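(* Let $(\beta,B)\in\Theta_1$, and let $(A_N)_{N\ge 1}$ be a sequence of coupling matrices such that $\max_{1\le i\le N}R_i\lesssim 1$ and $\lim_{N\to\infty}\lambda_1(A_N)=1$. If $\boldsymbol\sigma$ is a random vector from the Ising model $\mathbb P$ with parameters $(A_N,\beta,B)$, then $$d_{KS}\Big(\sqrt N(\overline{\boldsymbol\sigma}-t),Z_\tau\Big)\lesssim \frac1{\sqrt N}\left(\lVert A_N\rVert_F^2+\sum_{i=1}^N(R_i-1)^2+|t|\,\Big|\sum_{i=1}^N(R_i-1)\Big|\right),$$ where $Z_\tau\sim N(0,\tau)$ with $\tau=\frac{1-t^2}{1-\beta(1-t^2)}$.
   Context: A coupling matrix $A_N$ is a symmetric $N\times N$ matrix with non-negative entries and zeros on the diagonal. The Ising model with parameters $(A_N,\beta,B)$, $\beta>0$, $B\in\mathbb R$, is the probability mass function on $\boldsymbol\sigma=(\sigma_1,\dots,\sigma_N)\in\{-1,1\}^N$ given by $\mathbb P(\boldsymbol\sigma)=\frac1{Z_N(\beta,B)}\exp\big(\frac\beta2\boldsymbol\sigma^\top A_N\boldsymbol\sigma+B\sum_{i=1}^N\sigma_i\big)$. Put $\overline{\boldsymbol\sigma}=\frac1N\sum_{i=1}^N\sigma_i$, $R_i=\sum_{j=1}^NA_N(i,j)$, $\lambda_1(A_N)\ge\dots\ge\lambda_N(A_N)$ the eigenvalues, $\lVert\cdot\rVert_F$ the Frobenius norm. Parameter regimes: $\Theta_{11}=\{(\beta,0):0<\beta<1\}$, $\Theta_{12}=\{(\beta,B):\beta>0,B\ne0\}$,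 $\Theta_1=\Theta_{11}\cup\Theta_{12}$. For $(\beta,B)\in\Theta_{11}$ put $t=0$; for $(\beta,B)\in\Theta_{12}$, $t$ is the unique solution of $x=\tanh(\beta x+B)$ having the same sign as $B$. $d_{KS}(X,Y)=\sup_{x\in\mathbb R}|\mathbb P(X\le x)-\mathbb P(Y\le x)|$. $x_N\lesssim y_N$ means there is a finite constant $C$ free of $N$ (it may depend on $\beta,B$ and on the sequence $(A_N)$) with $x_N\le Cy_N$ for all $N$. *)

theory Defs
  imports "HOL-Probability.Probability" "Jordan_Normal_Form.Spectral_Radius"
begin

(* "$" and vec_index refer to the vectors of Jordan_Normal_Form, whose indices start at 0:
   the sites 1, ..., N of the model are 0, ..., N - 1 here. *)
unbundle no vec_syntax

definition lesssim :: "(nat \<Rightarrow> real) \<Rightarrow> (nat \<Rightarrow> real) \<Rightarrow> bool" where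
  "lesssim x y \<longleftrightarrow> (\<exists>C. \<forall>N\<ge>1. x N \<le> C * y N)"

definition coupling_matrix :: "nat \<Rightarrow> real mat \<Rightarrow> bool" where
  "coupling_matrix N A \<longleftrightarrow>
     A \<in> carrier_mat N N \<and> transpose_mat A = A \<and>
     (\<forall>i<N. \<forall>j<N. A $$ (i, j) \<ge> 0) \<and> (\<forall>i<N. A $$ (i, i) = 0)"

definition row_sum :: "real mat \<Rightarrow> nat \<Rightarrow> real" where
  "row_sum A i = (\<Sum>j<dim_col A. A $$ (i, j))"

definition frobenius_norm :: "real mat \<Rightarrow> real" where
  "frobenius_norm A = sqrt (\<Sum>i<dim_row A. \<Sum>j<dim_col A. (A $$ (i, j))\<^sup>2)"

(* Only used for symmetric matrices of positive size, whose set of real eigenvalues is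
   finite and non-empty. *)
definition lambda_1 :: "real mat \<Rightarrow> real" where
  "lambda_1 A = Max (spectrum A)"

definition spins :: "nat \<Rightarrow> real vec set" where
  "spins N = {\<sigma> \<in> carrier_vec N. \<forall>i<N. \<sigma> $ i \<in> {-1, 1}}"

definition ising_weight :: "real mat \<Rightarrow> real \<Rightarrow> real \<Rightarrow> real vec \<Rightarrow> real" where
  "ising_weight A \<beta> B \<sigma> =
     exp (\<beta> / 2 * scalar_prod \<sigma> (A *\<^sub>v \<sigma>) + B * (\<Sum>i<dim_vec \<sigma>. \<sigma> $ i))"

definition partition_function :: "real mat \<Rightarrow> real \<Rightarrow> real \<Rightarrow> real" where
  "partition_function A \<beta> B = (\<Sum>\<sigma>\<in>spins (dim_row A). ising_weight A \<beta> B \<sigma>)"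

definition ising :: "real mat \<Rightarrow> real \<Rightarrow> real \<Rightarrow> real vec pmf" where
  "ising A \<beta> B = embed_pmf (\<lambda>\<sigma>.
     if \<sigma> \<in> spins (dim_row A) then ising_weight A \<beta> B \<sigma> / partition_function A \<beta> B else 0)"

lemma finite_spins: "finite (spins N)"
proof (rule finite_subset)
  show "spins N \<subseteq> vec N ` (PiE {..<N} (\<lambda>_. {-1, 1}))"
  proof
    fix \<sigma> assume s: "\<sigma> \<in> spins N"
    have "\<sigma> = vec N (restrict (vec_index \<sigma>) {..<N})"
      using s by (auto simp: spins_def)
    moreover have "restrict (vec_index \<sigma>) {..<N} \<in> PiE {..<N} (\<lambda>_. {-1, 1})"
      using s by (auto simp: spins_def)
    ultimately show "\<sigma> \<in> vec N ` (PiE {..<N} (\<lambda>_. {-1, 1}))" by blast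
  qed
  show "finite (vec N ` (PiE {..<N} (\<lambda>_. {-1, 1 :: real})))"
    by (intro finite_imageI finite_PiE) auto
qed

lemma partition_function_pos: "partition_function A \<beta> B > 0"
proof -
  have "vec (dim_row A) (\<lambda>_. 1) \<in> spins (dim_row A)"
    by (auto simp: spins_def)
  then show ?thesis
    unfolding partition_function_def
    by (intro sum_pos finite_spins) (auto simp: ising_weight_def)
qed

lemma pmf_ising:
  "pmf (ising A \<beta> B) \<sigma> =
     (if \<sigma> \<in> spins (dim_row A) then ising_weight A \<beta> B \<sigma> / partition_function A \<beta> B else 0)"
proof -
  let ?f = "\<lambda>\<sigma>. if \<sigma> \<in> spins (dim_row A)
    then ising_weight A \<beta> B \<sigma> / partition_function A \<beta> B else 0"
  have nonneg: "0 \<le> ?f \<sigma>" for \<sigma>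
    using partition_function_pos[of A \<beta> B] by (auto simp: ising_weight_def)
  have "(\<integral>\<^sup>+\<sigma>. ennreal (?f \<sigma>) \<partial>count_space UNIV) = (\<Sum>\<sigma>\<in>spins (dim_row A). ennreal (?f \<sigma>))"
    by (rule nn_integral_count_space'[OF finite_spins]) auto
  also have "\<dots> = ennreal (\<Sum>\<sigma>\<in>spins (dim_row A). ?f \<sigma>)"
    by (rule sum_ennreal[OF nonneg])
  also have "(\<Sum>\<sigma>\<in>spins (dim_row A). ?f \<sigma>) =
      (\<Sum>\<sigma>\<in>spins (dim_row A). ising_weight A \<beta> B \<sigma> / partition_function A \<beta> B)"
    by (rule sum.cong) auto
  also have "\<dots> = partition_function A \<beta> B / partition_function A \<beta> B"
    by (simp only: partition_function_def sum_divide_distrib)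
  also have "\<dots> = 1"
    using partition_function_pos[of A \<beta> B] by simp
  finally show ?thesis
    unfolding ising_def by (subst pmf_embed_pmf) (use nonneg in auto)
qed

definition spin_mean :: "real vec \<Rightarrow> real" where
  "spin_mean \<sigma> = (\<Sum>i<dim_vec \<sigma>. \<sigma> $ i) / real (dim_vec \<sigma>)"

definition Theta11 :: "(real \<times> real) set" where
  "Theta11 = {(\<beta>, B). 0 < \<beta> \<and> \<beta> < 1 \<and> B = 0}"

definition Theta12 :: "(real \<times> real) set" where
  "Theta12 = {(\<beta>, B). \<beta> > 0 \<and> B \<noteq> 0}"

definition Theta1 :: "(real \<times> real) set" where
  "Theta1 = Theta11 \<union> Theta12"

definition magnetization :: "real \<Rightarrow> real \<Rightarrow> real" where
  "magnetization \<beta> B =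
     (if (\<beta>, B) \<in> Theta11 then 0
      else (THE x. x = tanh (\<beta> * x + B) \<and> sgn x = sgn B))"

lemma ex1_mean_field_pos:
  fixes \<beta> B :: real
  assumes b: "\<beta> > 0" and B: "B > 0"
  shows "\<exists>!x. x = tanh (\<beta> * x + B) \<and> x > 0"
proof -
  let ?g = "\<lambda>x. tanh (\<beta> * x + B)"
  have der: "(?g has_real_derivative (1 - (?g x)\<^sup>2) * \<beta>) (at x)" for x
    by (auto intro!: derivative_eq_intros)
  have cont: "continuous_on {0..1} (\<lambda>x. ?g x - x)"
    by (intro continuous_intros) auto
  have "\<exists>x\<ge>0. x \<le> 1 \<and> ?g x - x = 0"
    by (rule IVT2'[OF _ _ _ cont]) (use B tanh_real_lt_1[of "\<beta> + B"] in auto)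
  then obtain x where x: "x \<ge> 0" "?g x = x" by auto
  have "x \<noteq> 0" using x(2) B by auto
  with x have ex: "x = ?g x \<and> x > 0" by auto
  have no: False if p: "0 < x" "x < y" "x = ?g x" "y = ?g y" for x y
  proof -
    obtain u where u: "0 < u" "u < x" "?g x - ?g 0 = (x - 0) * ((1 - (?g u)\<^sup>2) * \<beta>)"
      using MVT2[OF p(1), of ?g "\<lambda>x. (1 - (?g x)\<^sup>2) * \<beta>"] der by blast
    obtain v where v: "x < v" "v < y" "?g y - ?g x = (y - x) * ((1 - (?g v)\<^sup>2) * \<beta>)"
      using MVT2[OF p(2), of ?g "\<lambda>x. (1 - (?g x)\<^sup>2) * \<beta>"] der by blast
    have "?g 0 > 0" using B by simp
    then have "x * ((1 - (?g u)\<^sup>2) * \<beta>) < x * 1"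
      using u(3) p(3) unfolding diff_zero mult_1_right by linarith
    then have 1: "(1 - (?g u)\<^sup>2) * \<beta> < 1"
      using p(1) mult_less_cancel_left_pos by blast
    have "(y - x) * ((1 - (?g v)\<^sup>2) * \<beta>) = (y - x) * 1"
      using v(3) p(3,4) unfolding mult_1_right by linarith
    then have 2: "(1 - (?g v)\<^sup>2) * \<beta> = 1"
      using p(2) by (subst (asm) mult_cancel_left) simp
    have "0 \<le> ?g u" using b B u by simp
    moreover have "?g u \<le> ?g v" using b u v by simp
    ultimately have "(?g u)\<^sup>2 \<le> (?g v)\<^sup>2" by (rule power_mono[rotated])
    then have "(1 - (?g v)\<^sup>2) * \<beta> \<le> (1 - (?g u)\<^sup>2) * \<beta>"
      using b by (intro mult_right_mono) auto
    with 1 2 show False by simp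
  qed
  show ?thesis
  proof (rule ex1I[of _ x])
    fix y assume "y = ?g y \<and> y > 0"
    then show "y = x" using no[of x y] no[of y x] ex by (cases x y rule: linorder_cases) auto
  qed (use ex in auto)
qed

lemma ex1_mean_field:
  fixes \<beta> B :: real
  assumes b: "\<beta> > 0" and B: "B \<noteq> 0"
  shows "\<exists>!x. x = tanh (\<beta> * x + B) \<and> sgn x = sgn B"
proof (cases "B > 0")
  case True
  then have "sgn x = sgn B \<longleftrightarrow> x > 0" for x :: real by (auto simp: sgn_if)
  then show ?thesis using ex1_mean_field_pos[OF b True] by simp
next
  case False
  with B have neg: "- B > 0" by simp
  then have sg: "sgn x = sgn B \<longleftrightarrow> - x > 0" for x :: real by (auto simp: sgn_if)
  have eq: "x = tanh (\<beta> * x + B) \<longleftrightarrow> - x = tanh (\<beta> * (- x) + - B)" for x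
    using tanh_minus[of "\<beta> * x + B"] by auto
  obtain z where z: "z = tanh (\<beta> * z + - B) \<and> z > 0"
    and uniq: "\<And>y. y = tanh (\<beta> * y + - B) \<and> y > 0 \<Longrightarrow> y = z"
    using ex1_mean_field_pos[OF b neg] by blast
  show ?thesis
  proof (rule ex1I[of _ "- z"])
    show "- z = tanh (\<beta> * (- z) + B) \<and> sgn (- z) = sgn B"
      unfolding sg eq[of "- z"] using z by simp
    fix y assume "y = tanh (\<beta> * y + B) \<and> sgn y = sgn B"
    then have "- y = z" unfolding sg eq[of y] by (rule uniq)
    then show "y = - z" by simp
  qed
qed

(* The Kolmogorov-Smirnov distance of two random variables, as a function of their laws. *)
definition dKS :: "real measure \<Rightarrow> real measure \<Rightarrow> real" where
  "dKS \<mu> \<nu> = (SUP x. \<bar>cdf \<mu> x - cdf \<nu> x\<bar>)"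

(* N(0, v) is parametrised by its variance v, normal_density by the standard deviation. *)
definition centered_normal :: "real \<Rightarrow> real measure" where
  "centered_normal v = density lborel (\<lambda>x. ennreal (normal_density 0 (sqrt v) x))"

end

(* Resample one uniformly chosen spin: this gives an exchangeable pair, and Stein's method for
   exchangeable pairs (Shao-Zhang), with the remainder measured in L1, reduces the Berry-Esseen bound
   to second moments of the local fields m_i = sum_j A(i,j) sigma_j around t. Since
   E(sigma_i | rest) = tanh(beta m_i + B), the vector m solves the fixed point equation
   x = A tanh(beta x + B) up to an error of squared norm O(||A||_F^2) in mean, and a contraction
   argument with lambda_1(A) -> 1 gives E sum_i (m_i - t)^2 = O(||A||_F^2 + sum_i (R_i - 1)^2).
   For B = 0 and beta < 1 the map is a contraction on the whole line. For B > 0 it contracts towards t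
   only on the half line x >= 0, so the argument is run for the means E m_i, which are nonnegative,
   while the variances are controlled by the covariance inequality of GHS type: covariances are
   nonnegative and decrease in the field, hence every row of the covariance matrix sums to at most 2/B.
   The case B < 0 follows by the symmetry sigma -> -sigma. *)
theory Submission
  imports Defs
begin

section \<open>Gaussian tails and the Stein equation\<close>

text \<open>The Stein solution f of an indicator has a jump in f', so f(W') - f(W) admits no
  second-order Taylor expansion. Monotonicity takes its place: f'(w) is the sum of the nondecreasing
  w f(w) and a nonincreasing step, and interchanging the members of the pair turns the error into
  the drift of \<Delta> |\<Delta>|, \<Delta> being the jump of W. All flips have the same size, so
  that drift is a multiple of the sum of the centred spins and is of order sqrt N rather than N. The
  GHS ingredient is used between two fields h and h' instead of as a third derivative: of four
  replicas, two sit at each field. Concavity then compares the slope at B with a chord over [0, B],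
  and the values in [-1, 1] produce 2/B. The bracket ||A||_F^2 + sum_i (R_i - 1)^2 is at least 1/2
  for every N, because row sums near 1 force a Frobenius norm of order 1. This lets it absorb all
  contributions of order 1/sqrt N, and settles the finitely many N for which lambda_1 is still too
  large by the trivial bound d_KS \<le> 1.\<close>

abbreviation \<Phi> :: "real \<Rightarrow> real" where "\<Phi> \<equiv> cdf std_normal_distribution"
abbreviation \<phi> :: "real \<Rightarrow> real" where "\<phi> \<equiv> std_normal_density"

lemma std_normal_cdf_diff:
  assumes "a \<le> x"
  shows "\<Phi> x - \<Phi> a = integral {a..x} \<phi>"
proof (cases "a = x")
  case False
  with assms have ax: "a < x" by simp
  interpret real_distribution std_normal_distribution by (rule real_dist_normal_dist)
  have int: "integrable lborel \<phi>" by (rule integrable_normal_density) simp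
  have "\<Phi> x - \<Phi> a = measure std_normal_distribution {a<..x}"
    using cdf_diff_eq[OF ax] .
  also have "\<dots> = (\<integral>y. indicator {a<..x} y \<partial>std_normal_distribution)"
    by simp
  also have "\<dots> = (\<integral>y. \<phi> y *\<^sub>R indicator {a<..x} y \<partial>lborel)"
    by (rule integral_density) auto
  also have "\<dots> = (LINT y:{a<..x}|lborel. \<phi> y)"
    by (simp add: set_lebesgue_integral_def mult.commute)
  also have "\<dots> = integral {a<..x} \<phi>"
    by (intro set_borel_integral_eq_integral)
      (use integrable_mult_indicator[OF _ int, of "{a<..x}"] in \<open>simp add: set_integrable_def\<close>)
  also have "\<dots> = integral {a..x} \<phi>"
    by (rule integral_spike_set) (auto intro: negligible_subset[of "{a}"])
  finally show ?thesis .
qed simp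

lemma has_real_derivative_std_normal_cdf [derivative_intros]:
  "(\<Phi> has_real_derivative \<phi> x) (at x)"
proof -
  have "continuous_on {x - 1..x + 1} \<phi>"
    unfolding normal_density_def by (intro continuous_intros) auto
  from integral_has_real_derivative[OF this, of x]
  have "((\<lambda>y. integral {x - 1..y} \<phi>) has_real_derivative \<phi> x) (at x)"
    by (simp add: at_within_Icc_at)
  then have "((\<lambda>y. \<Phi> (x - 1) + integral {x - 1..y} \<phi>) has_real_derivative \<phi> x) (at x)"
    by (auto intro!: derivative_eq_intros)
  moreover have "\<forall>\<^sub>F y in nhds x. \<Phi> y = \<Phi> (x - 1) + integral {x - 1..y} \<phi>"
  proof -
    have "\<forall>\<^sub>F y in nhds x. y \<in> {x - 1<..}"
      by (intro eventually_nhds_in_open) auto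
    then show ?thesis
    proof eventually_elim
      case (elim y)
      then show ?case using std_normal_cdf_diff[of "x - 1" y] by simp
    qed
  qed
  ultimately show ?thesis
    by (subst DERIV_cong_ev[OF refl _ refl])
qed

lemma has_real_derivative_std_normal_density [derivative_intros]:
  "(\<phi> has_real_derivative - x * \<phi> x) (at x)"
proof -
  have "((\<lambda>x. 1 / sqrt (2 * pi) * exp (- x\<^sup>2 / 2)) has_real_derivative
      1 / sqrt (2 * pi) * (exp (- x\<^sup>2 / 2) * - x)) (at x)"
    by (intro DERIV_cmult DERIV_fun_exp) (auto intro!: derivative_eq_intros)
  then show ?thesis
    unfolding std_normal_density_def[abs_def] by (simp add: mult_ac)
qed

lemma std_normal_density_tendsto_0: "(\<phi> \<longlongrightarrow> 0) at_top"
proof -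
  have "((\<lambda>x::real. exp (- x\<^sup>2 / 2)) \<longlongrightarrow> 0) at_top" by real_asymp
  from tendsto_mult_left[OF this, of "1 / sqrt (2 * pi)"] show ?thesis
    by (simp add: std_normal_density_def[abs_def])
qed

lemma std_normal_cdf_tendsto_1: "(\<Phi> \<longlongrightarrow> 1) at_top"
  by (rule real_distribution.cdf_lim_at_top_prob[OF real_dist_normal_dist])

lemma std_normal_density_pos: "\<phi> x > 0"
  by (rule normal_density_pos) simp

lemma std_normal_cdf_nonneg: "0 \<le> \<Phi> x" and std_normal_cdf_le_1: "\<Phi> x \<le> 1"
proof -
  interpret real_distribution std_normal_distribution by (rule real_dist_normal_dist)
  show "0 \<le> \<Phi> x" by (rule cdf_nonneg)
  show "\<Phi> x \<le> 1" by (rule cdf_bounded_prob)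
qed

lemma std_normal_cdf_mono: "x \<le> y \<Longrightarrow> \<Phi> x \<le> \<Phi> y"
proof -
  interpret real_distribution std_normal_distribution by (rule real_dist_normal_dist)
  show "x \<le> y \<Longrightarrow> \<Phi> x \<le> \<Phi> y" by (rule cdf_nondecreasing)
qed

lemma std_normal_density_minus: "\<phi> (- x) = \<phi> x"
  by (simp add: normal_density_def)

text \<open>The sum \<Phi>(x) + \<Phi>(-x) has derivative 0 because the density is even, and its
  limit at infinity is 1.\<close>

lemma std_normal_cdf_minus: "\<Phi> (- x) = 1 - \<Phi> x"
proof -
  let ?h = "\<lambda>x. \<Phi> x + \<Phi> (- x)"
  have der: "(?h has_real_derivative 0) (at x)" for x
  proof -
    have "((\<lambda>x. \<Phi> (- x)) has_real_derivative \<phi> (- x) * - 1) (at x)"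
      by (rule DERIV_chain2[OF has_real_derivative_std_normal_cdf]) (auto intro!: derivative_eq_intros)
    from DERIV_add[OF has_real_derivative_std_normal_cdf this] show ?thesis
      by (simp add: std_normal_density_minus)
  qed
  have const: "?h y = ?h x" for y
    by (rule DERIV_isconst_all) (use der in blast)
  have bot: "(\<Phi> \<longlongrightarrow> 0) at_bot"
    by (rule finite_borel_measure.cdf_lim_at_bot)
      (use real_dist_normal_dist in \<open>simp add: real_distribution.finite_borel_measure_M\<close>)
  have "((\<lambda>y. \<Phi> y + \<Phi> (- y)) \<longlongrightarrow> 1 + 0) at_top"
    by (intro tendsto_add std_normal_cdf_tendsto_1 filterlim_compose[OF bot] filterlim_uminus_at_bot_at_top)
  moreover have "(\<lambda>y. \<Phi> y + \<Phi> (- y)) = (\<lambda>y. ?h x)"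
    using const by blast
  ultimately have "((\<lambda>y::real. ?h x) \<longlongrightarrow> 1) at_top"
    by simp
  then have "?h x = 1"
    by (simp add: tendsto_const_iff)
  then show ?thesis by simp
qed

section \<open>Two-sided bounds for the Gaussian tail\<close>

lemma mills_upper:
  assumes "x > 0"
  shows "x * (1 - \<Phi> x) \<le> \<phi> x"
proof -
  let ?h = "\<lambda>x. \<phi> x / x - (1 - \<Phi> x)"
  \<comment> \<open>The derivative is -\<phi>(y)/y^2, and a strictly decreasing function with limit
    0 at infinity is positive.\<close>
  have "0 < ?h x"
  proof (rule DERIV_neg_imp_decreasing_at_top[where f = ?h and b = x])
    fix y assume "x \<le> y"
    with assms have y: "y > 0" by simp
    have "(?h has_real_derivative - \<phi> y / y\<^sup>2) (at y)"
    proof -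
      have "(?h has_real_derivative (- y * \<phi> y * y - \<phi> y * 1) / (y * y) - (0 - \<phi> y)) (at y)"
        using y by (intro DERIV_diff DERIV_divide DERIV_const DERIV_ident
            has_real_derivative_std_normal_density has_real_derivative_std_normal_cdf) auto
      moreover have "(- y * \<phi> y * y - \<phi> y * 1) / (y * y) - (0 - \<phi> y) = - \<phi> y / y\<^sup>2"
        using y by (simp add: field_simps power2_eq_square)
      ultimately show ?thesis by simp
    qed
    moreover have "- \<phi> y / y\<^sup>2 < 0" using y std_normal_density_pos[of y] by simp
    ultimately show "\<exists>d. (?h has_real_derivative d) (at y) \<and> d < 0" by blast
  next
    have "(?h \<longlongrightarrow> 0 - (1 - 1)) at_top"
      by (intro tendsto_diff tendsto_const std_normal_cdf_tendsto_1
          real_tendsto_divide_at_top[OF std_normal_density_tendsto_0] filterlim_ident)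
    then show "(?h \<longlongrightarrow> 0) at_top" by simp
  qed
  with assms show ?thesis by (simp add: field_simps)
qed

text \<open>Same device as for the upper bound: the defect tends to 0 at infinity and its derivative
  collapses to -2 \<phi>(x) / (1 + x^2)^2. This lower bound is what makes
  \<open>w * mills_left w\<close> monotone.\<close>

lemma mills_lower: "x * \<phi> x \<le> (1 + x\<^sup>2) * (1 - \<Phi> x)"
proof -
  let ?h = "\<lambda>x. (1 - \<Phi> x) - x / (1 + x\<^sup>2) * \<phi> x"
  have nz: "1 + y\<^sup>2 > 0" for y :: real by (simp add: add_pos_nonneg)
  have "0 < ?h x"
  proof (rule DERIV_neg_imp_decreasing_at_top[where f = ?h and b = x])
    fix y :: real
    have "(?h has_real_derivative (0 - \<phi> y) -
        ((1 * (1 + y\<^sup>2) - y * (2 * y)) / ((1 + y\<^sup>2) * (1 + y\<^sup>2)) * \<phi> y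
          + (- y * \<phi> y) * (y / (1 + y\<^sup>2)))) (at y)"
      using nz[of y]
      by (intro DERIV_diff DERIV_mult DERIV_divide DERIV_const DERIV_ident
            has_real_derivative_std_normal_density has_real_derivative_std_normal_cdf)
         (auto intro!: derivative_eq_intros)
    \<comment> \<open>The denominator is kept as a variable w, so that clearing fractions does not
      expand 1 + y^2.\<close>
    moreover have "(0 - p) - ((1 * w - y * (2 * y)) / (w * w) * p + (- y * p) * (y / w)) = - 2 * p / w\<^sup>2"
      if "w > 0" "w = 1 + y * y" for w p
    proof -
      have "(0 - p) - ((1 * w - y * (2 * y)) / (w * w) * p + (- y * p) * (y / w))
          = (- p * w * w - (w - 2 * (y * y)) * p + (y * y) * p * w) / w\<^sup>2"
        using that(1) by (simp add: field_simps power2_eq_square)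
      also have "- p * w * w - (w - 2 * (y * y)) * p + (y * y) * p * w = - 2 * p"
        unfolding that(2) by (simp add: algebra_simps)
      finally show ?thesis .
    qed
    from this[of "1 + y\<^sup>2" "\<phi> y"] have "(0 - \<phi> y) -
        ((1 * (1 + y\<^sup>2) - y * (2 * y)) / ((1 + y\<^sup>2) * (1 + y\<^sup>2)) * \<phi> y
          + (- y * \<phi> y) * (y / (1 + y\<^sup>2))) = - 2 * \<phi> y / (1 + y\<^sup>2)\<^sup>2"
      using nz[of y] by (simp only: power2_eq_square)
    ultimately have "(?h has_real_derivative - 2 * \<phi> y / (1 + y\<^sup>2)\<^sup>2) (at y)"
      by (simp only:)
    moreover have "- 2 * \<phi> y / (1 + y\<^sup>2)\<^sup>2 < 0"
      using nz[of y] std_normal_density_pos[of y] by (simp add: divide_neg_pos)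
    ultimately show "\<exists>d. (?h has_real_derivative d) (at y) \<and> d < 0" by blast
  next
    have "((\<lambda>x::real. x / (1 + x\<^sup>2)) \<longlongrightarrow> 0) at_top"
      by real_asymp
    then have "(?h \<longlongrightarrow> (1 - 1) - 0 * 0) at_top"
      by (intro tendsto_diff tendsto_mult tendsto_const std_normal_cdf_tendsto_1
          std_normal_density_tendsto_0)
    then show "(?h \<longlongrightarrow> 0) at_top" by simp
  qed
  then have "x / (1 + x\<^sup>2) * \<phi> x \<le> 1 - \<Phi> x" by simp
  from mult_left_mono[OF this, of "1 + x\<^sup>2"] nz[of x] show ?thesis by simp
qed

section \<open>Mills ratios and the solution of the Stein equation\<close>

definition mills_left :: "real \<Rightarrow> real" where "mills_left w = \<Phi> w / \<phi> w"
definition mills_right :: "real \<Rightarrow> real" where "mills_right w = (1 - \<Phi> w) / \<phi> w"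

lemma mills_left_minus: "mills_left (- w) = mills_right w"
  by (simp add: mills_left_def mills_right_def std_normal_cdf_minus std_normal_density_minus)

lemma mills_left_nonneg: "0 \<le> mills_left w" and mills_right_nonneg: "0 \<le> mills_right w"
  using std_normal_density_pos[of w] std_normal_cdf_nonneg[of w] std_normal_cdf_le_1[of w]
  by (auto simp: mills_left_def mills_right_def)

lemma mills_right_le: "x > 0 \<Longrightarrow> x * mills_right x \<le> 1"
  using mills_upper[of x] std_normal_density_pos[of x] by (simp add: mills_right_def)

lemma mills_right_ge: "x \<le> (1 + x\<^sup>2) * mills_right x"
  using mills_lower[of x] std_normal_density_pos[of x] by (simp add: mills_right_def field_simps)

lemma mills_left_ge: "- x \<le> (1 + x\<^sup>2) * mills_left x"
  using mills_right_ge[of "- x"] mills_left_minus[of "- x"] by simp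

lemma has_real_derivative_mills_left:
  "(mills_left has_real_derivative 1 + w * mills_left w) (at w)"
proof -
  have nz: "\<phi> w \<noteq> 0" using std_normal_density_pos[of w] by simp
  have "((\<lambda>w. \<Phi> w / \<phi> w) has_real_derivative
      (\<phi> w * \<phi> w - \<Phi> w * (- w * \<phi> w)) / (\<phi> w * \<phi> w)) (at w)"
    by (intro DERIV_divide has_real_derivative_std_normal_density has_real_derivative_std_normal_cdf nz)
  moreover have "(\<phi> w * \<phi> w - \<Phi> w * (- w * \<phi> w)) / (\<phi> w * \<phi> w) = 1 + w * (\<Phi> w / \<phi> w)"
    using nz by (simp add: field_simps)
  ultimately show ?thesis by (simp add: mills_left_def[abs_def])
qed

lemma has_real_derivative_mills_right:
  "(mills_right has_real_derivative w * mills_right w - 1) (at w)"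
proof -
  have "((\<lambda>w. mills_left (- w)) has_real_derivative (1 + (- w) * mills_left (- w)) * - 1) (at w)"
    by (rule DERIV_chain2[OF has_real_derivative_mills_left]) (auto intro!: derivative_eq_intros)
  then show ?thesis by (simp add: mills_left_minus)
qed

text \<open>By the equation M' = 1 + w M, the derivative of w M is (1 + w^2) M + w, and
  \<open>mills_left_ge\<close> is exactly its nonnegativity.\<close>

lemma mono_times_mills_left:
  assumes "x \<le> y"
  shows "x * mills_left x \<le> y * mills_left y"
proof (rule DERIV_nonneg_imp_nondecreasing[OF assms])
  fix w
  have "((\<lambda>w. w * mills_left w) has_real_derivative 1 * mills_left w + (1 + w * mills_left w) * w) (at w)"
    by (intro DERIV_mult DERIV_ident has_real_derivative_mills_left)
  moreover have "0 \<le> 1 * mills_left w + (1 + w * mills_left w) * w"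
    using mills_left_ge[of w] by (simp add: algebra_simps power2_eq_square)
  ultimately show "\<exists>d. ((\<lambda>w. w * mills_left w) has_real_derivative d) (at w) \<and> 0 \<le> d" by blast
qed

lemma mono_times_mills_right: "x \<le> y \<Longrightarrow> x * mills_right x \<le> y * mills_right y"
  using mono_times_mills_left[of "- y" "- x"] by (simp add: mills_left_minus)

text \<open>The bounded solution of f'(w) - w f(w) = 1{w \<le> z} - \<Phi>(z). The branches agree at
  w = z, where f' jumps.\<close>

definition stein_solution :: "real \<Rightarrow> real \<Rightarrow> real" where
  "stein_solution z w =
     (if w \<le> z then mills_left w * (1 - \<Phi> z) else mills_right w * \<Phi> z)"

lemma stein_solution_left: "w \<le> z \<Longrightarrow> stein_solution z w = mills_left w * (1 - \<Phi> z)"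
  by (simp add: stein_solution_def)

lemma stein_solution_right: "z \<le> w \<Longrightarrow> stein_solution z w = mills_right w * \<Phi> z"
  by (cases "w = z") (auto simp: stein_solution_def mills_left_def mills_right_def)

text \<open>Both branches are monotone and agree at z, so a pair on opposite sides of z is compared
  through z.\<close>

lemma mono_times_stein_solution:
  assumes "x \<le> y"
  shows "x * stein_solution z x \<le> y * stein_solution z y"
proof -
  have Q: "0 \<le> 1 - \<Phi> z" using std_normal_cdf_le_1[of z] by simp
  have l: "x * stein_solution z x \<le> y * stein_solution z y" if "x \<le> y" "y \<le> z" for x y
    using mult_right_mono[OF mono_times_mills_left[OF that(1)] Q] that
    by (simp add: stein_solution_left mult.assoc)
  have r: "x * stein_solution z x \<le> y * stein_solution z y" if "x \<le> y" "z \<le> x" for x y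
    using mult_right_mono[OF mono_times_mills_right[OF that(1)] std_normal_cdf_nonneg[of z]] that
    by (simp add: stein_solution_right mult.assoc)
  show ?thesis
    using l[of x y] r[of x y] l[of x z] r[of z y] assms by linarith
qed

text \<open>It is enough to treat w \<le> z, since (w, z) -> (-w, -z) exchanges the branches. For
  negative w this is the upper Mills bound itself; for positive w, enlarging 1 - \<Phi>(z) to 1 -
  \<Phi>(w) turns the solution into \<open>mills_right w * \<Phi> w\<close>.\<close>

lemma abs_times_stein_solution_le: "\<bar>w * stein_solution z w\<bar> \<le> 1"
proof -
  have p01: "a * b \<le> 1" if "0 \<le> a" "a \<le> 1" "0 \<le> b" "b \<le> 1" for a b :: real
    using mult_mono[of a 1 b 1] that by simp
  have main: "\<bar>w * (mills_left w * (1 - \<Phi> z))\<bar> \<le> 1" if "w \<le> z" for w z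
  proof -
    note bnd = std_normal_cdf_nonneg[of z] std_normal_cdf_le_1[of z]
    consider "w < 0" | "w = 0" | "w > 0" by linarith
    then show ?thesis
    proof cases
      case 1
      then have "(- w) * mills_left w \<le> 1"
        using mills_right_le[of "- w"] mills_left_minus[of "- w"] by simp
      moreover have "0 \<le> (- w) * mills_left w"
        using 1 mills_left_nonneg[of w] by (intro mult_nonneg_nonneg) auto
      ultimately have "((- w) * mills_left w) * (1 - \<Phi> z) \<le> 1"
        using bnd p01[of "(- w) * mills_left w" "1 - \<Phi> z"] by linarith
      moreover have "0 \<le> (- w * mills_left w) * (1 - \<Phi> z)"
        using 1 mills_left_nonneg[of w] bnd by (intro mult_nonneg_nonneg) auto
      ultimately show ?thesis by (simp add: mult.assoc)
    next
      case 3
      have "mills_left w * (1 - \<Phi> z) \<le> mills_left w * (1 - \<Phi> w)"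
        using mills_left_nonneg[of w] std_normal_cdf_mono[OF that] by (intro mult_left_mono) auto
      also have "\<dots> = mills_right w * \<Phi> w"
        by (simp add: mills_left_def mills_right_def)
      finally have "w * (mills_left w * (1 - \<Phi> z)) \<le> (w * mills_right w) * \<Phi> w"
        using 3 by (simp add: mult.assoc)
      also have "\<dots> \<le> 1"
        using mills_right_le[OF 3] mult_nonneg_nonneg[OF less_imp_le[OF 3] mills_right_nonneg[of w]]
          std_normal_cdf_nonneg[of w] std_normal_cdf_le_1[of w] p01[of "w * mills_right w" "\<Phi> w"]
        by linarith
      finally show ?thesis
        using 3 mills_left_nonneg[of w] bnd by (simp add: abs_of_nonneg)
    qed simp
  qed
  show ?thesis
  proof (cases "w \<le> z")
    case True
    then show ?thesis using main[OF True] by (simp add: stein_solution_left)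
  next
    case False
    then show ?thesis using main[of "- w" "- z"]
      by (simp add: stein_solution_right mills_left_minus std_normal_cdf_minus)
  qed
qed

text \<open>Away from [-1, 1] the bound on w f(w) gives |f| \<le> 1. On [-1, 1] the reciprocal
  density is at most sqrt(2 pi) e^(1/2) \<le> 3 * 5/3, which is the source of the 5.\<close>

lemma stein_solution_le: "\<bar>stein_solution z w\<bar> \<le> 5"
proof (cases "\<bar>w\<bar> \<le> 1")
  case True
  have "exp (1 / 2 :: real) \<le> 5 / 3"
  proof -
    have "exp (1 / 2 :: real) ^ 2 = exp 1" by (simp flip: exp_double)
    also have "\<dots> \<le> (5 / 3)\<^sup>2" using e_less_272 by (simp add: power2_eq_square)
    finally show ?thesis by (rule power2_le_imp_le) simp
  qed
  moreover have "sqrt (2 * pi) \<le> 3"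
    by (rule real_le_lsqrt) (use pi_less_4 pi_gt_zero in auto)
  ultimately have "sqrt (2 * pi) * exp (1 / 2) \<le> 3 * (5 / 3)"
    by (intro mult_mono) auto
  moreover have "1 / \<phi> w \<le> sqrt (2 * pi) * exp (1 / 2)"
    using True abs_square_le_1[of w]
    by (simp add: std_normal_density_def exp_minus field_simps)
  ultimately have 5: "1 / \<phi> w \<le> 5" by simp
  have p: "\<bar>a / \<phi> w * b\<bar> \<le> 1 / \<phi> w" if "0 \<le> a" "a \<le> 1" "0 \<le> b" "b \<le> 1" for a b
  proof -
    have "a * b \<le> 1" using mult_mono[of a 1 b 1] that by simp
    then show ?thesis using that std_normal_density_pos[of w]
      by (simp add: abs_mult divide_right_mono)
  qed
  have "\<bar>stein_solution z w\<bar> \<le> 1 / \<phi> w"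
    using p[of "\<Phi> w" "1 - \<Phi> z"] p[of "1 - \<Phi> w" "\<Phi> z"]
      std_normal_cdf_nonneg[of w] std_normal_cdf_le_1[of w]
      std_normal_cdf_nonneg[of z] std_normal_cdf_le_1[of z]
    unfolding stein_solution_def mills_left_def mills_right_def by (cases "w \<le> z") simp_all
  with 5 show ?thesis by linarith
next
  case False
  then have "\<bar>stein_solution z w\<bar> \<le> \<bar>w\<bar> * \<bar>stein_solution z w\<bar>"
    using mult_right_mono[of 1 "\<bar>w\<bar>" "\<bar>stein_solution z w\<bar>"] by simp
  with abs_times_stein_solution_le[of w z] show ?thesis by (simp add: abs_mult)
qed

text \<open>The Stein equation splits the derivative of the solution into the increasing part
  \<open>w * stein_solution z w\<close> and the decreasing part \<open>stein_rhs z w\<close>.\<close>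

definition stein_rhs :: "real \<Rightarrow> real \<Rightarrow> real" where
  "stein_rhs z w = (if w \<le> z then 1 else 0) - \<Phi> z"

lemma abs_stein_rhs_le: "\<bar>stein_rhs z w\<bar> \<le> 1"
  using std_normal_cdf_nonneg[of z] std_normal_cdf_le_1[of z] by (auto simp: stein_rhs_def)

lemma stein_rhs_antimono: "x \<le> y \<Longrightarrow> stein_rhs z y \<le> stein_rhs z x"
  by (auto simp: stein_rhs_def)

text \<open>f' is the increasing w f(w) plus the decreasing \<open>stein_rhs\<close>, so each of its
  values on (y, x) lies between the two mixed endpoint sums. These bounds do the work of a second
  derivative, which f lacks at z.\<close>

lemma stein_solution_diff:
  assumes "y \<le> x"
  shows "(x - y) * (y * stein_solution z y + stein_rhs z x) \<le> stein_solution z x - stein_solution z y"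
    and "stein_solution z x - stein_solution z y \<le> (x - y) * (x * stein_solution z x + stein_rhs z y)"
proof -
  let ?f = "stein_solution z" and ?k = "stein_rhs z"
  define P where "P x y \<longleftrightarrow> (x - y) * (y * ?f y + ?k x) \<le> ?f x - ?f y \<and>
     ?f x - ?f y \<le> (x - y) * (x * ?f x + ?k y)" for x y
  \<comment> \<open>\<open>P0\<close> packages the mean value theorem: d is the derivative of the
    branch in force, to be trapped between the endpoint expressions.\<close>
  have P0: "P x y" if "y \<le> x" "\<And>c. y < c \<Longrightarrow> c < x \<Longrightarrow> ?f x - ?f y = (x - y) * d c \<longrightarrow>
      y * ?f y + ?k x \<le> d c \<and> d c \<le> x * ?f x + ?k y"
    and ex: "y < x \<Longrightarrow> \<exists>c. y < c \<and> c < x \<and> ?f x - ?f y = (x - y) * d c" for x y d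
  proof (cases "y = x")
    case False
    with that(1) have "y < x" by simp
    from ex[OF this] obtain c where c: "y < c" "c < x" "?f x - ?f y = (x - y) * d c" by blast
    with that(2)[OF c(1,2)] have "y * ?f y + ?k x \<le> d c" "d c \<le> x * ?f x + ?k y" by auto
    then show ?thesis
      unfolding P_def c(3) using \<open>y < x\<close> by (auto intro!: mult_left_mono)
  qed (simp add: P_def)
  have l: "P x y" if "y \<le> x" "x \<le> z" for x y
  proof (rule P0[where d = "\<lambda>c. (1 + c * mills_left c) * (1 - \<Phi> z)"])
    assume "y < x"
    have "\<exists>c>y. c < x \<and> mills_left x * (1 - \<Phi> z) - mills_left y * (1 - \<Phi> z) =
        (x - y) * ((1 + c * mills_left c) * (1 - \<Phi> z))"
      by (rule MVT2[OF \<open>y < x\<close>])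
        (intro DERIV_cmult_right has_real_derivative_mills_left)
    with that show "\<exists>c. y < c \<and> c < x \<and> ?f x - ?f y = (x - y) * ((1 + c * mills_left c) * (1 - \<Phi> z))"
      by (simp add: stein_solution_left)
  next
    fix c assume c: "y < c" "c < x"
    with that have "y * ?f y \<le> c * ?f c" "c * ?f c \<le> x * ?f x"
      by (auto intro!: mono_times_stein_solution)
    moreover have "(1 + c * mills_left c) * (1 - \<Phi> z) = c * ?f c + (1 - \<Phi> z)"
      using c that by (simp add: stein_solution_left algebra_simps)
    ultimately show "?f x - ?f y = (x - y) * ((1 + c * mills_left c) * (1 - \<Phi> z)) \<longrightarrow>
       y * ?f y + ?k x \<le> (1 + c * mills_left c) * (1 - \<Phi> z) \<and>
       (1 + c * mills_left c) * (1 - \<Phi> z) \<le> x * ?f x + ?k y"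
      using that by (auto simp: stein_rhs_def)
  qed (rule that)
  have r: "P x y" if "y \<le> x" "z \<le> y" for x y
  proof (rule P0[where d = "\<lambda>c. (c * mills_right c - 1) * \<Phi> z"])
    assume "y < x"
    have "\<exists>c>y. c < x \<and> mills_right x * \<Phi> z - mills_right y * \<Phi> z =
        (x - y) * ((c * mills_right c - 1) * \<Phi> z)"
      by (rule MVT2[OF \<open>y < x\<close>])
        (intro DERIV_cmult_right has_real_derivative_mills_right)
    with that show "\<exists>c. y < c \<and> c < x \<and> ?f x - ?f y = (x - y) * ((c * mills_right c - 1) * \<Phi> z)"
      by (simp add: stein_solution_right)
  next
    fix c assume c: "y < c" "c < x"
    with that have "y * ?f y \<le> c * ?f c" "c * ?f c \<le> x * ?f x"
      by (auto intro!: mono_times_stein_solution)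
    moreover have "(c * mills_right c - 1) * \<Phi> z = c * ?f c - \<Phi> z"
      using c that by (simp add: stein_solution_right algebra_simps)
    ultimately show "?f x - ?f y = (x - y) * ((c * mills_right c - 1) * \<Phi> z) \<longrightarrow>
       y * ?f y + ?k x \<le> (c * mills_right c - 1) * \<Phi> z \<and>
       (c * mills_right c - 1) * \<Phi> z \<le> x * ?f x + ?k y"
      using that c by (auto simp: stein_rhs_def)
  qed (rule that)
  have "P x y"
  proof -
    consider "x \<le> z" | "z \<le> y" | "y < z" "z < x" by linarith
    then show ?thesis
    proof cases
      case 3
      \<comment> \<open>f is not differentiable at z, so the bounds on [y, z] and [z, x] are added;
        the values at z are first replaced by the worse values at y and x.\<close>
      have 1: "(x - z) * (y * ?f y + ?k x) \<le> (x - z) * (z * ?f z + ?k x)"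
        "(z - y) * (y * ?f y + ?k x) \<le> (z - y) * (y * ?f y + ?k z)"
        "(x - z) * (x * ?f x + ?k z) \<le> (x - z) * (x * ?f x + ?k y)"
        "(z - y) * (z * ?f z + ?k y) \<le> (z - y) * (x * ?f x + ?k y)"
        using 3 by (auto intro!: mult_left_mono add_mono mono_times_stein_solution stein_rhs_antimono)
      have "P x z" "P z y" using 3 l r by auto
      with 1 have "(x - z) * (y * ?f y + ?k x) + (z - y) * (y * ?f y + ?k x) \<le> ?f x - ?f y"
        "?f x - ?f y \<le> (x - z) * (x * ?f x + ?k y) + (z - y) * (x * ?f x + ?k y)"
        unfolding P_def by linarith+
      then show ?thesis unfolding P_def by (simp flip: distrib_right)
    qed (use l r assms in auto)
  qed
  then show "(x - y) * (y * ?f y + ?k x) \<le> ?f x - ?f y" "?f x - ?f y \<le> (x - y) * (x * ?f x + ?k y)"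
    unfolding P_def by auto
qed

section \<open>Normal approximation by exchangeable pairs\<close>

text \<open>\<open>\<kappa> i s\<close> is the probability flow of the move T i out of s; its
  invariance under the involution T i is reversibility, and r is the failure of the drift to be
  linear in W. In the second error sum the absolute value stands outside the sum over moves, so that
  up and down jumps can cancel.\<close>

lemma exchangeable_pair_normal_approximation:
  fixes \<Omega> :: "'a set" and I :: "'b set" and T :: "'b \<Rightarrow> 'a \<Rightarrow> 'a"
    and \<kappa> :: "'b \<Rightarrow> 'a \<Rightarrow> real" and p r W :: "'a \<Rightarrow> real"
  assumes fin: "finite \<Omega>" "finite I"
    and T: "\<And>i s. i \<in> I \<Longrightarrow> s \<in> \<Omega> \<Longrightarrow> T i s \<in> \<Omega>" "\<And>i s. i \<in> I \<Longrightarrow> s \<in> \<Omega> \<Longrightarrow> T i (T i s) = s"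
    and \<kappa>: "\<And>i s. i \<in> I \<Longrightarrow> s \<in> \<Omega> \<Longrightarrow> \<kappa> i (T i s) = \<kappa> i s" "\<And>i s. i \<in> I \<Longrightarrow> s \<in> \<Omega> \<Longrightarrow> 0 \<le> \<kappa> i s"
    and p: "\<And>s. s \<in> \<Omega> \<Longrightarrow> 0 \<le> p s" "(\<Sum>s\<in>\<Omega>. p s) = 1"
    and drift: "\<And>s. s \<in> \<Omega> \<Longrightarrow> (\<Sum>i\<in>I. \<kappa> i s * (W s - W (T i s))) = p s * (W s + r s)"
  shows "\<bar>(\<Sum>s\<in>\<Omega>. p s * (if W s \<le> z then 1 else 0)) - \<Phi> z\<bar> \<le>
     2 * (\<Sum>s\<in>\<Omega>. \<bar>p s - (\<Sum>i\<in>I. \<kappa> i s * (W s - W (T i s))\<^sup>2) / 2\<bar>)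
     + (\<Sum>s\<in>\<Omega>. \<bar>\<Sum>i\<in>I. \<kappa> i s * ((W s - W (T i s)) * \<bar>W s - W (T i s)\<bar>)\<bar>)
     + 5 * (\<Sum>s\<in>\<Omega>. p s * \<bar>r s\<bar>)"
proof -
  define \<Delta> where "\<Delta> i s = W s - W (T i s)" for i s
  define f where "f s = stein_solution z (W s)" for s
  define g where "g s = W s * f s" for s
  define k where "k s = stein_rhs z (W s)" for s
  \<comment> \<open>The parts of \<Delta>^2 from the two directions of a jump; T i exchanges them,
    and their difference is \<Delta> |\<Delta>|.\<close>
  define P where "P i s = (if \<Delta> i s > 0 then (\<Delta> i s)\<^sup>2 else 0)" for i s
  define M where "M i s = (if \<Delta> i s < 0 then (\<Delta> i s)\<^sup>2 else 0)" for i s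
  define S where "S G = (\<Sum>s\<in>\<Omega>. \<Sum>i\<in>I. \<kappa> i s * G i s)" for G
  \<comment> \<open>Exchangeability: each T i is an involution preserving \<kappa> i, so the roles
    of s and T i s can be interchanged.\<close>
  have swap: "S (\<lambda>i s. G i (T i s)) = S G" for G
  proof -
    have "(\<Sum>s\<in>\<Omega>. \<kappa> i s * G i (T i s)) = (\<Sum>s\<in>\<Omega>. \<kappa> i s * G i s)" if i: "i \<in> I" for i
      by (rule sum.reindex_bij_witness[of _ "T i" "T i"]) (use T \<kappa> i in auto)
    then show ?thesis
      unfolding S_def by (subst (1 2) sum.swap) (auto intro: sum.cong)
  qed
  have S_cong: "S G = S H" if "\<And>i s. i \<in> I \<Longrightarrow> s \<in> \<Omega> \<Longrightarrow> G i s = H i s" for G H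
    unfolding S_def using that by (auto intro!: sum.cong)
  have S_mono: "S G \<le> S H" if "\<And>i s. i \<in> I \<Longrightarrow> s \<in> \<Omega> \<Longrightarrow> G i s \<le> H i s" for G H
    unfolding S_def using that \<kappa> by (auto intro!: sum_mono mult_left_mono)
  have S_add: "S (\<lambda>i s. G i s + H i s) = S G + S H" and S_diff: "S (\<lambda>i s. G i s - H i s) = S G - S H" for G H
    unfolding S_def by (simp_all add: algebra_simps sum.distrib sum_subtractf)
  have \<Delta>T: "\<Delta> i (T i s) = - \<Delta> i s" if "i \<in> I" "s \<in> \<Omega>" for i s
    using T(2)[OF that] by (simp add: \<Delta>_def)
  have PT: "P i (T i s) = M i s" and MT: "M i (T i s) = P i s" if "i \<in> I" "s \<in> \<Omega>" for i s
    using \<Delta>T[OF that] by (auto simp: P_def M_def)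
  have PM: "P i s - M i s = \<Delta> i s * \<bar>\<Delta> i s\<bar>" for i s
    by (auto simp: P_def M_def power2_eq_square)
  have drift': "S (\<lambda>i s. \<Delta> i s * h s) = (\<Sum>s\<in>\<Omega>. p s * (W s + r s) * h s)" for h
    unfolding S_def using drift by (auto intro!: sum.cong simp: \<Delta>_def mult.assoc[symmetric] simp flip: sum_distrib_right)
  have "S (\<lambda>i s. \<Delta> i s * f (T i s)) = S (\<lambda>i s. - \<Delta> i s * f s)"
  proof -
    have "S (\<lambda>i s. \<Delta> i s * f (T i s)) = S (\<lambda>i s. - \<Delta> i (T i s) * f (T i s))"
      by (rule S_cong) (simp add: \<Delta>T)
    also have "\<dots> = S (\<lambda>i s. - \<Delta> i s * f s)" by (rule swap)
    finally show ?thesis .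
  qed
  \<comment> \<open>Antisymmetry of \<Delta> doubles the drift identity tested against f and
    produces increments of f.\<close>
  then have e2: "S (\<lambda>i s. \<Delta> i s * (f s - f (T i s))) = 2 * (\<Sum>s\<in>\<Omega>. p s * (W s + r s) * f s)"
    unfolding drift'[symmetric] by (simp add: right_diff_distrib S_diff) (simp add: S_def sum_negf)
  \<comment> \<open>The error of replacing the increment of f by \<Delta> f'(W), as f' = g + k. The
    endpoint bounds on f pair \<Delta>^2 with increments of the monotone functions g and k.\<close>
  define d where "d i s = \<Delta> i s * (f s - f (T i s)) - (\<Delta> i s)\<^sup>2 * (g s + k s)" for i s
  have d: "P i s * (g (T i s) - g s) + M i s * (k (T i s) - k s) \<le> d i s \<and>
      d i s \<le> P i s * (k (T i s) - k s) + M i s * (g (T i s) - g s)" for i s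
  proof -
    consider "\<Delta> i s = 0" | "\<Delta> i s > 0" | "\<Delta> i s < 0" by linarith
    then show ?thesis
    proof cases
      case 2
      then have le: "W (T i s) \<le> W s" by (simp add: \<Delta>_def)
      have "\<Delta> i s * (g (T i s) + k s) \<le> f s - f (T i s)" "f s - f (T i s) \<le> \<Delta> i s * (g s + k (T i s))"
        using stein_solution_diff[OF le, of z] unfolding \<Delta>_def f_def g_def k_def by auto
      from this[THEN mult_left_mono[OF _ less_imp_le[OF 2]]]
      show ?thesis using 2 by (simp add: d_def P_def M_def algebra_simps power2_eq_square)
    next
      case 3
      then have le: "W s \<le> W (T i s)" by (simp add: \<Delta>_def)
      have "(- \<Delta> i s) * (g s + k (T i s)) \<le> f (T i s) - f s" "f (T i s) - f s \<le> (- \<Delta> i s) * (g (T i s) + k s)"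
        using stein_solution_diff[OF le, of z] unfolding \<Delta>_def f_def g_def k_def by auto
      from this[THEN mult_left_mono[of _ _ "- \<Delta> i s"]]
      show ?thesis using 3 by (simp add: d_def P_def M_def algebra_simps power2_eq_square)
    qed (simp add: d_def P_def M_def)
  qed
  \<comment> \<open>Interchanging s and T i s moves the increment off h: P against h(T i s) becomes
    M against h(s), and M - P = -\<Delta> |\<Delta>|.\<close>
  have SP: "S (\<lambda>i s. P i s * (h (T i s) - h s)) = - S (\<lambda>i s. \<Delta> i s * \<bar>\<Delta> i s\<bar> * h s)"
    and SM: "S (\<lambda>i s. M i s * (h (T i s) - h s)) = S (\<lambda>i s. \<Delta> i s * \<bar>\<Delta> i s\<bar> * h s)" for h
  proof -
    have "S (\<lambda>i s. P i s * h (T i s)) = S (\<lambda>i s. M i (T i s) * h (T i s))"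
      by (rule S_cong) (simp add: MT)
    also have "\<dots> = S (\<lambda>i s. M i s * h s)" by (rule swap)
    finally show "S (\<lambda>i s. P i s * (h (T i s) - h s)) = - S (\<lambda>i s. \<Delta> i s * \<bar>\<Delta> i s\<bar> * h s)"
      by (simp add: right_diff_distrib S_diff left_diff_distrib flip: PM)
    have "S (\<lambda>i s. M i s * h (T i s)) = S (\<lambda>i s. P i (T i s) * h (T i s))"
      by (rule S_cong) (simp add: PT)
    also have "\<dots> = S (\<lambda>i s. P i s * h s)" by (rule swap)
    finally show "S (\<lambda>i s. M i s * (h (T i s) - h s)) = S (\<lambda>i s. \<Delta> i s * \<bar>\<Delta> i s\<bar> * h s)"
      by (simp add: right_diff_distrib S_diff left_diff_distrib flip: PM)
  qed
  define C where "C = (\<Sum>s\<in>\<Omega>. \<bar>\<Sum>i\<in>I. \<kappa> i s * (\<Delta> i s * \<bar>\<Delta> i s\<bar>)\<bar>)"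
  have f5: "\<bar>f s\<bar> \<le> 5" and g1: "\<bar>g s\<bar> \<le> 1" and k1: "\<bar>k s\<bar> \<le> 1" for s
    using stein_solution_le abs_times_stein_solution_le abs_stein_rhs_le by (auto simp: f_def g_def k_def)
  have SC: "\<bar>S (\<lambda>i s. \<Delta> i s * \<bar>\<Delta> i s\<bar> * h s)\<bar> \<le> C" if "\<And>s. \<bar>h s\<bar> \<le> 1" for h
  proof -
    have "S (\<lambda>i s. \<Delta> i s * \<bar>\<Delta> i s\<bar> * h s) = (\<Sum>s\<in>\<Omega>. (\<Sum>i\<in>I. \<kappa> i s * (\<Delta> i s * \<bar>\<Delta> i s\<bar>)) * h s)"
      by (simp add: S_def sum_distrib_right mult.assoc)
    also have "\<bar>\<dots>\<bar> \<le> (\<Sum>s\<in>\<Omega>. \<bar>(\<Sum>i\<in>I. \<kappa> i s * (\<Delta> i s * \<bar>\<Delta> i s\<bar>)) * h s\<bar>)" by (rule sum_abs)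
    also have "\<dots> \<le> C"
      unfolding C_def abs_mult using that by (intro sum_mono mult_left_le) auto
    finally show ?thesis .
  qed
  have "S d \<le> S (\<lambda>i s. P i s * (k (T i s) - k s) + M i s * (g (T i s) - g s))"
    using d by (intro S_mono) auto
  then have "S d \<le> - S (\<lambda>i s. \<Delta> i s * \<bar>\<Delta> i s\<bar> * k s) + S (\<lambda>i s. \<Delta> i s * \<bar>\<Delta> i s\<bar> * g s)"
    unfolding S_add SP SM .
  moreover have "S (\<lambda>i s. P i s * (g (T i s) - g s) + M i s * (k (T i s) - k s)) \<le> S d"
    using d by (intro S_mono) auto
  then have "- S (\<lambda>i s. \<Delta> i s * \<bar>\<Delta> i s\<bar> * g s) + S (\<lambda>i s. \<Delta> i s * \<bar>\<Delta> i s\<bar> * k s) \<le> S d"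
    unfolding S_add SP SM .
  ultimately have Sd: "\<bar>S d\<bar> \<le> 2 * C"
    using SC[of g, OF g1] SC[of k, OF k1] by linarith
  define X where "X s = (\<Sum>i\<in>I. \<kappa> i s * (\<Delta> i s)\<^sup>2)" for s
  have "S d = 2 * (\<Sum>s\<in>\<Omega>. p s * (W s + r s) * f s) - (\<Sum>s\<in>\<Omega>. X s * (g s + k s))"
    unfolding d_def S_diff e2 by (simp add: S_def X_def sum_distrib_right mult.assoc)
  moreover have "(\<Sum>s\<in>\<Omega>. p s * (W s + r s) * f s) = (\<Sum>s\<in>\<Omega>. p s * g s) + (\<Sum>s\<in>\<Omega>. p s * r s * f s)"
    by (simp add: g_def algebra_simps sum.distrib)
  moreover have "(\<Sum>s\<in>\<Omega>. (p s - X s / 2) * (g s + k s)) =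
      (\<Sum>s\<in>\<Omega>. p s * g s) + (\<Sum>s\<in>\<Omega>. p s * k s) - (\<Sum>s\<in>\<Omega>. X s * (g s + k s)) / 2"
    by (simp add: left_diff_distrib distrib_left sum.distrib sum_subtractf sum_divide_distrib add_divide_distrib)
  \<comment> \<open>Solving for the mean of k, which is P(W \<le> z) - \<Phi>(z): the bounded g + k
    multiplies the second-moment defect, the rest are the errors d and r.\<close>
  ultimately have "(\<Sum>s\<in>\<Omega>. p s * k s) = (\<Sum>s\<in>\<Omega>. (p s - X s / 2) * (g s + k s))
      - S d / 2 + (\<Sum>s\<in>\<Omega>. p s * r s * f s)"
    by linarith
  moreover have "\<bar>\<Sum>s\<in>\<Omega>. (p s - X s / 2) * (g s + k s)\<bar> \<le> (\<Sum>s\<in>\<Omega>. \<bar>p s - X s / 2\<bar> * 2)"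
  proof (intro order.trans[OF sum_abs] sum_mono)
    fix s
    have "\<bar>g s + k s\<bar> \<le> 2" using g1[of s] k1[of s] by linarith
    then show "\<bar>(p s - X s / 2) * (g s + k s)\<bar> \<le> \<bar>p s - X s / 2\<bar> * 2"
      unfolding abs_mult by (intro mult_left_mono) auto
  qed
  moreover have "\<bar>\<Sum>s\<in>\<Omega>. p s * r s * f s\<bar> \<le> (\<Sum>s\<in>\<Omega>. p s * \<bar>r s\<bar> * 5)"
  proof (intro order.trans[OF sum_abs] sum_mono)
    fix s assume "s \<in> \<Omega>"
    then show "\<bar>p s * r s * f s\<bar> \<le> p s * \<bar>r s\<bar> * 5"
      using p f5[of s] unfolding abs_mult by (intro mult_mono) auto
  qed
  moreover have "(\<Sum>s\<in>\<Omega>. p s * k s) = (\<Sum>s\<in>\<Omega>. p s * (if W s \<le> z then 1 else 0)) - \<Phi> z"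
    unfolding k_def stein_rhs_def right_diff_distrib sum_subtractf
    using p(2) by (simp flip: sum_distrib_right)
  ultimately show ?thesis
    using Sd unfolding \<Delta>_def[symmetric] C_def[symmetric] X_def[symmetric] sum_distrib_right[symmetric]
    by linarith
qed

section \<open>Correlation inequalities from four replicas\<close>

text \<open>Functions that are \<open>undefined\<close> off {..<N}: a configuration is determined by
  its spins, and a sum of products over sites factors.\<close>

definition spin_configs :: "nat \<Rightarrow> (nat \<Rightarrow> real) set" where
  "spin_configs N = PiE {..<N} (\<lambda>_. {-1, 1})"

lemma finite_spin_configs [simp]: "finite (spin_configs N)"
  unfolding spin_configs_def by (intro finite_PiE) auto

lemma spin_configs_nonempty: "spin_configs N \<noteq> {}"
  unfolding spin_configs_def by (simp add: PiE_eq_empty_iff)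

lemma spin_cases: "s \<in> spin_configs N \<Longrightarrow> i < N \<Longrightarrow> s i = 1 \<or> s i = -1"
  unfolding spin_configs_def by (auto dest: PiE_mem)

type_synonym replicas = "(nat \<Rightarrow> real) \<times> (nat \<Rightarrow> real) \<times> (nat \<Rightarrow> real) \<times> (nat \<Rightarrow> real)"

definition replica_configs :: "nat \<Rightarrow> replicas set" where
  "replica_configs N = spin_configs N \<times> spin_configs N \<times> spin_configs N \<times> spin_configs N"

lemma sum_replica_configs:
  "(\<Sum>x\<in>replica_configs N. F x) =
    (\<Sum>s1\<in>spin_configs N. \<Sum>s2\<in>spin_configs N. \<Sum>s3\<in>spin_configs N. \<Sum>s4\<in>spin_configs N. F (s1, s2, s3, s4))"
  unfolding replica_configs_def by (simp add: sum.cartesian_product)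

lemma sum_replica_configs_prod:
  fixes f1 f2 f3 f4 :: "(nat \<Rightarrow> real) \<Rightarrow> real"
  shows "(\<Sum>(s1, s2, s3, s4)\<in>replica_configs N. f1 s1 * f2 s2 * f3 s3 * f4 s4) =
    (\<Sum>s\<in>spin_configs N. f1 s) * (\<Sum>s\<in>spin_configs N. f2 s) *
    (\<Sum>s\<in>spin_configs N. f3 s) * (\<Sum>s\<in>spin_configs N. f4 s)"
  unfolding sum_replica_configs prod.case
  by (simp add: sum_distrib_left[symmetric] sum_distrib_right[symmetric])

text \<open>Up to normalisation, the orthogonal change of variables of Ellis, Monroe and Newman: every
  single-site moment of the new coordinates is nonnegative, and so is every expectation of a
  function with nonnegative coefficients in them.\<close>

fun rep_u rep_v rep_w rep_d :: "nat \<Rightarrow> replicas \<Rightarrow> real" where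
  "rep_u i (s1, s2, s3, s4) = s1 i + s2 i + s3 i + s4 i"
| "rep_v i (s1, s2, s3, s4) = s1 i + s2 i - s3 i - s4 i"
| "rep_w i (s1, s2, s3, s4) = s1 i - s2 i + s3 i - s4 i"
| "rep_d i (s1, s2, s3, s4) = - s1 i + s2 i + s3 i - s4 i"

definition rep_monom :: "nat \<Rightarrow> (nat \<Rightarrow> nat) \<Rightarrow> (nat \<Rightarrow> nat) \<Rightarrow> (nat \<Rightarrow> nat) \<Rightarrow> (nat \<Rightarrow> nat) \<Rightarrow> replicas \<Rightarrow> real" where
  "rep_monom N a b c d x =
    (\<Prod>i<N. rep_u i x ^ a i * rep_v i x ^ b i * rep_w i x ^ c i * rep_d i x ^ d i)"

text \<open>Positivity of F is tested against all monomials at once. The multipliers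
  \<open>replica_pos_mult\<close> that preserve it contain the coordinates and are closed under
  sums, products and exponentials, so Boltzmann factors are handled without expanding them.\<close>

definition replica_pos :: "nat \<Rightarrow> (replicas \<Rightarrow> real) \<Rightarrow> bool" where
  "replica_pos N F \<longleftrightarrow> (\<forall>a b c d. 0 \<le> (\<Sum>x\<in>replica_configs N. F x * rep_monom N a b c d x))"

definition replica_pos_mult :: "nat \<Rightarrow> (replicas \<Rightarrow> real) \<Rightarrow> bool" where
  "replica_pos_mult N G \<longleftrightarrow> (\<forall>F. replica_pos N F \<longrightarrow> replica_pos N (\<lambda>x. F x * G x))"

text \<open>Eight of the sixteen sign patterns give a vector with one entry 4 or -4 and zeros; the
  other eight give entries 2 or -2 with an even number of minus signs. The latter total 2^(a+b+c+d)
  times the even part of (1+A)(1+B)(1+C)(1+D), with A = (-1)^a and so on. With the opposite sign in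
  \<open>rep_d\<close> the number of minus signs would be odd and the claim false.\<close>

lemma single_site_moments_nonneg:
  fixes a b c d :: nat
  shows "0 \<le> (\<Sum>x1\<in>{-1, 1::real}. \<Sum>x2\<in>{-1, 1}. \<Sum>x3\<in>{-1, 1}. \<Sum>x4\<in>{-1, 1}.
    (x1 + x2 + x3 + x4) ^ a * (x1 + x2 - x3 - x4) ^ b * (x1 - x2 + x3 - x4) ^ c * (- x1 + x2 + x3 - x4) ^ d)"
    (is "0 \<le> ?T")
proof -
  define t :: "real \<Rightarrow> real \<Rightarrow> real \<Rightarrow> real \<Rightarrow> real"
    where "t x y z w = x ^ a * y ^ b * z ^ c * w ^ d" for x y z w
  have sum2: "(\<Sum>x\<in>{-1, 1::real}. f x) = f (-1) + f 1" for f :: "real \<Rightarrow> real" by simp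
  have eq: "?T = (t 4 0 0 0 + t (-4) 0 0 0) + (t 0 4 0 0 + t 0 (-4) 0 0)
     + (t 0 0 4 0 + t 0 0 (-4) 0) + (t 0 0 0 4 + t 0 0 0 (-4))
     + (t 2 2 2 2 + t (-2) (-2) (-2) (-2) + t 2 2 (-2) (-2) + t 2 (-2) 2 (-2) + t 2 (-2) (-2) 2
        + t (-2) 2 2 (-2) + t (-2) 2 (-2) 2 + t (-2) (-2) 2 2)"
    unfolding sum2 t_def[symmetric] by simp
  have p: "0 \<le> x ^ n + (- x) ^ n" if "0 \<le> x" for x :: real and n
    using that by (cases "even n") auto
  have g: "0 \<le> t 4 0 0 0 + t (-4) 0 0 0" "0 \<le> t 0 4 0 0 + t 0 (-4) 0 0"
    "0 \<le> t 0 0 4 0 + t 0 0 (-4) 0" "0 \<le> t 0 0 0 4 + t 0 0 0 (-4)"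
    unfolding t_def distrib_right[symmetric] distrib_left[symmetric]
    by (auto intro!: mult_nonneg_nonneg p)
  define A B C D :: real where "A = (- 1) ^ a" "B = (- 1) ^ b" "C = (- 1) ^ c" "D = (- 1) ^ d"
  note ABCD = A_B_C_D_def
  have sgn: "A = 1 \<or> A = -1" "B = 1 \<or> B = -1" "C = 1 \<or> C = -1" "D = 1 \<or> D = -1"
    unfolding ABCD by (auto simp: minus_one_power_iff)
  have m: "(- 2 :: real) ^ n = (- 1) ^ n * 2 ^ n" for n by (rule power_minus)
  have ts: "t (-2) (-2) (-2) (-2) = A * B * C * D * t 2 2 2 2" "t 2 2 (-2) (-2) = C * D * t 2 2 2 2"
    "t 2 (-2) 2 (-2) = B * D * t 2 2 2 2" "t 2 (-2) (-2) 2 = B * C * t 2 2 2 2"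
    "t (-2) 2 2 (-2) = A * D * t 2 2 2 2" "t (-2) 2 (-2) 2 = A * C * t 2 2 2 2"
    "t (-2) (-2) 2 2 = A * B * t 2 2 2 2"
    unfolding t_def m ABCD[symmetric] by (simp_all only: mult_ac)
  have "t 2 2 2 2 + t (-2) (-2) (-2) (-2) + t 2 2 (-2) (-2) + t 2 (-2) 2 (-2) + t 2 (-2) (-2) 2
        + t (-2) 2 2 (-2) + t (-2) 2 (-2) 2 + t (-2) (-2) 2 2
     = (1 + A * B * C * D + C * D + B * D + B * C + A * D + A * C + A * B) * t 2 2 2 2"
    unfolding ts by (simp only: distrib_right mult_1_left)
  moreover have "0 \<le> 1 + A * B * C * D + C * D + B * D + B * C + A * D + A * C + A * B"
    using sgn by (elim disjE) simp_all
  moreover have "0 \<le> t 2 2 2 2" by (simp add: t_def)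
  ultimately show ?thesis
    unfolding eq using g by (simp only: add_nonneg_nonneg mult_nonneg_nonneg)
qed

lemma sum_spin_configs_prod:
  "(\<Sum>s\<in>spin_configs N. \<Prod>i<N. f i (s i)) = (\<Prod>i<N. \<Sum>x\<in>{-1, 1 :: real}. (f i x :: real))"
  unfolding spin_configs_def by (rule prod_sum_PiE[symmetric]) auto

lemma sum_four_spin_configs_prod:
  fixes f :: "nat \<Rightarrow> real \<Rightarrow> real \<Rightarrow> real \<Rightarrow> real \<Rightarrow> real"
  shows "(\<Sum>s1\<in>spin_configs N. \<Sum>s2\<in>spin_configs N. \<Sum>s3\<in>spin_configs N. \<Sum>s4\<in>spin_configs N.
      \<Prod>i<N. f i (s1 i) (s2 i) (s3 i) (s4 i)) =
    (\<Prod>i<N. \<Sum>x1\<in>{-1, 1}. \<Sum>x2\<in>{-1, 1}. \<Sum>x3\<in>{-1, 1}. \<Sum>x4\<in>{-1, 1}. f i x1 x2 x3 x4)"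
proof -
  have "(\<Sum>s4\<in>spin_configs N. \<Prod>i<N. f i (s1 i) (s2 i) (s3 i) (s4 i)) =
      (\<Prod>i<N. \<Sum>x4\<in>{-1, 1}. f i (s1 i) (s2 i) (s3 i) x4)" for s1 s2 s3
    by (rule sum_spin_configs_prod)
  moreover have "(\<Sum>s3\<in>spin_configs N. \<Prod>i<N. \<Sum>x4\<in>{-1, 1}. f i (s1 i) (s2 i) (s3 i) x4) =
      (\<Prod>i<N. \<Sum>x3\<in>{-1, 1}. \<Sum>x4\<in>{-1, 1}. f i (s1 i) (s2 i) x3 x4)" for s1 s2
    by (rule sum_spin_configs_prod)
  moreover have "(\<Sum>s2\<in>spin_configs N. \<Prod>i<N. \<Sum>x3\<in>{-1, 1}. \<Sum>x4\<in>{-1, 1}. f i (s1 i) (s2 i) x3 x4) =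
      (\<Prod>i<N. \<Sum>x2\<in>{-1, 1}. \<Sum>x3\<in>{-1, 1}. \<Sum>x4\<in>{-1, 1}. f i (s1 i) x2 x3 x4)" for s1
    by (rule sum_spin_configs_prod)
  moreover have "(\<Sum>s1\<in>spin_configs N. \<Prod>i<N. \<Sum>x2\<in>{-1, 1}. \<Sum>x3\<in>{-1, 1}. \<Sum>x4\<in>{-1, 1}. f i (s1 i) x2 x3 x4) =
      (\<Prod>i<N. \<Sum>x1\<in>{-1, 1}. \<Sum>x2\<in>{-1, 1}. \<Sum>x3\<in>{-1, 1}. \<Sum>x4\<in>{-1, 1}. f i x1 x2 x3 x4)"
    by (rule sum_spin_configs_prod)
  ultimately show ?thesis by (simp only:)
qed

text \<open>Without a weight different sites are independent, so the moment is a product of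
  single-site moments.\<close>

lemma replica_pos_1: "replica_pos N (\<lambda>_. 1)"
proof -
  have "0 \<le> (\<Sum>x\<in>replica_configs N. rep_monom N a b c d x)" for a b c d
  proof -
    define f where "f i x1 x2 x3 x4 = (x1 + x2 + x3 + x4) ^ a i * (x1 + x2 - x3 - x4) ^ b i
      * (x1 - x2 + x3 - x4) ^ c i * (- x1 + x2 + x3 - x4) ^ d i" for i and x1 x2 x3 x4 :: real
    have "(\<Sum>x\<in>replica_configs N. rep_monom N a b c d x) =
      (\<Prod>i<N. \<Sum>x1\<in>{-1, 1}. \<Sum>x2\<in>{-1, 1}. \<Sum>x3\<in>{-1, 1}. \<Sum>x4\<in>{-1, 1}. f i x1 x2 x3 x4)"
      unfolding sum_four_spin_configs_prod[symmetric] sum_replica_configs rep_monom_def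
        rep_u.simps rep_v.simps rep_w.simps rep_d.simps f_def ..
    also have "\<dots> \<ge> 0"
      unfolding f_def by (intro prod_nonneg ballI single_site_moments_nonneg)
    finally show ?thesis .
  qed
  then show ?thesis by (simp add: replica_pos_def)
qed

lemma rep_monom_Suc:
  assumes "i < N"
  shows "rep_u i x * rep_monom N a b c d x = rep_monom N (a(i := Suc (a i))) b c d x"
    and "rep_v i x * rep_monom N a b c d x = rep_monom N a (b(i := Suc (b i))) c d x"
    and "rep_w i x * rep_monom N a b c d x = rep_monom N a b (c(i := Suc (c i))) d x"
    and "rep_d i x * rep_monom N a b c d x = rep_monom N a b c (d(i := Suc (d i))) x"
proof -
  have i: "i \<in> {..<N}" "finite {..<N}" using assms by auto
  have eq: "y * (\<Prod>j<N. f j) = (\<Prod>j<N. g j)"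
    if "g i = y * f i" "\<And>j. j \<noteq> i \<Longrightarrow> g j = f j" for y :: real and f g :: "nat \<Rightarrow> real"
    unfolding prod.remove[OF i(2,1), of f] prod.remove[OF i(2,1), of g] using that by simp
  show "rep_u i x * rep_monom N a b c d x = rep_monom N (a(i := Suc (a i))) b c d x"
    and "rep_v i x * rep_monom N a b c d x = rep_monom N a (b(i := Suc (b i))) c d x"
    and "rep_w i x * rep_monom N a b c d x = rep_monom N a b (c(i := Suc (c i))) d x"
    and "rep_d i x * rep_monom N a b c d x = rep_monom N a b c (d(i := Suc (d i))) x"
    unfolding rep_monom_def by (rule eq; simp)+
qed

text \<open>Multiplying by a coordinate raises one exponent, and positivity quantifies over all
  exponents.\<close>

lemma replica_pos_mult_rep:
  assumes "i < N"
  shows "replica_pos_mult N (rep_u i)" "replica_pos_mult N (rep_v i)"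
    "replica_pos_mult N (rep_w i)" "replica_pos_mult N (rep_d i)"
  using assms unfolding replica_pos_mult_def replica_pos_def
  by (simp_all add: mult.assoc rep_monom_Suc)

lemma replica_pos_mult_mult:
  "replica_pos_mult N G \<Longrightarrow> replica_pos_mult N H \<Longrightarrow> replica_pos_mult N (\<lambda>x. G x * H x)"
  unfolding replica_pos_mult_def by (simp flip: mult.assoc)

lemma replica_pos_mult_add:
  assumes "replica_pos_mult N G" "replica_pos_mult N H"
  shows "replica_pos_mult N (\<lambda>x. G x + H x)"
  using assms unfolding replica_pos_mult_def replica_pos_def
  by (simp add: distrib_left distrib_right sum.distrib)

lemma replica_pos_mult_const:
  assumes "c \<ge> 0"
  shows "replica_pos_mult N (\<lambda>_. c)"
  using assms unfolding replica_pos_mult_def replica_pos_def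
  by (auto simp: mult_ac simp flip: sum_distrib_left)

lemma replica_pos_mult_sum:
  assumes "\<And>i. i \<in> I \<Longrightarrow> replica_pos_mult N (G i)"
  shows "replica_pos_mult N (\<lambda>x. \<Sum>i\<in>I. G i x)"
  using assms
  by (induction I rule: infinite_finite_induct)
    (auto intro!: replica_pos_mult_const[of 0, simplified] replica_pos_mult_add)

lemma replica_pos_mult_power:
  "replica_pos_mult N G \<Longrightarrow> replica_pos_mult N (\<lambda>x. G x ^ n)"
  by (induction n) (auto intro!: replica_pos_mult_const replica_pos_mult_mult)

text \<open>The partial sums of the exponential series are multipliers, and nonnegativity passes to
  the limit because the configuration space is finite.\<close>

lemma replica_pos_mult_exp:
  assumes "replica_pos_mult N G"
  shows "replica_pos_mult N (\<lambda>x. exp (G x))"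
  unfolding replica_pos_mult_def replica_pos_def
proof (intro allI impI)
  fix F a b c d
  assume F: "\<forall>a b c d. 0 \<le> (\<Sum>x\<in>replica_configs N. F x * rep_monom N a b c d x)"
  have "(\<lambda>n. \<Sum>x\<in>replica_configs N. F x * (\<Sum>k<n. G x ^ k /\<^sub>R fact k) * rep_monom N a b c d x)
     \<longlonglongrightarrow> (\<Sum>x\<in>replica_configs N. F x * exp (G x) * rep_monom N a b c d x)"
    by (intro tendsto_sum tendsto_mult tendsto_const exp_converges[unfolded sums_def])
  moreover have "0 \<le> (\<Sum>x\<in>replica_configs N. F x * (\<Sum>k<n. G x ^ k /\<^sub>R fact k) * rep_monom N a b c d x)" for n
  proof -
    have "replica_pos_mult N (\<lambda>x. \<Sum>k<n. G x ^ k * inverse (fact k))"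
      by (intro replica_pos_mult_sum replica_pos_mult_mult replica_pos_mult_power replica_pos_mult_const assms) auto
    with F show ?thesis
      unfolding replica_pos_mult_def replica_pos_def by (simp add: mult.commute)
  qed
  ultimately show "0 \<le> (\<Sum>x\<in>replica_configs N. F x * exp (G x) * rep_monom N a b c d x)"
    by (intro LIMSEQ_le_const[of _ _ 0]) auto
qed

lemma replica_pos_mult_nonneg:
  assumes "replica_pos_mult N G"
  shows "0 \<le> (\<Sum>x\<in>replica_configs N. G x)"
proof -
  have "replica_pos N (\<lambda>x. 1 * G x)"
    using assms replica_pos_1 unfolding replica_pos_mult_def by blast
  then have "0 \<le> (\<Sum>x\<in>replica_configs N. 1 * G x * rep_monom N (\<lambda>_. 0) (\<lambda>_. 0) (\<lambda>_. 0) (\<lambda>_. 0) x)"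
    unfolding replica_pos_def by blast
  then show ?thesis by (simp add: rep_monom_def)
qed

section \<open>The Ising model in a uniform field; inequalities of Griffiths and GHS type\<close>

locale ising_model =
  fixes N :: nat and a :: "nat \<Rightarrow> nat \<Rightarrow> real" and \<beta> :: real
  assumes a_sym: "\<And>i j. i < N \<Longrightarrow> j < N \<Longrightarrow> a i j = a j i"
    and a_nonneg: "\<And>i j. i < N \<Longrightarrow> j < N \<Longrightarrow> 0 \<le> a i j"
    and a_diag: "\<And>i. i < N \<Longrightarrow> a i i = 0"
    and \<beta>_pos: "\<beta> > 0"
begin

text \<open>The field h is an argument, not a locale parameter: different fields are compared, and
  expectations are differentiated in h.\<close>

definition energy :: "real \<Rightarrow> (nat \<Rightarrow> real) \<Rightarrow> real" where
  "energy h s = \<beta> / 2 * (\<Sum>i<N. \<Sum>j<N. s i * (a i j * s j)) + h * (\<Sum>i<N. s i)"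

definition weight :: "real \<Rightarrow> (nat \<Rightarrow> real) \<Rightarrow> real" where
  "weight h s = exp (energy h s)"

definition Z :: "real \<Rightarrow> real" where
  "Z h = (\<Sum>s\<in>spin_configs N. weight h s)"

definition E :: "real \<Rightarrow> ((nat \<Rightarrow> real) \<Rightarrow> real) \<Rightarrow> real" where
  "E h F = (\<Sum>s\<in>spin_configs N. weight h s * F s) / Z h"

definition cov :: "real \<Rightarrow> nat \<Rightarrow> nat \<Rightarrow> real" where
  "cov h i j = E h (\<lambda>s. s i * s j) - E h (\<lambda>s. s i) * E h (\<lambda>s. s j)"

lemma weight_pos: "weight h s > 0"
  by (simp add: weight_def)

lemma Z_pos: "Z h > 0"
  unfolding Z_def using spin_configs_nonempty by (intro sum_pos) (auto simp: weight_pos)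

text \<open>Two replicas at field \<open>h'\<close> and two at field \<open>h\<close>: for \<open>h' \<ge> h \<ge> 0\<close> the energy still has
  nonnegative coefficients, which allows covariances at two different fields to be compared.\<close>

definition replica_weight :: "real \<Rightarrow> real \<Rightarrow> replicas \<Rightarrow> real" where
  "replica_weight h' h = (\<lambda>(s1, s2, s3, s4). weight h' s1 * weight h' s2 * weight h s3 * weight h s4)"

text \<open>The four coordinates are orthogonal combinations of squared norm 4, so \<beta>/2 becomes
  \<beta>/8; in the field term h'(s1 + s2) + h(s3 + s4) only \<open>rep_u\<close> and
  \<open>rep_v\<close> survive.\<close>

lemma replica_weight_eq:
  "replica_weight h' h x = exp (
     (\<Sum>i<N. \<Sum>j<N. \<beta> / 8 * a i j * (rep_u i x * rep_u j x + rep_v i x * rep_v j x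
        + rep_w i x * rep_w j x + rep_d i x * rep_d j x))
     + (\<Sum>i<N. (h' + h) / 2 * rep_u i x + (h' - h) / 2 * rep_v i x))"
proof -
  obtain s1 s2 s3 s4 where x: "x = (s1, s2, s3, s4)" by (cases x) auto
  have 1: "\<beta> / 8 * a i j * (rep_u i x * rep_u j x + rep_v i x * rep_v j x
        + rep_w i x * rep_w j x + rep_d i x * rep_d j x) =
     \<beta> / 2 * (s1 i * (a i j * s1 j)) + \<beta> / 2 * (s2 i * (a i j * s2 j)) +
     \<beta> / 2 * (s3 i * (a i j * s3 j)) + \<beta> / 2 * (s4 i * (a i j * s4 j))" for i j
    unfolding x by (simp add: algebra_simps)
  have 2: "(h' + h) / 2 * rep_u i x + (h' - h) / 2 * rep_v i x = h' * s1 i + h' * s2 i + h * s3 i + h * s4 i" for i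
    unfolding x by (simp add: field_simps)
  have "replica_weight h' h x = exp (energy h' s1 + energy h' s2 + energy h s3 + energy h s4)"
    by (simp add: x replica_weight_def weight_def exp_add)
  also have "energy h' s1 + energy h' s2 + energy h s3 + energy h s4 =
     (\<Sum>i<N. \<Sum>j<N. \<beta> / 8 * a i j * (rep_u i x * rep_u j x + rep_v i x * rep_v j x
        + rep_w i x * rep_w j x + rep_d i x * rep_d j x))
     + (\<Sum>i<N. (h' + h) / 2 * rep_u i x + (h' - h) / 2 * rep_v i x)"
    unfolding 1 2 by (simp add: energy_def sum.distrib sum_distrib_left)
  finally show ?thesis .
qed

lemma replica_weight_pos:
  assumes "h \<le> h'" "0 \<le> h + h'"
  shows "replica_pos_mult N (replica_weight h' h)"
  unfolding replica_weight_eq[abs_def] using assms a_nonneg \<beta>_pos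
  by (intro replica_pos_mult_exp replica_pos_mult_add replica_pos_mult_sum replica_pos_mult_mult
      replica_pos_mult_const replica_pos_mult_rep) auto

lemma replica_weight_nonneg:
  assumes "h \<le> h'" "0 \<le> h + h'" "replica_pos_mult N G"
  shows "0 \<le> (\<Sum>x\<in>replica_configs N. replica_weight h' h x * G x)"
  by (intro replica_pos_mult_nonneg replica_pos_mult_mult replica_weight_pos assms)

text \<open>Griffiths' first inequality: with all replicas at the same field, \<open>rep_u\<close>
  has four times the expectation of one spin.\<close>

lemma E_spin_nonneg:
  assumes "0 \<le> h" "i < N"
  shows "0 \<le> E h (\<lambda>s. s i)"
proof -
  define S where "S = (\<Sum>s\<in>spin_configs N. weight h s * s i)"
  have "0 \<le> (\<Sum>x\<in>replica_configs N. replica_weight h h x * rep_u i x)"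
    using assms by (intro replica_weight_nonneg replica_pos_mult_rep) auto
  also have "\<dots> = (\<Sum>(s1, s2, s3, s4)\<in>replica_configs N. (weight h s1 * s1 i) * weight h s2 * weight h s3 * weight h s4)
     + (\<Sum>(s1, s2, s3, s4)\<in>replica_configs N. weight h s1 * (weight h s2 * s2 i) * weight h s3 * weight h s4)
     + (\<Sum>(s1, s2, s3, s4)\<in>replica_configs N. weight h s1 * weight h s2 * (weight h s3 * s3 i) * weight h s4)
     + (\<Sum>(s1, s2, s3, s4)\<in>replica_configs N. weight h s1 * weight h s2 * weight h s3 * (weight h s4 * s4 i))"
    unfolding sum.distrib[symmetric]
    by (intro sum.cong refl) (auto simp: replica_weight_def algebra_simps)
  also have "\<dots> = 4 * Z h ^ 3 * S"
    unfolding sum_replica_configs_prod by (simp add: S_def Z_def[symmetric] power3_eq_cube)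
  finally have "0 \<le> S" using Z_pos[of h] by (simp add: zero_le_mult_iff)
  then show ?thesis using Z_pos[of h] by (simp add: E_def S_def)
qed

text \<open>For two independent copies of one law, E (x - x')(y - y') = 2 cov; the other two
  replicas contribute their partition functions.\<close>

lemma replica_cov:
  "(\<Sum>(s1, s2, s3, s4)\<in>replica_configs N. replica_weight h' h (s1, s2, s3, s4) * ((s3 i - s4 i) * (s3 j - s4 j)))
     = 2 * (Z h')\<^sup>2 * (Z h)\<^sup>2 * cov h i j" (is "?lhs3 = _")
  "(\<Sum>(s1, s2, s3, s4)\<in>replica_configs N. replica_weight h' h (s1, s2, s3, s4) * ((s1 i - s2 i) * (s1 j - s2 j)))
     = 2 * (Z h')\<^sup>2 * (Z h)\<^sup>2 * cov h' i j" (is "?lhs1 = _")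
proof -
  define S where "S h i = (\<Sum>s\<in>spin_configs N. weight h s * s i)" for h i
  define S2 where "S2 h = (\<Sum>s\<in>spin_configs N. weight h s * (s i * s j))" for h
  have cov: "(Z h)\<^sup>2 * cov h i j = Z h * S2 h - S h i * S h j" for h
    using Z_pos[of h] unfolding cov_def E_def S_def[symmetric] S2_def[symmetric]
    by (simp add: field_simps power2_eq_square)
  have "?lhs3 = (\<Sum>(s1, s2, s3, s4)\<in>replica_configs N. weight h' s1 * weight h' s2 * (weight h s3 * (s3 i * s3 j)) * weight h s4)
     + (\<Sum>(s1, s2, s3, s4)\<in>replica_configs N. weight h' s1 * weight h' s2 * weight h s3 * (weight h s4 * (s4 i * s4 j)))
     - (\<Sum>(s1, s2, s3, s4)\<in>replica_configs N. weight h' s1 * weight h' s2 * (weight h s3 * s3 i) * (weight h s4 * s4 j))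
     - (\<Sum>(s1, s2, s3, s4)\<in>replica_configs N. weight h' s1 * weight h' s2 * (weight h s3 * s3 j) * (weight h s4 * s4 i))"
    unfolding sum.distrib[symmetric] sum_subtractf[symmetric]
    by (intro sum.cong refl) (auto simp: replica_weight_def algebra_simps)
  also have "\<dots> = 2 * (Z h')\<^sup>2 * (Z h * S2 h - S h i * S h j)"
    unfolding sum_replica_configs_prod S_def[symmetric] S2_def[symmetric] Z_def[symmetric]
    by (simp add: algebra_simps power2_eq_square)
  finally show "?lhs3 = 2 * (Z h')\<^sup>2 * (Z h)\<^sup>2 * cov h i j" by (simp add: cov)
  have "?lhs1 = (\<Sum>(s1, s2, s3, s4)\<in>replica_configs N. (weight h' s1 * (s1 i * s1 j)) * weight h' s2 * weight h s3 * weight h s4)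
     + (\<Sum>(s1, s2, s3, s4)\<in>replica_configs N. weight h' s1 * (weight h' s2 * (s2 i * s2 j)) * weight h s3 * weight h s4)
     - (\<Sum>(s1, s2, s3, s4)\<in>replica_configs N. (weight h' s1 * s1 i) * (weight h' s2 * s2 j) * weight h s3 * weight h s4)
     - (\<Sum>(s1, s2, s3, s4)\<in>replica_configs N. (weight h' s1 * s1 j) * (weight h' s2 * s2 i) * weight h s3 * weight h s4)"
    unfolding sum.distrib[symmetric] sum_subtractf[symmetric]
    by (intro sum.cong refl) (auto simp: replica_weight_def algebra_simps)
  also have "\<dots> = 2 * (Z h)\<^sup>2 * (Z h' * S2 h' - S h' i * S h' j)"
    unfolding sum_replica_configs_prod S_def[symmetric] S2_def[symmetric] Z_def[symmetric]
    by (simp add: algebra_simps power2_eq_square)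
  finally have l1: "?lhs1 = 2 * (Z h)\<^sup>2 * (Z h' * S2 h' - S h' i * S h' j)" .
  show "?lhs1 = 2 * (Z h')\<^sup>2 * (Z h)\<^sup>2 * cov h' i j"
    unfolding l1 cov[symmetric] by (simp only: mult_ac)
qed

text \<open>With p = s1 - s2 and q = s3 - s4, \<open>rep_w\<close> is q + p and \<open>rep_d\<close>
  is q - p, so the symmetric combination is 2 (p_i p_j + q_i q_j).\<close>

lemma cov_nonneg:
  assumes "0 \<le> h" "i < N" "j < N"
  shows "0 \<le> cov h i j"
proof -
  have "0 \<le> (\<Sum>x\<in>replica_configs N. replica_weight h h x * (rep_w i x * rep_w j x + rep_d i x * rep_d j x))"
    using assms by (intro replica_weight_nonneg replica_pos_mult_add replica_pos_mult_mult replica_pos_mult_rep) auto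
  also have "\<dots> = 2 * ((\<Sum>(s1, s2, s3, s4)\<in>replica_configs N. replica_weight h h (s1, s2, s3, s4) * ((s3 i - s4 i) * (s3 j - s4 j)))
     + (\<Sum>(s1, s2, s3, s4)\<in>replica_configs N. replica_weight h h (s1, s2, s3, s4) * ((s1 i - s2 i) * (s1 j - s2 j))))"
    unfolding sum.distrib[symmetric] sum_distrib_left
    by (intro sum.cong refl) (auto simp: algebra_simps)
  finally have "0 \<le> 8 * ((Z h)\<^sup>2 * (Z h)\<^sup>2) * cov h i j" unfolding replica_cov by simp
  moreover have "0 < 8 * ((Z h)\<^sup>2 * (Z h)\<^sup>2)" using Z_pos[of h] by simp
  ultimately show ?thesis by (simp only: zero_le_mult_iff) linarith
qed

text \<open>With p = s1 - s2 at field h' and q = s3 - s4 at field h, the mixed products of q + p and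
  q - p give 2 (q_i q_j - p_i p_j). This is GHS in integrated form.\<close>

lemma cov_antimono:
  assumes "0 \<le> h" "h \<le> h'" "i < N" "j < N"
  shows "cov h' i j \<le> cov h i j"
proof -
  have "0 \<le> (\<Sum>x\<in>replica_configs N. replica_weight h' h x * (rep_w i x * rep_d j x + rep_d i x * rep_w j x))"
    using assms by (intro replica_weight_nonneg replica_pos_mult_add replica_pos_mult_mult replica_pos_mult_rep) auto
  also have "\<dots> = 2 * ((\<Sum>(s1, s2, s3, s4)\<in>replica_configs N. replica_weight h' h (s1, s2, s3, s4) * ((s3 i - s4 i) * (s3 j - s4 j)))
     - (\<Sum>(s1, s2, s3, s4)\<in>replica_configs N. replica_weight h' h (s1, s2, s3, s4) * ((s1 i - s2 i) * (s1 j - s2 j))))"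
    unfolding sum_subtractf[symmetric] sum_distrib_left
    by (intro sum.cong refl) (auto simp: algebra_simps)
  finally have "0 \<le> 4 * ((Z h')\<^sup>2 * (Z h)\<^sup>2) * (cov h i j - cov h' i j)"
    unfolding replica_cov by (simp add: algebra_simps)
  moreover have "0 < 4 * ((Z h')\<^sup>2 * (Z h)\<^sup>2)" using Z_pos[of h] Z_pos[of h'] by simp
  ultimately have "0 \<le> cov h i j - cov h' i j" by (simp only: zero_le_mult_iff) linarith
  then show ?thesis by simp
qed

text \<open>Linear response: differentiating both the weight and its normalisation in h produces a
  row sum of covariances.\<close>

lemma has_real_derivative_E_spin:
  "((\<lambda>h. E h (\<lambda>s. s i)) has_real_derivative (\<Sum>j<N. cov h i j)) (at h)"
proof -
  define S where "S i h = (\<Sum>s\<in>spin_configs N. weight h s * s i)" for i h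
  define S2 where "S2 j h = (\<Sum>s\<in>spin_configs N. weight h s * (s i * s j))" for j h
  have dw: "((\<lambda>h. weight h s) has_real_derivative weight h s * (\<Sum>j<N. s j)) (at h)" for s
    unfolding weight_def energy_def by (auto intro!: derivative_eq_intros)
  have "(S i has_real_derivative (\<Sum>s\<in>spin_configs N. weight h s * (\<Sum>j<N. s j) * s i)) (at h)"
    unfolding S_def by (intro DERIV_sum DERIV_cmult_right dw)
  also have "(\<Sum>s\<in>spin_configs N. weight h s * (\<Sum>j<N. s j) * s i) = (\<Sum>j<N. S2 j h)"
    unfolding S2_def by (subst sum.swap) (simp add: sum_distrib_left sum_distrib_right mult_ac)
  finally have dS: "(S i has_real_derivative (\<Sum>j<N. S2 j h)) (at h)" .
  have "(Z has_real_derivative (\<Sum>s\<in>spin_configs N. weight h s * (\<Sum>j<N. s j))) (at h)"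
    unfolding Z_def by (intro DERIV_sum dw)
  also have "(\<Sum>s\<in>spin_configs N. weight h s * (\<Sum>j<N. s j)) = (\<Sum>j<N. S j h)"
    unfolding S_def by (subst sum.swap) (simp add: sum_distrib_left)
  finally have dZ: "(Z has_real_derivative (\<Sum>j<N. S j h)) (at h)" .
  have nz: "Z h \<noteq> 0" using Z_pos[of h] by simp
  have "((\<lambda>h. S i h / Z h) has_real_derivative
      ((\<Sum>j<N. S2 j h) * Z h - S i h * (\<Sum>j<N. S j h)) / (Z h * Z h)) (at h)"
    by (intro DERIV_divide dS dZ nz)
  also have "((\<Sum>j<N. S2 j h) * Z h - S i h * (\<Sum>j<N. S j h)) / (Z h * Z h) = (\<Sum>j<N. cov h i j)"
    using nz unfolding cov_def E_def S_def[symmetric] S2_def[symmetric]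
    by (simp add: sum_subtractf diff_divide_distrib sum_divide_distrib sum_distrib_left sum_distrib_right)
  finally show ?thesis unfolding S_def E_def .
qed

lemma abs_E_spin_le:
  assumes "i < N"
  shows "\<bar>E h (\<lambda>s. s i)\<bar> \<le> 1"
proof -
  have "\<bar>\<Sum>s\<in>spin_configs N. weight h s * s i\<bar> \<le> (\<Sum>s\<in>spin_configs N. weight h s * 1)"
  proof (intro order.trans[OF sum_abs] sum_mono)
    fix s assume "s \<in> spin_configs N"
    from spin_cases[OF this assms] show "\<bar>weight h s * s i\<bar> \<le> weight h s * 1"
      using weight_pos[of h s] by auto
  qed
  then show ?thesis using Z_pos[of h] by (simp add: E_def Z_def)
qed

text \<open>Covariances decrease in the field, so the magnetization is concave in \<open>h \<ge> 0\<close> and its slope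
  at \<open>h\<close> is at most the slope of a chord over \<open>[0, h]\<close>.\<close>

lemma sum_cov_le:
  assumes "0 < h" "i < N"
  shows "(\<Sum>j<N. cov h i j) \<le> 2 / h"
proof -
  obtain x where x: "0 < x" "x < h" "E h (\<lambda>s. s i) - E 0 (\<lambda>s. s i) = (h - 0) * (\<Sum>j<N. cov x i j)"
    using MVT2[OF assms(1), of "\<lambda>h. E h (\<lambda>s. s i)" "\<lambda>h. \<Sum>j<N. cov h i j"] has_real_derivative_E_spin by blast
  have "h * (\<Sum>j<N. cov h i j) \<le> h * (\<Sum>j<N. cov x i j)"
    using x assms by (intro mult_left_mono sum_mono cov_antimono) auto
  \<comment> \<open>The mean of one spin stays in [-1, 1], hence the 2.\<close>
  also have "\<dots> \<le> 2"
    using x(3) abs_E_spin_le[OF assms(2), of h] abs_E_spin_le[OF assms(2), of 0] by simp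
  finally show ?thesis using assms by (simp add: field_simps)
qed

end

section \<open>Single-spin dynamics and second moments\<close>

lemma tanh_lipschitz: "\<bar>tanh x - tanh y\<bar> \<le> \<bar>x - y\<bar>" for x y :: real
proof -
  have *: "\<bar>tanh x - tanh y\<bar> \<le> \<bar>x - y\<bar>" if "y < x" for x y :: real
  proof -
    have "\<exists>c>y. c < x \<and> tanh x - tanh y = (x - y) * (1 - (tanh c)\<^sup>2)"
      by (rule MVT2[OF that]) (auto intro!: derivative_eq_intros)
    then obtain c where c: "tanh x - tanh y = (x - y) * (1 - (tanh c)\<^sup>2)" by blast
    have "0 \<le> 1 - (tanh c)\<^sup>2" "1 - (tanh c)\<^sup>2 \<le> 1"
      using tanh_real_bounds[of c] by (auto simp: abs_square_le_1)
    then show ?thesis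
      unfolding c abs_mult by (intro mult_left_le) auto
  qed
  show ?thesis using *[of x y] *[of y x] by (cases x y rule: linorder_cases) auto
qed

text \<open>The odds of the two values of a resampled spin; the identity behind
  \<open>detailed_balance\<close>.\<close>

lemma exp_tanh_balance: "exp (- 2 * y) * (1 + tanh y) = 1 - tanh y" for y :: real
proof -
  define p q where "p = exp y" and "q = exp (- y)"
  have pq: "p + q > 0" "p * q = 1" "exp (- 2 * y) = q * q"
    by (simp_all add: p_def q_def add_pos_pos flip: exp_add)
  have t: "tanh y = (p - q) / (p + q)" unfolding p_def q_def by (rule tanh_altdef)
  have "1 + tanh y = 2 * p / (p + q)" "1 - tanh y = 2 * q / (p + q)"
    unfolding t using pq(1) by (simp_all add: field_simps)
  moreover have "q * q * (2 * p) = 2 * q" using pq(2) by (simp add: mult_ac)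
  ultimately show ?thesis unfolding pq(3) by simp
qed

context ising_model
begin

section \<open>Conditional means and single-spin flips\<close>

definition F2 :: real where "F2 = (\<Sum>i<N. \<Sum>j<N. (a i j)\<^sup>2)"
definition degree :: "nat \<Rightarrow> real" where "degree i = (\<Sum>j<N. a i j)"
definition local_field :: "nat \<Rightarrow> (nat \<Rightarrow> real) \<Rightarrow> real" where
  "local_field i s = (\<Sum>j<N. a i j * s j)"
definition local_mean :: "real \<Rightarrow> nat \<Rightarrow> (nat \<Rightarrow> real) \<Rightarrow> real" where
  "local_mean h i s = tanh (\<beta> * local_field i s + h)"
definition flip :: "nat \<Rightarrow> (nat \<Rightarrow> real) \<Rightarrow> (nat \<Rightarrow> real)" where
  "flip i s = s(i := - s i)"
text \<open>Heat-bath probability that spin i is reversed when it is resampled given the others;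
  \<open>local_mean\<close> is the conditional mean of that spin.\<close>

definition flip_rate :: "real \<Rightarrow> nat \<Rightarrow> (nat \<Rightarrow> real) \<Rightarrow> real" where
  "flip_rate h i s = (1 - s i * local_mean h i s) / 2"

lemma F2_nonneg: "0 \<le> F2"
  unfolding F2_def by (intro sum_nonneg) auto

lemma flip_in: "s \<in> spin_configs N \<Longrightarrow> i < N \<Longrightarrow> flip i s \<in> spin_configs N"
  unfolding spin_configs_def flip_def by (auto simp: PiE_iff extensional_def)

lemma flip_flip [simp]: "flip i (flip i s) = s"
  by (auto simp: flip_def)

lemma flip_same [simp]: "flip i s i = - s i"
  by (simp add: flip_def)

lemma flip_eq: "flip i s j = s j - 2 * s i * (if j = i then 1 else 0)"
  by (simp add: flip_def)

lemma sum_flip: "i < N \<Longrightarrow> (\<Sum>j<N. flip i s j) = (\<Sum>j<N. s j) - 2 * s i"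
  unfolding flip_eq sum_subtractf by (simp add: sum.delta if_distrib cong: if_cong)

lemma local_field_flip:
  assumes "i < N"
  shows "local_field j (flip i s) = local_field j s - 2 * a j i * s i"
proof -
  have "local_field j (flip i s) = local_field j s - (\<Sum>k<N. if k = i then 2 * a j i * s i else 0)"
    unfolding local_field_def flip_eq sum_subtractf[symmetric] by (rule sum.cong) (auto simp: algebra_simps)
  also have "(\<Sum>k<N. if k = i then 2 * a j i * s i else 0) = 2 * a j i * s i"
    using assms by (simp add: sum.delta)
  finally show ?thesis .
qed

lemma local_field_flip_same: "i < N \<Longrightarrow> local_field i (flip i s) = local_field i s"
  by (simp add: local_field_flip a_diag)

lemma local_mean_flip_same: "i < N \<Longrightarrow> local_mean h i (flip i s) = local_mean h i s"
  by (simp add: local_mean_def local_field_flip_same)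

lemma energy_flip:
  assumes "i < N"
  shows "energy h (flip i s) = energy h s - 2 * (s i * (\<beta> * local_field i s + h))"
proof -
  have q: "(\<Sum>j<N. \<Sum>k<N. s j * (a j k * s k)) = (\<Sum>j<N. s j * local_field j s)" for s
    by (simp add: local_field_def sum_distrib_left)
  \<comment> \<open>Two equal contributions: the field at every other site moves by
    \<open>- 2 * a j i * s i\<close>, and the spin at i changes sign in front of its own
    field.\<close>
  have "(\<Sum>j<N. flip i s j * local_field j (flip i s)) =
      (\<Sum>j<N. s j * local_field j s - 2 * s i * (a i j * s j)
         - (if j = i then 2 * s i * local_field i s else 0))"
    using assms unfolding local_field_flip[OF assms]
    by (intro sum.cong) (auto simp: flip_eq algebra_simps a_sym[of i] a_diag)
  also have "\<dots> = (\<Sum>j<N. s j * local_field j s) - 2 * s i * local_field i s - 2 * s i * local_field i s"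
    using assms unfolding sum_subtractf by (simp add: sum.delta local_field_def flip: sum_distrib_left)
  finally have 1: "(\<Sum>j<N. flip i s j * local_field j (flip i s)) =
     (\<Sum>j<N. s j * local_field j s) - 4 * (s i * local_field i s)" by simp
  show ?thesis unfolding energy_def q 1 sum_flip[OF assms] by (simp add: algebra_simps)
qed

lemma tanh_spin: "s i = 1 \<or> s i = -1 \<Longrightarrow> tanh (s i * x) = s i * tanh x" for x :: real
  by auto

text \<open>Since s i is a sign, it can be moved inside tanh: with y = s_i (\<beta> m_i + h) the
  weights have ratio e^(-2y) and the rates are (1 + tanh y)/2 and (1 - tanh y)/2.\<close>

lemma detailed_balance:
  assumes "s \<in> spin_configs N" "i < N"
  shows "weight h (flip i s) * flip_rate h i (flip i s) = weight h s * flip_rate h i s"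
proof -
  define y where "y = s i * (\<beta> * local_field i s + h)"
  have t: "tanh y = s i * local_mean h i s"
    unfolding y_def local_mean_def using spin_cases[OF assms] by (rule tanh_spin)
  have "weight h (flip i s) = weight h s * exp (- 2 * y)"
    unfolding weight_def energy_flip[OF assms(2)] y_def by (simp flip: exp_add)
  moreover have "flip_rate h i (flip i s) = (1 + tanh y) / 2"
    by (simp add: flip_rate_def local_mean_flip_same[OF assms(2)] t)
  moreover have "flip_rate h i s = (1 - tanh y) / 2"
    by (simp add: flip_rate_def t)
  ultimately have "weight h (flip i s) * flip_rate h i (flip i s) =
      weight h s * ((exp (- 2 * y) * (1 + tanh y)) / 2)" and r: "flip_rate h i s = (1 - tanh y) / 2"
    by simp_all
  then show ?thesis unfolding exp_tanh_balance r by simp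
qed

lemma abs_local_mean_le: "\<bar>local_mean h i s\<bar> \<le> 1"
  using tanh_real_bounds[of "\<beta> * local_field i s + h"] by (auto simp: local_mean_def)

lemma flip_rate_bounds:
  assumes "s \<in> spin_configs N" "i < N"
  shows "0 \<le> flip_rate h i s" "flip_rate h i s \<le> 1"
  using spin_cases[OF assms] abs_local_mean_le[of h i s] by (auto simp: flip_rate_def)

lemma spin_minus_local_mean:
  assumes "s \<in> spin_configs N" "i < N"
  shows "s i - local_mean h i s = 2 * (flip_rate h i s * s i)"
  using spin_cases[OF assms] by (auto simp: flip_rate_def)

section \<open>Expectations and discrete integration by parts\<close>

lemma E_add: "E h (\<lambda>s. F s + G s) = E h F + E h G"
  and E_diff: "E h (\<lambda>s. F s - G s) = E h F - E h G"
  and E_minus: "E h (\<lambda>s. - F s) = - E h F"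
  by (simp_all add: E_def algebra_simps sum.distrib sum_subtractf sum_negf add_divide_distrib diff_divide_distrib)

lemma E_cmult: "E h (\<lambda>s. c * F s) = c * E h F"
  by (simp add: E_def mult.left_commute flip: sum_distrib_left)

lemma E_const [simp]: "E h (\<lambda>s. c) = c"
  using Z_pos[of h] by (simp add: E_def Z_def flip: sum_distrib_right)

lemma E_sum: "E h (\<lambda>s. \<Sum>i\<in>I. F i s) = (\<Sum>i\<in>I. E h (F i))"
  by (induction I rule: infinite_finite_induct) (auto simp: E_add)

lemma E_cong: "(\<And>s. s \<in> spin_configs N \<Longrightarrow> F s = G s) \<Longrightarrow> E h F = E h G"
  by (simp add: E_def)

lemma E_mono: "(\<And>s. s \<in> spin_configs N \<Longrightarrow> F s \<le> G s) \<Longrightarrow> E h F \<le> E h G"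
  using Z_pos[of h] weight_pos[of h]
  by (auto simp: E_def less_imp_le intro!: divide_right_mono sum_mono mult_left_mono)

lemma E_nonneg: "(\<And>s. s \<in> spin_configs N \<Longrightarrow> 0 \<le> F s) \<Longrightarrow> 0 \<le> E h F"
  using E_mono[of "\<lambda>_. 0" F h] by simp

lemma abs_E_le: "\<bar>E h F\<bar> \<le> E h (\<lambda>s. \<bar>F s\<bar>)"
proof (rule abs_leI)
  show "E h F \<le> E h (\<lambda>s. \<bar>F s\<bar>)" by (rule E_mono) simp
  show "- E h F \<le> E h (\<lambda>s. \<bar>F s\<bar>)" unfolding E_minus[symmetric] by (rule E_mono) simp
qed

lemma E_power2_le: "(E h F)\<^sup>2 \<le> E h (\<lambda>s. (F s)\<^sup>2)"
proof -
  define m where "m = E h F"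
  have "0 \<le> E h (\<lambda>s. (F s - m)\<^sup>2)" by (rule E_nonneg) simp
  also have "E h (\<lambda>s. (F s - m)\<^sup>2) = E h (\<lambda>s. (F s)\<^sup>2 + (m\<^sup>2 - 2 * m * F s))"
    by (rule E_cong) (simp add: power2_eq_square algebra_simps)
  also have "\<dots> = E h (\<lambda>s. (F s)\<^sup>2) - m\<^sup>2"
    unfolding E_add E_diff E_cmult E_const m_def[symmetric] by (simp add: power2_eq_square)
  finally show ?thesis by (simp add: m_def)
qed

lemma E_abs_le_sqrt: "E h (\<lambda>s. (F s)\<^sup>2) \<le> c \<Longrightarrow> E h (\<lambda>s. \<bar>F s\<bar>) \<le> sqrt c"
  using E_power2_le[of h "\<lambda>s. \<bar>F s\<bar>"] by (intro real_le_rsqrt) simp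

lemma E_flip:
  assumes "i < N"
  shows "E h (\<lambda>s. flip_rate h i s * G (flip i s)) = E h (\<lambda>s. flip_rate h i s * G s)"
proof -
  have "(\<Sum>s\<in>spin_configs N. weight h s * (flip_rate h i s * G (flip i s)))
      = (\<Sum>s\<in>spin_configs N. weight h s * (flip_rate h i s * G s))"
    by (rule sum.reindex_bij_witness[of _ "flip i" "flip i"])
      (use assms in \<open>auto simp: flip_in detailed_balance mult.assoc[symmetric]\<close>)
  then show ?thesis by (simp add: E_def)
qed

text \<open>Integration by parts from reversibility: a centred spin tested against G sees only the
  change of G under its own flip.\<close>

lemma E_spin_minus_local_mean:
  assumes "i < N"
  shows "E h (\<lambda>s. (s i - local_mean h i s) * G s) =
    E h (\<lambda>s. flip_rate h i s * (s i * (G s - G (flip i s))))"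
proof -
  have "E h (\<lambda>s. flip_rate h i s * (s i * G s)) = E h (\<lambda>s. flip_rate h i s * (flip i s i * G (flip i s)))"
    by (rule E_flip[OF assms, symmetric])
  also have "\<dots> = - E h (\<lambda>s. flip_rate h i s * (s i * G (flip i s)))"
    by (simp flip: E_minus)
  finally have 1: "E h (\<lambda>s. flip_rate h i s * (s i * G s)) = - E h (\<lambda>s. flip_rate h i s * (s i * G (flip i s)))" .
  have "E h (\<lambda>s. (s i - local_mean h i s) * G s) = E h (\<lambda>s. 2 * (flip_rate h i s * (s i * G s)))"
    by (rule E_cong) (simp add: spin_minus_local_mean[OF _ assms])
  also have "\<dots> = E h (\<lambda>s. flip_rate h i s * (s i * G s)) - E h (\<lambda>s. flip_rate h i s * (s i * G (flip i s)))"
    unfolding E_cmult using 1 by simp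
  finally show ?thesis by (simp add: right_diff_distrib E_diff)
qed

lemma E_spin: "i < N \<Longrightarrow> E h (\<lambda>s. s i) = E h (local_mean h i)"
  using E_spin_minus_local_mean[of i h "\<lambda>_. 1"] by (simp add: E_diff)

lemma local_mean_diff_le: "\<bar>local_mean h i s - tanh (\<beta> * x + h)\<bar> \<le> \<beta> * \<bar>local_field i s - x\<bar>"
proof -
  have "\<bar>local_mean h i s - tanh (\<beta> * x + h)\<bar> \<le> \<bar>(\<beta> * local_field i s + h) - (\<beta> * x + h)\<bar>"
    unfolding local_mean_def by (rule tanh_lipschitz)
  also have "\<dots> = \<beta> * \<bar>local_field i s - x\<bar>"
    using \<beta>_pos by (simp add: abs_mult flip: right_diff_distrib)
  finally show ?thesis .
qed

lemma local_mean_flip_diff: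
  assumes "i < N" "j < N" "s \<in> spin_configs N"
  shows "\<bar>local_mean h j s - local_mean h j (flip i s)\<bar> \<le> 2 * \<beta> * a i j"
proof -
  have "\<bar>local_mean h j s - local_mean h j (flip i s)\<bar> \<le> \<beta> * \<bar>local_field j s - local_field j (flip i s)\<bar>"
    using local_mean_diff_le[of h j s "local_field j (flip i s)"] by (simp add: local_mean_def)
  also have "\<bar>local_field j s - local_field j (flip i s)\<bar> = 2 * a i j"
    using spin_cases[OF assms(3,1)] a_nonneg[OF assms(2,1)] a_sym[OF assms(1,2)]
    by (auto simp: local_field_flip[OF assms(1)])
  finally show ?thesis by simp
qed

text \<open>Write G for the sum. Integration by parts bounds E G^2 by the sum of |c_i| times the
  influence of spin i on G, at most 2 |c_i| + 2 \<beta> sum_j a_ij |c_j|; then 2 |c_i c_j| \<le>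
  c_i^2 + c_j^2 and the row sums finish. The order is that of independent terms.\<close>

lemma E_sum_spin_minus_local_mean_le:
  assumes R: "\<And>i. i < N \<Longrightarrow> degree i \<le> R"
  shows "E h (\<lambda>s. (\<Sum>i<N. c i * (s i - local_mean h i s))\<^sup>2) \<le> (2 + 2 * \<beta> * R) * (\<Sum>i<N. (c i)\<^sup>2)"
proof -
  define G where "G s = (\<Sum>j<N. c j * (s j - local_mean h j s))" for s
  have G: "\<bar>G s - G (flip i s)\<bar> \<le> 2 * \<bar>c i\<bar> + (\<Sum>j<N. 2 * \<beta> * (a i j * \<bar>c j\<bar>))"
    if s: "s \<in> spin_configs N" and i: "i < N" for i s
  proof -
    have "G s - G (flip i s) = (\<Sum>j<N. (if j = i then c i * (2 * s i) else 0)
        - c j * (local_mean h j s - local_mean h j (flip i s)))"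
      unfolding G_def sum_subtractf[symmetric] by (rule sum.cong) (auto simp: flip_eq algebra_simps)
    also have "\<dots> = c i * (2 * s i) - (\<Sum>j<N. c j * (local_mean h j s - local_mean h j (flip i s)))"
      using i by (simp add: sum_subtractf sum.delta)
    finally have "\<bar>G s - G (flip i s)\<bar> \<le> \<bar>c i * (2 * s i)\<bar>
        + (\<Sum>j<N. \<bar>c j * (local_mean h j s - local_mean h j (flip i s))\<bar>)"
      using sum_abs[of "\<lambda>j. c j * (local_mean h j s - local_mean h j (flip i s))" "{..<N}"] by linarith
    moreover have "\<bar>c i * (2 * s i)\<bar> = 2 * \<bar>c i\<bar>"
      using spin_cases[OF s i] by (auto simp: abs_mult)
    moreover have "(\<Sum>j<N. \<bar>c j * (local_mean h j s - local_mean h j (flip i s))\<bar>)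
        \<le> (\<Sum>j<N. \<bar>c j\<bar> * (2 * \<beta> * a i j))"
      unfolding abs_mult using s i by (intro sum_mono mult_left_mono local_mean_flip_diff) auto
    ultimately show ?thesis by (simp add: mult_ac)
  qed
  have 1: "c i * E h (\<lambda>s. (s i - local_mean h i s) * G s)
      \<le> 2 * (c i)\<^sup>2 + (\<Sum>j<N. \<beta> * (a i j * ((c i)\<^sup>2 + (c j)\<^sup>2)))" if i: "i < N" for i
  proof -
    define b where "b = 2 * \<bar>c i\<bar> + (\<Sum>j<N. 2 * \<beta> * (a i j * \<bar>c j\<bar>))"
    have "\<bar>E h (\<lambda>s. (s i - local_mean h i s) * G s)\<bar> \<le> E h (\<lambda>s. \<bar>flip_rate h i s * (s i * (G s - G (flip i s)))\<bar>)"
      unfolding E_spin_minus_local_mean[OF i] by (rule abs_E_le)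
    also have "\<dots> \<le> E h (\<lambda>s. b)"
    proof (rule E_mono)
      fix s assume s: "s \<in> spin_configs N"
      have "\<bar>flip_rate h i s * (s i * (G s - G (flip i s)))\<bar> = flip_rate h i s * \<bar>G s - G (flip i s)\<bar>"
        using spin_cases[OF s i] flip_rate_bounds[OF s i, of h] by (auto simp: abs_mult)
      also have "\<dots> \<le> 1 * \<bar>G s - G (flip i s)\<bar>"
        using flip_rate_bounds[OF s i, of h] by (intro mult_right_mono) auto
      also have "\<dots> \<le> b" unfolding b_def using G[OF s i] by simp
      finally show "\<bar>flip_rate h i s * (s i * (G s - G (flip i s)))\<bar> \<le> b" .
    qed
    finally have "\<bar>c i\<bar> * \<bar>E h (\<lambda>s. (s i - local_mean h i s) * G s)\<bar> \<le> \<bar>c i\<bar> * b"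
      by (intro mult_left_mono) auto
    then have "c i * E h (\<lambda>s. (s i - local_mean h i s) * G s) \<le> \<bar>c i\<bar> * b"
      by (simp flip: abs_mult)
    also have "\<bar>c i\<bar> * b = 2 * (c i)\<^sup>2 + (\<Sum>j<N. \<beta> * (a i j * (2 * (\<bar>c i\<bar> * \<bar>c j\<bar>))))"
      by (simp add: b_def distrib_left sum_distrib_left mult_ac power2_eq_square)
    also have "\<dots> \<le> 2 * (c i)\<^sup>2 + (\<Sum>j<N. \<beta> * (a i j * ((c i)\<^sup>2 + (c j)\<^sup>2)))"
    proof -
      have "2 * (\<bar>c i\<bar> * \<bar>c j\<bar>) \<le> (c i)\<^sup>2 + (c j)\<^sup>2" for j
        using sum_squares_bound[of "\<bar>c i\<bar>" "\<bar>c j\<bar>"] by simp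
      then show ?thesis
        using i a_nonneg \<beta>_pos by (intro add_left_mono sum_mono mult_left_mono) auto
    qed
    finally show ?thesis .
  qed
  have "E h (\<lambda>s. (G s)\<^sup>2) = E h (\<lambda>s. \<Sum>i<N. c i * ((s i - local_mean h i s) * G s))"
    by (rule E_cong) (simp add: power2_eq_square, simp add: G_def sum_distrib_right mult.assoc)
  also have "\<dots> = (\<Sum>i<N. c i * E h (\<lambda>s. (s i - local_mean h i s) * G s))"
    unfolding E_sum E_cmult ..
  also have "\<dots> \<le> (\<Sum>i<N. 2 * (c i)\<^sup>2 + (\<Sum>j<N. \<beta> * (a i j * ((c i)\<^sup>2 + (c j)\<^sup>2))))"
    using 1 by (intro sum_mono) auto
  also have "\<dots> = 2 * (\<Sum>i<N. (c i)\<^sup>2) + \<beta> * ((\<Sum>i<N. \<Sum>j<N. a i j * (c i)\<^sup>2) + (\<Sum>i<N. \<Sum>j<N. a i j * (c j)\<^sup>2))"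
    by (simp add: sum.distrib sum_distrib_left distrib_left)
  also have "(\<Sum>i<N. \<Sum>j<N. a i j * (c j)\<^sup>2) = (\<Sum>i<N. \<Sum>j<N. a i j * (c i)\<^sup>2)"
    by (subst sum.swap) (auto intro!: sum.cong simp: a_sym)
  also have "(\<Sum>i<N. \<Sum>j<N. a i j * (c i)\<^sup>2) = (\<Sum>i<N. degree i * (c i)\<^sup>2)"
    by (simp add: degree_def sum_distrib_right)
  also have "2 * (\<Sum>i<N. (c i)\<^sup>2) + \<beta> * ((\<Sum>i<N. degree i * (c i)\<^sup>2) + (\<Sum>i<N. degree i * (c i)\<^sup>2))
     \<le> 2 * (\<Sum>i<N. (c i)\<^sup>2) + \<beta> * ((\<Sum>i<N. R * (c i)\<^sup>2) + (\<Sum>i<N. R * (c i)\<^sup>2))"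
    using R \<beta>_pos by (intro add_mono mult_left_mono sum_mono mult_right_mono) auto
  also have "\<dots> = (2 + 2 * \<beta> * R) * (\<Sum>i<N. (c i)\<^sup>2)"
    by (simp add: algebra_simps flip: sum_distrib_left)
  finally show ?thesis by (simp add: G_def)
qed

end

section \<open>Deviation of the local fields\<close>

context ising_model
begin

text \<open>Largest eigenvalue at most \<Lambda>, stated through the quadratic form so that it can
  be tested on the vector of absolute values.\<close>

definition spectral_bound :: "real \<Rightarrow> bool" where
  "spectral_bound \<Lambda> \<longleftrightarrow> (\<forall>x. (\<Sum>i<N. \<Sum>j<N. x i * (a i j * x j)) \<le> \<Lambda> * (\<Sum>i<N. (x i)\<^sup>2))"

lemma spectral_bound_mono:
  assumes "spectral_bound \<Lambda>" "\<Lambda> \<le> \<Lambda>'"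
  shows "spectral_bound \<Lambda>'"
  unfolding spectral_bound_def
proof
  fix x :: "nat \<Rightarrow> real"
  have "(\<Sum>i<N. \<Sum>j<N. x i * (a i j * x j)) \<le> \<Lambda> * (\<Sum>i<N. (x i)\<^sup>2)"
    using assms(1) by (simp add: spectral_bound_def)
  also have "\<dots> \<le> \<Lambda>' * (\<Sum>i<N. (x i)\<^sup>2)"
    using assms(2) by (intro mult_right_mono sum_nonneg) auto
  finally show "(\<Sum>i<N. \<Sum>j<N. x i * (a i j * x j)) \<le> \<Lambda>' * (\<Sum>i<N. (x i)\<^sup>2)" .
qed

text \<open>Pair the equation with y. Nonnegative couplings allow passing to absolute values, where
  the quadratic form costs \<rho> \<Lambda> |y|^2; the gap \<kappa> pays for the product of y and
  g.\<close>

lemma fixed_point_perturbation: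
  assumes \<Lambda>: "spectral_bound \<Lambda>"
    and y: "\<And>i. i < N \<Longrightarrow> y i = (\<Sum>j<N. a i j * w j) + g i"
    and w: "\<And>j. j < N \<Longrightarrow> \<bar>w j\<bar> \<le> \<rho> * \<bar>y j\<bar>"
    and \<rho>: "0 \<le> \<rho>" and \<kappa>: "0 < \<kappa>" "\<kappa> \<le> 1 - \<rho> * \<Lambda>"
  shows "\<kappa>\<^sup>2 * (\<Sum>i<N. (y i)\<^sup>2) \<le> (\<Sum>i<N. (g i)\<^sup>2)"
proof -
  define Y where "Y = (\<Sum>i<N. (y i)\<^sup>2)"
  define Q where "Q = (\<Sum>i<N. (g i)\<^sup>2)"
  have Y0: "0 \<le> Y" unfolding Y_def by (intro sum_nonneg) auto
  have "Y = (\<Sum>i<N. y i * (\<Sum>j<N. a i j * w j)) + (\<Sum>i<N. y i * g i)"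
    unfolding Y_def sum.distrib[symmetric]
    by (rule sum.cong) (auto simp: power2_eq_square distrib_left[symmetric] y[symmetric])
  moreover have "(\<Sum>i<N. y i * (\<Sum>j<N. a i j * w j)) \<le> \<rho> * (\<Lambda> * Y)"
  proof -
    have "(\<Sum>i<N. y i * (\<Sum>j<N. a i j * w j)) \<le> (\<Sum>i<N. \<Sum>j<N. \<rho> * (\<bar>y i\<bar> * (a i j * \<bar>y j\<bar>)))"
      unfolding sum_distrib_left
    proof (intro sum_mono)
      fix i j assume ij: "i \<in> {..<N}" "j \<in> {..<N}"
      have "y i * (a i j * w j) \<le> \<bar>y i\<bar> * (a i j * \<bar>w j\<bar>)"
        using abs_ge_self[of "y i * (a i j * w j)"] a_nonneg ij by (simp add: abs_mult)
      also have "\<dots> \<le> \<bar>y i\<bar> * (a i j * (\<rho> * \<bar>y j\<bar>))"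
        using a_nonneg ij w by (intro mult_left_mono) auto
      finally show "y i * (a i j * w j) \<le> \<rho> * (\<bar>y i\<bar> * (a i j * \<bar>y j\<bar>))" by (simp add: mult_ac)
    qed
    also have "\<dots> = \<rho> * (\<Sum>i<N. \<Sum>j<N. \<bar>y i\<bar> * (a i j * \<bar>y j\<bar>))"
      by (simp add: sum_distrib_left)
    also have "\<dots> \<le> \<rho> * (\<Lambda> * (\<Sum>i<N. \<bar>y i\<bar>\<^sup>2))"
      using \<Lambda>[unfolded spectral_bound_def, rule_format, of "\<lambda>i. \<bar>y i\<bar>"] \<rho> by (intro mult_left_mono)
    finally show ?thesis by (simp add: Y_def)
  qed
  \<comment> \<open>Weighted arithmetic-geometric mean inequality, with the weight chosen to spend
    half of the gap \<kappa>.\<close>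
  moreover have "(\<Sum>i<N. y i * g i) \<le> \<kappa> / 2 * Y + 1 / (2 * \<kappa>) * Q"
    unfolding Y_def Q_def sum_distrib_left sum.distrib[symmetric]
  proof (rule sum_mono)
    fix i
    have "0 \<le> (\<kappa> * y i - g i)\<^sup>2 / (2 * \<kappa>)" using \<kappa>(1) by simp
    also have "\<dots> = \<kappa> / 2 * (y i)\<^sup>2 + 1 / (2 * \<kappa>) * (g i)\<^sup>2 - y i * g i"
      using \<kappa>(1) by (simp add: field_simps power2_eq_square)
    finally show "y i * g i \<le> \<kappa> / 2 * (y i)\<^sup>2 + 1 / (2 * \<kappa>) * (g i)\<^sup>2" by simp
  qed
  moreover have "\<kappa> * Y \<le> (1 - \<rho> * \<Lambda>) * Y" using \<kappa> Y0 by (intro mult_right_mono) auto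
  ultimately have "\<kappa> / 2 * Y \<le> 1 / (2 * \<kappa>) * Q" by (simp add: algebra_simps)
  from mult_left_mono[OF this, of "2 * \<kappa>"] \<kappa>(1) have "\<kappa>\<^sup>2 * Y \<le> Q"
    by (simp add: field_simps power2_eq_square)
  then show ?thesis by (simp add: Y_def Q_def)
qed

definition field_deviation :: "real \<Rightarrow> real \<Rightarrow> real" where
  "field_deviation h t = E h (\<lambda>s. \<Sum>i<N. (local_field i s - t)\<^sup>2)"

lemma field_deviation_nonneg: "0 \<le> field_deviation h t"
  unfolding field_deviation_def by (intro E_nonneg sum_nonneg) auto

text \<open>For every single configuration m = A tanh(\<beta> m) + g, where g_i is the sum of the
  centred spins with weights a_ij. As |tanh(\<beta> x)| \<le> \<beta> |x|, the perturbation lemma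
  applies pathwise, and E g_i^2 is at most a constant times the squared i-th row.\<close>

lemma field_deviation_high_temperature:
  assumes R: "\<And>i. i < N \<Longrightarrow> degree i \<le> R" and \<Lambda>: "spectral_bound \<Lambda>"
    and \<kappa>: "0 < \<kappa>" "\<kappa> \<le> 1 - \<beta> * \<Lambda>"
  shows "\<kappa>\<^sup>2 * field_deviation 0 0 \<le> (2 + 2 * \<beta> * R) * F2"
proof -
  define g where "g i s = (\<Sum>j<N. a i j * (s j - local_mean 0 j s))" for i s
  have "\<kappa>\<^sup>2 * field_deviation 0 0 = E 0 (\<lambda>s. \<kappa>\<^sup>2 * (\<Sum>i<N. (local_field i s)\<^sup>2))"
    unfolding field_deviation_def E_cmult[symmetric] by simp
  also have "\<dots> \<le> E 0 (\<lambda>s. \<Sum>i<N. (g i s)\<^sup>2)"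
  proof (rule E_mono)
    fix s
    show "\<kappa>\<^sup>2 * (\<Sum>i<N. (local_field i s)\<^sup>2) \<le> (\<Sum>i<N. (g i s)\<^sup>2)"
    proof (rule fixed_point_perturbation[OF \<Lambda> _ _ _ \<kappa>])
      show "local_field i s = (\<Sum>j<N. a i j * local_mean 0 j s) + g i s" for i
        by (simp add: local_field_def g_def right_diff_distrib sum_subtractf)
      show "\<bar>local_mean 0 j s\<bar> \<le> \<beta> * \<bar>local_field j s\<bar>" for j
        using local_mean_diff_le[of 0 j s 0] by simp
    qed (use \<beta>_pos in simp)
  qed
  also have "\<dots> \<le> (\<Sum>i<N. (2 + 2 * \<beta> * R) * (\<Sum>j<N. (a i j)\<^sup>2))"
    unfolding E_sum g_def by (intro sum_mono E_sum_spin_minus_local_mean_le R)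
  also have "\<dots> = (2 + 2 * \<beta> * R) * F2" by (simp add: F2_def sum_distrib_left)
  finally show ?thesis .
qed

text \<open>The variance of m_i is the quadratic form of the covariance matrix at row i. Nonnegative
  covariances allow a_ij a_ik \<le> (a_ij^2 + a_ik^2)/2 under the sum, and then the bound 2/h on row
  sums of covariances applies.\<close>

lemma sum_variance_local_field_le:
  assumes h: "0 < h"
  shows "(\<Sum>i<N. E h (\<lambda>s. (local_field i s - E h (local_field i))\<^sup>2)) \<le> 2 / h * F2"
proof -
  have C: "cov h j k = cov h k j" for j k by (simp add: cov_def mult.commute)
  have m: "E h (local_field i) = (\<Sum>j<N. a i j * E h (\<lambda>s. s j))" for i
    unfolding local_field_def[abs_def] E_sum E_cmult ..
  have v: "E h (\<lambda>s. (local_field i s - E h (local_field i))\<^sup>2) = (\<Sum>j<N. \<Sum>k<N. a i j * a i k * cov h j k)" for i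
  proof -
    define \<mu> where "\<mu> = E h (local_field i)"
    have "E h (\<lambda>s. (local_field i s - \<mu>)\<^sup>2) = E h (\<lambda>s. (local_field i s)\<^sup>2 - (2 * \<mu> * local_field i s - \<mu>\<^sup>2))"
      by (rule E_cong) (simp add: power2_eq_square algebra_simps)
    also have "\<dots> = E h (\<lambda>s. (local_field i s)\<^sup>2) - \<mu>\<^sup>2"
      unfolding E_diff E_cmult E_const \<mu>_def[symmetric] by (simp add: power2_eq_square)
    also have "E h (\<lambda>s. (local_field i s)\<^sup>2) = E h (\<lambda>s. \<Sum>j<N. \<Sum>k<N. a i j * a i k * (s j * s k))"
      by (simp add: local_field_def power2_eq_square sum_product mult_ac)
    also have "\<dots> = (\<Sum>j<N. \<Sum>k<N. a i j * a i k * E h (\<lambda>s. s j * s k))"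
      unfolding E_sum E_cmult ..
    also have "\<mu>\<^sup>2 = (\<Sum>j<N. \<Sum>k<N. a i j * a i k * (E h (\<lambda>s. s j) * E h (\<lambda>s. s k)))"
      unfolding \<mu>_def m power2_eq_square sum_product by (simp add: mult_ac)
    finally show ?thesis by (simp add: \<mu>_def cov_def right_diff_distrib sum_subtractf)
  qed
  have le: "(\<Sum>j<N. \<Sum>k<N. a i j * a i k * cov h j k) \<le> (\<Sum>j<N. (a i j)\<^sup>2 * (2 / h))" if i: "i < N" for i
  proof -
    have "(\<Sum>j<N. \<Sum>k<N. a i j * a i k * cov h j k)
        \<le> (\<Sum>j<N. \<Sum>k<N. (a i j)\<^sup>2 / 2 * cov h j k + (a i k)\<^sup>2 / 2 * cov h k j)"
    proof (intro sum_mono)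
      fix j k assume jk: "j \<in> {..<N}" "k \<in> {..<N}"
      have "a i j * a i k \<le> (a i j)\<^sup>2 / 2 + (a i k)\<^sup>2 / 2"
        using sum_squares_bound[of "a i j" "a i k"] by simp
      from mult_right_mono[OF this, of "cov h j k"] cov_nonneg[of h j k] h jk
      show "a i j * a i k * cov h j k \<le> (a i j)\<^sup>2 / 2 * cov h j k + (a i k)\<^sup>2 / 2 * cov h k j"
        by (simp add: distrib_right C[of k j])
    qed
    also have "\<dots> = (\<Sum>j<N. \<Sum>k<N. (a i j)\<^sup>2 / 2 * cov h j k) + (\<Sum>k<N. \<Sum>j<N. (a i k)\<^sup>2 / 2 * cov h k j)"
      unfolding sum.distrib by (subst sum.swap[of "\<lambda>j k. (a i k)\<^sup>2 / 2 * cov h k j"]) simp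
    also have "\<dots> = (\<Sum>j<N. (a i j)\<^sup>2 * (\<Sum>k<N. cov h j k))"
      by (simp add: sum.distrib[symmetric] sum_distrib_left field_simps)
    also have "\<dots> \<le> (\<Sum>j<N. (a i j)\<^sup>2 * (2 / h))"
      using h by (intro sum_mono mult_left_mono sum_cov_le) auto
    finally show ?thesis .
  qed
  have "(\<Sum>i<N. E h (\<lambda>s. (local_field i s - E h (local_field i))\<^sup>2)) \<le> (\<Sum>i<N. \<Sum>j<N. (a i j)\<^sup>2 * (2 / h))"
    unfolding v by (intro sum_mono le) auto
  also have "\<dots> = 2 / h * F2"
    unfolding F2_def sum_distrib_left by (simp add: mult_ac)
  finally show ?thesis .
qed

text \<open>Schur test: Cauchy-Schwarz in each row with weights a_ij, then column sums, which are
  row sums by symmetry.\<close>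

lemma sum_square_le_degree:
  assumes R: "\<And>i. i < N \<Longrightarrow> degree i \<le> R"
  shows "(\<Sum>i<N. (\<Sum>j<N. a i j * x j)\<^sup>2) \<le> R\<^sup>2 * (\<Sum>j<N. (x j)\<^sup>2)"
proof -
  have d0: "0 \<le> degree i" if "i < N" for i
    unfolding degree_def using that a_nonneg by (intro sum_nonneg) auto
  have 1: "(\<Sum>j<N. a i j * x j)\<^sup>2 \<le> R * (\<Sum>j<N. a i j * (x j)\<^sup>2)" if i: "i < N" for i
  proof -
    have "(\<Sum>j<N. a i j * x j)\<^sup>2 = (\<Sum>j<N. sqrt (a i j) * (sqrt (a i j) * x j))\<^sup>2"
      using a_nonneg[OF i] by (intro arg_cong[where f = "\<lambda>x. x\<^sup>2"] sum.cong) (auto simp: mult.assoc[symmetric])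
    also have "\<dots> \<le> (\<Sum>j<N. (sqrt (a i j))\<^sup>2) * (\<Sum>j<N. (sqrt (a i j) * x j)\<^sup>2)"
      by (rule Cauchy_Schwarz_ineq_sum)
    also have "\<dots> = degree i * (\<Sum>j<N. a i j * (x j)\<^sup>2)"
      using a_nonneg[OF i] by (simp add: degree_def power_mult_distrib)
    also have "\<dots> \<le> R * (\<Sum>j<N. a i j * (x j)\<^sup>2)"
      using R[OF i] a_nonneg[OF i] by (intro mult_right_mono sum_nonneg) auto
    finally show ?thesis .
  qed
  have "(\<Sum>i<N. (\<Sum>j<N. a i j * x j)\<^sup>2) \<le> (\<Sum>i<N. R * (\<Sum>j<N. a i j * (x j)\<^sup>2))"
    using 1 by (intro sum_mono) auto
  also have "\<dots> = R * (\<Sum>j<N. \<Sum>i<N. a j i * (x j)\<^sup>2)"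
    unfolding sum_distrib_left[symmetric] by (subst sum.swap) (auto intro!: sum.cong simp: a_sym)
  also have "\<dots> = R * (\<Sum>j<N. degree j * (x j)\<^sup>2)"
    by (simp add: degree_def sum_distrib_right)
  also have "\<dots> \<le> R * (\<Sum>j<N. R * (x j)\<^sup>2)"
  proof (cases "N = 0")
    case False
    then have "0 \<le> R" using d0[of 0] R[of 0] by simp
    then show ?thesis using R by (intro mult_left_mono sum_mono mult_right_mono) auto
  qed simp
  finally show ?thesis by (simp add: power2_eq_square sum_distrib_left mult.assoc)
qed

text \<open>The means \<mu>_i are nonnegative, so the contraction on the half line applies to \<mu>
  = A tanh(\<beta> \<mu> + h) + A x. Here x is the error of moving the expectation inside tanh,
  controlled by the variances. The constant vector t solves the equation up to t (R_i - 1), whence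
  the last term.\<close>

lemma field_deviation_positive_field:
  assumes R: "\<And>i. i < N \<Longrightarrow> degree i \<le> R" and \<Lambda>: "spectral_bound \<Lambda>"
    and \<rho>: "0 \<le> \<rho>" "\<And>x. 0 \<le> x \<Longrightarrow> \<bar>tanh (\<beta> * x + h) - t\<bar> \<le> \<rho> * \<bar>x - t\<bar>"
    and \<kappa>: "0 < \<kappa>" "\<kappa> \<le> 1 - \<rho> * \<Lambda>"
    and h: "0 < h"
  shows "\<kappa>\<^sup>2 * field_deviation h t \<le>
    (\<kappa>\<^sup>2 + 2 * R\<^sup>2 * \<beta>\<^sup>2) * (2 / h * F2) + 2 * t\<^sup>2 * (\<Sum>i<N. (degree i - 1)\<^sup>2)"
proof -
  define \<mu> where "\<mu> i = E h (local_field i)" for i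
  define V where "V = (\<Sum>i<N. E h (\<lambda>s. (local_field i s - \<mu> i)\<^sup>2))"
  have V: "V \<le> 2 / h * F2" using sum_variance_local_field_le[OF h] by (simp add: V_def \<mu>_def)
  have \<mu>: "\<mu> i = (\<Sum>j<N. a i j * E h (local_mean h j))" for i
    unfolding \<mu>_def local_field_def[abs_def] E_sum E_cmult by (rule sum.cong) (auto simp: E_spin)
  have \<mu>0: "0 \<le> \<mu> i" if "i < N" for i
    unfolding \<mu> using that a_nonneg h E_spin_nonneg[of h] by (intro sum_nonneg mult_nonneg_nonneg) (auto simp flip: E_spin)
  define x where "x j = E h (local_mean h j) - tanh (\<beta> * \<mu> j + h)" for j
  have x: "(x j)\<^sup>2 \<le> \<beta>\<^sup>2 * E h (\<lambda>s. (local_field j s - \<mu> j)\<^sup>2)" for j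
  proof -
    have "(x j)\<^sup>2 = (E h (\<lambda>s. local_mean h j s - tanh (\<beta> * \<mu> j + h)))\<^sup>2"
      by (simp add: x_def E_diff)
    also have "\<dots> \<le> E h (\<lambda>s. (local_mean h j s - tanh (\<beta> * \<mu> j + h))\<^sup>2)" by (rule E_power2_le)
    also have "\<dots> \<le> E h (\<lambda>s. \<beta>\<^sup>2 * (local_field j s - \<mu> j)\<^sup>2)"
    proof (rule E_mono)
      fix s
      show "(local_mean h j s - tanh (\<beta> * \<mu> j + h))\<^sup>2 \<le> \<beta>\<^sup>2 * (local_field j s - \<mu> j)\<^sup>2"
        using power_mono[OF local_mean_diff_le[of h j s "\<mu> j"] abs_ge_zero, of 2] by (simp add: power_mult_distrib)
    qed
    finally show ?thesis by (simp add: E_cmult)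
  qed
  define g where "g i = (\<Sum>j<N. a i j * x j) + t * (degree i - 1)" for i
  have "\<kappa>\<^sup>2 * (\<Sum>i<N. (\<mu> i - t)\<^sup>2) \<le> (\<Sum>i<N. (g i)\<^sup>2)"
  proof (rule fixed_point_perturbation[OF \<Lambda> _ _ \<rho>(1) \<kappa>])
    show "\<mu> i - t = (\<Sum>j<N. a i j * (tanh (\<beta> * \<mu> j + h) - t)) + g i" for i
      by (simp add: \<mu>[of i] g_def x_def degree_def algebra_simps sum.distrib sum_subtractf sum_distrib_left)
    show "\<bar>tanh (\<beta> * \<mu> j + h) - t\<bar> \<le> \<rho> * \<bar>\<mu> j - t\<bar>" if "j < N" for j
      by (rule \<rho>(2)[OF \<mu>0[OF that]])
  qed
  also have "(\<Sum>i<N. (g i)\<^sup>2) \<le> (\<Sum>i<N. 2 * (\<Sum>j<N. a i j * x j)\<^sup>2 + 2 * t\<^sup>2 * (degree i - 1)\<^sup>2)"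
  proof (rule sum_mono)
    fix i
    show "(g i)\<^sup>2 \<le> 2 * (\<Sum>j<N. a i j * x j)\<^sup>2 + 2 * t\<^sup>2 * (degree i - 1)\<^sup>2"
      using sum_squares_bound[of "\<Sum>j<N. a i j * x j" "t * (degree i - 1)"]
      by (simp add: g_def power2_sum power_mult_distrib)
  qed
  also have "\<dots> \<le> 2 * (R\<^sup>2 * (\<Sum>j<N. (x j)\<^sup>2)) + 2 * t\<^sup>2 * (\<Sum>i<N. (degree i - 1)\<^sup>2)"
    using sum_square_le_degree[OF R, of x] by (simp add: sum.distrib flip: sum_distrib_left)
  also have "(\<Sum>j<N. (x j)\<^sup>2) \<le> \<beta>\<^sup>2 * V"
    unfolding V_def sum_distrib_left by (rule sum_mono) (rule x)
  finally have 1: "\<kappa>\<^sup>2 * (\<Sum>i<N. (\<mu> i - t)\<^sup>2) \<le> 2 * (R\<^sup>2 * (\<beta>\<^sup>2 * V)) + 2 * t\<^sup>2 * (\<Sum>i<N. (degree i - 1)\<^sup>2)"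
    by (simp add: mult_left_mono)
  \<comment> \<open>The deviation around t splits into variance and squared bias.\<close>
  have "field_deviation h t = (\<Sum>i<N. E h (\<lambda>s. (local_field i s - \<mu> i)\<^sup>2) + (\<mu> i - t)\<^sup>2)"
    unfolding field_deviation_def E_sum
  proof (rule sum.cong[OF refl])
    fix i
    have "E h (\<lambda>s. (local_field i s - t)\<^sup>2)
        = E h (\<lambda>s. (local_field i s - \<mu> i)\<^sup>2 + (2 * (\<mu> i - t) * (local_field i s - \<mu> i) + (\<mu> i - t)\<^sup>2))"
      by (rule E_cong) (simp add: power2_eq_square algebra_simps)
    then show "E h (\<lambda>s. (local_field i s - t)\<^sup>2) = E h (\<lambda>s. (local_field i s - \<mu> i)\<^sup>2) + (\<mu> i - t)\<^sup>2"
      unfolding E_add E_cmult E_diff E_const \<mu>_def[symmetric] by simp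
  qed
  then have "\<kappa>\<^sup>2 * field_deviation h t = \<kappa>\<^sup>2 * V + \<kappa>\<^sup>2 * (\<Sum>i<N. (\<mu> i - t)\<^sup>2)"
    by (simp add: V_def sum.distrib distrib_left)
  also have "\<dots> \<le> (\<kappa>\<^sup>2 + 2 * R\<^sup>2 * \<beta>\<^sup>2) * V + 2 * t\<^sup>2 * (\<Sum>i<N. (degree i - 1)\<^sup>2)"
    using 1 by (simp add: algebra_simps)
  also have "(\<kappa>\<^sup>2 + 2 * R\<^sup>2 * \<beta>\<^sup>2) * V \<le> (\<kappa>\<^sup>2 + 2 * R\<^sup>2 * \<beta>\<^sup>2) * (2 / h * F2)"
    using V by (intro mult_left_mono) auto
  finally show ?thesis by simp
qed

text \<open>The restriction keeps the value \<open>undefined\<close> off {..<N}, so that the map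
  stays inside \<open>spin_configs\<close>.\<close>

definition spin_neg :: "(nat \<Rightarrow> real) \<Rightarrow> (nat \<Rightarrow> real)" where
  "spin_neg s = restrict (\<lambda>i. - s i) {..<N}"

lemma field_deviation_minus: "field_deviation (- h) (- t) = field_deviation h t"
proof -
  have in_C: "spin_neg s \<in> spin_configs N" if "s \<in> spin_configs N" for s
    using that unfolding spin_configs_def spin_neg_def by (auto simp: PiE_iff)
  have nn: "spin_neg (spin_neg s) = s" if "s \<in> spin_configs N" for s
    using that unfolding spin_configs_def spin_neg_def by (auto simp: PiE_iff extensional_def fun_eq_iff)
  have w: "weight (- h) (spin_neg s) = weight h s" for s
    unfolding weight_def energy_def by (simp add: spin_neg_def sum_negf)
  have f: "local_field i (spin_neg s) = - local_field i s" for i s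
    unfolding local_field_def by (simp add: spin_neg_def sum_negf)
  have d: "(local_field i (spin_neg s) - - t)\<^sup>2 = (local_field i s - t)\<^sup>2" for i s
    unfolding f by (simp add: power2_eq_square algebra_simps)
  have re: "(\<Sum>s\<in>spin_configs N. G (spin_neg s)) = (\<Sum>s\<in>spin_configs N. G s)" for G :: "_ \<Rightarrow> real"
    by (rule sum.reindex_bij_witness[of _ spin_neg spin_neg]) (auto simp: in_C nn)
  have "Z (- h) = Z h"
    unfolding Z_def using re[of "weight (- h)"] by (simp add: w)
  moreover have "(\<Sum>s\<in>spin_configs N. weight (- h) s * (\<Sum>i<N. (local_field i s - - t)\<^sup>2))
      = (\<Sum>s\<in>spin_configs N. weight h s * (\<Sum>i<N. (local_field i s - t)\<^sup>2))"
    using re[of "\<lambda>s. weight (- h) s * (\<Sum>i<N. (local_field i s - - t)\<^sup>2)"] unfolding w d by simp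
  ultimately show ?thesis unfolding field_deviation_def E_def by simp
qed

end

section \<open>Berry--Esseen bound for one Ising model\<close>

text \<open>Mean value theorem with slope 1 - tanh(c)^2; the slope error factors as (tanh v - tanh
  c)(tanh v + tanh c), at most |u - v| times 2.\<close>

lemma tanh_taylor_le: "\<bar>tanh u - tanh v - (1 - (tanh v)\<^sup>2) * (u - v)\<bar> \<le> 2 * (u - v)\<^sup>2" for u v :: real
proof -
  obtain c where c: "\<bar>c - v\<bar> \<le> \<bar>u - v\<bar>" "tanh u - tanh v = (u - v) * (1 - (tanh c)\<^sup>2)"
  proof -
    have der: "(tanh has_real_derivative (1 - (tanh x)\<^sup>2)) (at x)" for x :: real
      by (auto intro!: derivative_eq_intros)
    consider "u = v" | "v < u" | "u < v" by linarith
    then show ?thesis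
    proof cases
      case 2
      from MVT2[OF 2, of tanh "\<lambda>x. 1 - (tanh x)\<^sup>2"] der obtain c
        where "v < c" "c < u" "tanh u - tanh v = (u - v) * (1 - (tanh c)\<^sup>2)" by blast
      then show ?thesis by (intro that[of c]) auto
    next
      case 3
      from MVT2[OF 3, of tanh "\<lambda>x. 1 - (tanh x)\<^sup>2"] der obtain c
        where "u < c" "c < v" "tanh v - tanh u = (v - u) * (1 - (tanh c)\<^sup>2)" by blast
      then show ?thesis by (intro that[of c]) (auto simp: algebra_simps)
    qed (use that[of v] in auto)
  qed
  have "tanh u - tanh v - (1 - (tanh v)\<^sup>2) * (u - v) = (u - v) * ((tanh v - tanh c) * (tanh v + tanh c))"
    unfolding c(2) by (simp add: algebra_simps power2_eq_square)
  also have "\<bar>\<dots>\<bar> \<le> \<bar>u - v\<bar> * (\<bar>u - v\<bar> * 2)"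
  proof -
    have "\<bar>tanh v - tanh c\<bar> \<le> \<bar>u - v\<bar>" using tanh_lipschitz[of v c] c(1) by linarith
    moreover have "\<bar>tanh v + tanh c\<bar> \<le> 2" using tanh_real_bounds[of v] tanh_real_bounds[of c] by auto
    ultimately show ?thesis unfolding abs_mult by (intro mult_mono) auto
  qed
  finally show ?thesis by (simp add: power2_eq_square mult_ac flip: abs_mult)
qed

section \<open>The mean-field equation in a positive field\<close>

locale positive_mean_field =
  fixes \<beta> h t :: real
  assumes \<beta>: "\<beta> > 0" and h: "h > 0" and t: "t > 0" and fp: "t = tanh (\<beta> * t + h)"
begin

lemma slope:
  assumes "x < y"
  obtains c where "x < c" "c < y" "tanh (\<beta> * y + h) - tanh (\<beta> * x + h) = (y - x) * (\<beta> * (1 - (tanh (\<beta> * c + h))\<^sup>2))"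
proof -
  have "\<exists>c>x. c < y \<and> tanh (\<beta> * y + h) - tanh (\<beta> * x + h) = (y - x) * (\<beta> * (1 - (tanh (\<beta> * c + h))\<^sup>2))"
    by (rule MVT2[OF assms]) (auto intro!: derivative_eq_intros)
  with that show ?thesis by blast
qed

text \<open>Concavity of x -> tanh(\<beta> x + h) on x \<ge> 0, where the argument of tanh is
  positive.\<close>

lemma slope_antimono:
  assumes "0 \<le> x" "x \<le> y"
  shows "\<beta> * (1 - (tanh (\<beta> * y + h))\<^sup>2) \<le> \<beta> * (1 - (tanh (\<beta> * x + h))\<^sup>2)"
proof -
  have "(tanh (\<beta> * x + h))\<^sup>2 \<le> (tanh (\<beta> * y + h))\<^sup>2"
    using assms \<beta> h by (intro power_mono) auto
  then show ?thesis using \<beta> by simp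
qed

lemma tanh_h: "0 < tanh h" "tanh h < t"
proof -
  show "0 < tanh h" using h by simp
  have "tanh h < tanh (\<beta> * t + h)" using \<beta> t by simp
  then show "tanh h < t" using fp by simp
qed

text \<open>By concavity the slope at t is at most that of the chord over [0, t], which is (t - tanh
  h)/t < 1.\<close>

lemma slope_at_fixed_point: "\<beta> * (1 - t\<^sup>2) < 1"
proof -
  obtain c where c: "0 < c" "c < t" "tanh (\<beta> * t + h) - tanh (\<beta> * 0 + h) = (t - 0) * (\<beta> * (1 - (tanh (\<beta> * c + h))\<^sup>2))"
    by (rule slope[OF t])
  have "\<beta> * (1 - t\<^sup>2) \<le> \<beta> * (1 - (tanh (\<beta> * c + h))\<^sup>2)"
    using slope_antimono[of c t] c fp by simp
  then have "t * (\<beta> * (1 - t\<^sup>2)) \<le> t - tanh h"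
    using c(3) t by (simp flip: fp add: mult_left_mono)
  also have "\<dots> < t * 1" using tanh_h by simp
  finally show ?thesis using t by (simp only: mult_less_cancel_left_pos)
qed

text \<open>The rate is the slope of the chord over [0, t]. Concavity makes the chord between x and
  t no steeper, whether x lies left or right of t.\<close>

lemma contraction:
  assumes x: "0 \<le> x"
  shows "\<bar>tanh (\<beta> * x + h) - t\<bar> \<le> (1 - tanh h / t) * \<bar>x - t\<bar>"
proof -
  let ?f = "\<lambda>x. tanh (\<beta> * x + h)"
  have "t * \<bar>?f x - t\<bar> \<le> (t - tanh h) * \<bar>x - t\<bar>"
  proof -
    consider "x = t" | "x = 0" | "0 < x" "x < t" | "t < x" using x by linarith
    then show ?thesis
    proof cases
      case 1
      then show ?thesis using fp by simp
    next
      case 2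
      then show ?thesis using tanh_h t by (simp add: abs_if)
    next
      case 3
      obtain c where c: "x < c" "c < t" "?f t - ?f x = (t - x) * (\<beta> * (1 - (?f c)\<^sup>2))" by (rule slope[OF 3(2)])
      obtain d where d: "0 < d" "d < x" "?f x - ?f 0 = (x - 0) * (\<beta> * (1 - (?f d)\<^sup>2))" by (rule slope[OF 3(1)])
      \<comment> \<open>The slope over [x, t] is compared with that over [0, x]; combining the two
        pieces yields the comparison with the chord over [0, t].\<close>
      have m: "\<beta> * (1 - (?f c)\<^sup>2) \<le> \<beta> * (1 - (?f d)\<^sup>2)" using slope_antimono[of d c] c d by simp
      have "x * (t - ?f x) = (t - x) * (x * (\<beta> * (1 - (?f c)\<^sup>2)))" using c(3) fp by simp
      also have "\<dots> \<le> (t - x) * (x * (\<beta> * (1 - (?f d)\<^sup>2)))"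
        by (rule mult_left_mono[OF mult_left_mono[OF m]]) (use 3 in auto)
      also have "\<dots> = (t - x) * (?f x - tanh h)" using d(3) by simp
      finally have "t * (t - ?f x) \<le> (t - tanh h) * (t - x)" by (simp add: algebra_simps)
      moreover have "?f x \<le> ?f t" using 3 \<beta> by simp
      then have "\<bar>?f x - t\<bar> = t - ?f x" by (simp flip: fp)
      moreover have "\<bar>x - t\<bar> = t - x" using 3 by simp
      ultimately show ?thesis by simp
    next
      case 4
      obtain c where c: "t < c" "c < x" "?f x - ?f t = (x - t) * (\<beta> * (1 - (?f c)\<^sup>2))" by (rule slope[OF 4])
      obtain d where d: "0 < d" "d < t" "?f t - ?f 0 = (t - 0) * (\<beta> * (1 - (?f d)\<^sup>2))" by (rule slope[OF t])
      have m: "\<beta> * (1 - (?f c)\<^sup>2) \<le> \<beta> * (1 - (?f d)\<^sup>2)" using slope_antimono[of d c] c d by simp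
      have "t * (?f x - t) = (x - t) * (t * (\<beta> * (1 - (?f c)\<^sup>2)))" using c(3) by (simp flip: fp)
      also have "\<dots> \<le> (x - t) * (t * (\<beta> * (1 - (?f d)\<^sup>2)))"
        by (rule mult_left_mono[OF mult_left_mono[OF m]]) (use 4 t in auto)
      also have "\<dots> = (x - t) * (t - tanh h)" using d(3) by (simp flip: fp)
      finally have "t * (?f x - t) \<le> (t - tanh h) * (x - t)" by (simp add: mult.commute)
      moreover have "?f t \<le> ?f x" using 4 \<beta> by simp
      then have "\<bar>?f x - t\<bar> = ?f x - t" by (simp flip: fp)
      moreover have "\<bar>x - t\<bar> = x - t" using 4 by simp
      ultimately show ?thesis by simp
    qed
  qed
  then show ?thesis using t by (simp add: field_simps)
qed

end

lemma rescale:
  fixes v n c d :: real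
  assumes "v \<noteq> 0" "n > 0"
  shows "1 / (n * v) * (c * v * (sqrt n * d)) = c * (d / sqrt n)"
proof -
  define w where "w = sqrt n"
  have "w > 0" "n = w * w" using assms by (auto simp: w_def)
  then show ?thesis using assms unfolding w_def[symmetric] by (simp add: field_simps)
qed

text \<open>For each row sum d, 1 \<le> 2 d^2 + 2 (d - 1)^2, and d^2 is at most N times the squared
  norm of the row. The error bracket thus never drops below 1/2 and can absorb terms of order
  1.\<close>

lemma (in ising_model) one_le_F2_plus_degree_deviation:
  assumes N_pos: "N > 0"
  shows "1 \<le> 2 * (F2 + (\<Sum>i<N. (degree i - 1)\<^sup>2))"
proof -
  define C2 where "C2 = (\<Sum>i<N. (degree i - 1)\<^sup>2)"
  have C2_nonneg: "0 \<le> C2" unfolding C2_def by (intro sum_nonneg) auto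
  have N1: "1 \<le> real N" using N_pos by simp
  have "(degree i)\<^sup>2 \<le> real N * (\<Sum>j<N. (a i j)\<^sup>2)" for i
    using Cauchy_Schwarz_ineq_sum[of "\<lambda>_. 1" "a i" "{..<N}"] by (simp add: degree_def)
  then have "(\<Sum>i<N. (degree i)\<^sup>2) \<le> real N * F2"
    unfolding F2_def sum_distrib_left by (intro sum_mono) auto
  moreover have "(\<Sum>i<N. 1) \<le> (\<Sum>i<N. 2 * (degree i)\<^sup>2 + 2 * (degree i - 1)\<^sup>2)"
  proof (rule sum_mono)
    fix i
    have "0 \<le> (2 * degree i - 1)\<^sup>2" by simp
    then show "1 \<le> 2 * (degree i)\<^sup>2 + 2 * (degree i - 1)\<^sup>2" by (simp add: power2_eq_square algebra_simps)
  qed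
  then have "real N \<le> 2 * (\<Sum>i<N. (degree i)\<^sup>2) + 2 * C2"
    by (simp add: sum.distrib C2_def sum_distrib_left)
  moreover have "2 * C2 \<le> real N * (2 * C2)"
    using mult_right_mono[OF N1, of "2 * C2"] C2_nonneg by simp
  ultimately have "real N * 1 \<le> real N * (2 * (F2 + C2))" by (simp add: algebra_simps)
  then show ?thesis unfolding C2_def[symmetric] using N_pos by (simp only: mult_le_cancel_left_pos of_nat_0_less_iff)
qed

section \<open>Error terms for one model\<close>

locale berry_esseen_setting = ising_model +
  fixes h t R K :: real
  assumes N_pos: "N > 0"
    and t_abs: "\<bar>t\<bar> < 1" and t_fp: "t = tanh (\<beta> * t + h)"
    and \<theta>_lt: "\<beta> * (1 - t\<^sup>2) < 1"
    and degree_le: "\<And>i. i < N \<Longrightarrow> degree i \<le> R" and R_nonneg: "0 \<le> R"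
    and deviation_le: "field_deviation h t \<le> K * (F2 + (\<Sum>i<N. (degree i - 1)\<^sup>2))" and K_nonneg: "0 \<le> K"
begin

text \<open>Slope of the mean-field map x -> tanh(\<beta> x + h) at t; 1 - \<theta> is the
  relaxation rate of the total spin.\<close>

definition "\<theta> = \<beta> * (1 - t\<^sup>2)"
definition "\<tau> = (1 - t\<^sup>2) / (1 - \<theta>)"
definition "C2 = (\<Sum>i<N. (degree i - 1)\<^sup>2)"
definition "D = F2 + C2 + \<bar>t\<bar> * \<bar>\<Sum>i<N. (degree i - 1)\<bar>"
definition "L = 2 + 2 * \<beta> * R"
definition "M2 = field_deviation h t"
text \<open>S is N times the deviation of the mean spin, Y the summed drift under resampling, and
  \<open>rem\<close> the part of the drift that is not linear in S.\<close>

definition S where "S s = (\<Sum>i<N. s i) - real N * t"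
definition Y where "Y s = (\<Sum>i<N. s i - local_mean h i s)"
definition rem where "rem s = Y s - (1 - \<theta>) * S s"

lemma t2: "0 < 1 - t\<^sup>2" using t_abs by (simp add: abs_square_less_1)
lemma \<theta>: "0 < \<theta>" "\<theta> < 1" using t2 \<beta>_pos \<theta>_lt by (auto simp: \<theta>_def)
lemma \<tau>_pos: "0 < \<tau>" using t2 \<theta> by (simp add: \<tau>_def)
lemma C2_nonneg: "0 \<le> C2" unfolding C2_def by (intro sum_nonneg) auto
lemma L: "0 < L" using \<beta>_pos R_nonneg by (simp add: L_def add_pos_nonneg)
lemma M2: "0 \<le> M2" "M2 \<le> K * D"
proof -
  show "0 \<le> M2" unfolding M2_def by (rule field_deviation_nonneg)
  have "M2 \<le> K * (F2 + C2)" using deviation_le by (simp add: M2_def C2_def)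
  also have "\<dots> \<le> K * D" using K_nonneg by (intro mult_left_mono) (auto simp: D_def)
  finally show "M2 \<le> K * D" .
qed

lemma one_le_D: "1 \<le> 2 * (F2 + C2)"
  unfolding C2_def by (rule one_le_F2_plus_degree_deviation[OF N_pos])

lemma D_ge: "F2 + C2 \<le> D" "F2 \<le> D" "C2 \<le> D" "1 \<le> 2 * D" "0 < D" "\<bar>t\<bar> * \<bar>\<Sum>i<N. (degree i - 1)\<bar> \<le> D"
proof -
  define w where "w = \<bar>t\<bar> * \<bar>\<Sum>i<N. (degree i - 1)\<bar>"
  have w: "0 \<le> w" "D = F2 + C2 + w" by (simp_all add: w_def D_def)
  have *: "0 \<le> F2" "0 \<le> C2" "1 \<le> 2 * (F2 + C2)"
    using one_le_D F2_nonneg C2_nonneg by auto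
  show "F2 + C2 \<le> D" "F2 \<le> D" "C2 \<le> D" "\<bar>t\<bar> * \<bar>\<Sum>i<N. (degree i - 1)\<bar> \<le> D"
    unfolding w_def[symmetric] using * w by linarith+
  have "2 * (F2 + C2) \<le> 2 * D" using w by simp
  with *(3) show "1 \<le> 2 * D" by (rule order.trans)
  then show "0 < D" by simp
qed

lemma E_abs_Y: "E h (\<lambda>s. \<bar>Y s\<bar>) \<le> sqrt L * sqrt N"
  using E_abs_le_sqrt[of h Y "L * real N"] E_sum_spin_minus_local_mean_le[of R h "\<lambda>_. 1"] degree_le
  by (simp add: Y_def L_def real_sqrt_mult)

text \<open>Taylor expansion of tanh replaces the sum of local means minus t by \<theta> times the
  sum of m_i - t, up to squares. By symmetry the m_i add up to the sum of R_j s_j, so the difference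
  from S involves R_j - 1 alone.\<close>

lemma abs_rem_le:
  "\<bar>rem s\<bar> \<le> \<bar>t\<bar> * \<bar>\<Sum>i<N. (degree i - 1)\<bar> + \<bar>\<Sum>i<N. (degree i - 1) * (s i - local_mean h i s)\<bar>
     + \<beta> / 2 * C2 + (\<beta> / 2 + 2 * \<beta>\<^sup>2) * (\<Sum>i<N. (local_field i s - t)\<^sup>2)"
proof -
  define Q where "Q = (\<Sum>i<N. (local_field i s - t)\<^sup>2)"
  define c where "c i = degree i - 1" for i
  have 1: "\<bar>(\<Sum>i<N. local_mean h i s - t) - \<theta> * (\<Sum>i<N. local_field i s - t)\<bar> \<le> 2 * \<beta>\<^sup>2 * Q"
    unfolding Q_def sum_distrib_left sum_subtractf[symmetric]
  proof (intro order.trans[OF sum_abs] sum_mono)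
    fix i
    have "local_mean h i s - t - \<theta> * (local_field i s - t) =
       tanh (\<beta> * local_field i s + h) - tanh (\<beta> * t + h) - (1 - (tanh (\<beta> * t + h))\<^sup>2) * ((\<beta> * local_field i s + h) - (\<beta> * t + h))"
      unfolding local_mean_def t_fp[symmetric] \<theta>_def by (simp add: algebra_simps)
    also have "\<bar>\<dots>\<bar> \<le> 2 * ((\<beta> * local_field i s + h) - (\<beta> * t + h))\<^sup>2" by (rule tanh_taylor_le)
    also have "\<dots> = 2 * \<beta>\<^sup>2 * (local_field i s - t)\<^sup>2" by (simp add: power2_eq_square algebra_simps)
    finally show "\<bar>local_mean h i s - t - \<theta> * (local_field i s - t)\<bar> \<le> 2 * \<beta>\<^sup>2 * (local_field i s - t)\<^sup>2" .
  qed
  have "(\<Sum>i<N. local_field i s) = (\<Sum>j<N. degree j * s j)"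
    unfolding local_field_def degree_def sum_distrib_right
    by (subst sum.swap) (auto intro!: sum.cong simp: a_sym)
  then have 2: "(\<Sum>i<N. local_field i s - t) = S s + t * (\<Sum>i<N. c i) + (\<Sum>i<N. c i * (s i - t))"
    by (simp add: S_def c_def sum_subtractf algebra_simps sum_distrib_left)
  have 3: "Y s = S s - (\<Sum>i<N. local_mean h i s - t)"
    by (simp add: Y_def S_def sum_subtractf)
  \<comment> \<open>s_i - t is split at the conditional mean: the centred part keeps its
    cancellations, the other part is bounded through m_i - t.\<close>
  have 4: "(\<Sum>i<N. c i * (s i - t)) = (\<Sum>i<N. c i * (s i - local_mean h i s)) + (\<Sum>i<N. c i * (local_mean h i s - t))"
    by (simp add: sum.distrib[symmetric] algebra_simps)
  have 5: "\<bar>\<Sum>i<N. c i * (local_mean h i s - t)\<bar> \<le> \<beta> / 2 * C2 + \<beta> / 2 * Q"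
    unfolding C2_def Q_def sum_distrib_left sum.distrib[symmetric]
  proof (intro order.trans[OF sum_abs] sum_mono)
    fix i
    have "\<bar>local_mean h i s - t\<bar> \<le> \<beta> * \<bar>local_field i s - t\<bar>"
      using local_mean_diff_le[of h i s t] by (simp flip: t_fp)
    then have "\<bar>c i * (local_mean h i s - t)\<bar> \<le> \<bar>c i\<bar> * (\<beta> * \<bar>local_field i s - t\<bar>)"
      unfolding abs_mult by (intro mult_left_mono) auto
    also have "\<dots> = \<beta> / 2 * (2 * \<bar>c i\<bar> * \<bar>local_field i s - t\<bar>)" by simp
    also have "\<dots> \<le> \<beta> / 2 * (\<bar>c i\<bar>\<^sup>2 + \<bar>local_field i s - t\<bar>\<^sup>2)"
      using \<beta>_pos by (intro mult_left_mono sum_squares_bound) auto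
    finally show "\<bar>c i * (local_mean h i s - t)\<bar> \<le> \<beta> / 2 * (degree i - 1)\<^sup>2 + \<beta> / 2 * (local_field i s - t)\<^sup>2"
      by (simp add: c_def distrib_left)
  qed
  define u where "u = t * (\<Sum>i<N. c i) + (\<Sum>i<N. c i * (s i - local_mean h i s)) + (\<Sum>i<N. c i * (local_mean h i s - t))"
  define X where "X = (\<Sum>i<N. local_mean h i s - t) - \<theta> * (\<Sum>i<N. local_field i s - t)"
  have "rem s = - X - \<theta> * u"
    unfolding X_def rem_def 3 2 4 u_def by (simp add: algebra_simps)
  moreover have "\<bar>\<theta> * u\<bar> \<le> \<bar>u\<bar>"
    using \<theta> mult_right_mono[of "\<bar>\<theta>\<bar>" 1 "\<bar>u\<bar>"] by (simp add: abs_mult)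
  ultimately have "\<bar>rem s\<bar> \<le> 2 * \<beta>\<^sup>2 * Q + \<bar>u\<bar>"
    using 1[folded X_def] by linarith
  also have "\<bar>u\<bar> \<le> \<bar>t\<bar> * \<bar>\<Sum>i<N. c i\<bar> + \<bar>\<Sum>i<N. c i * (s i - local_mean h i s)\<bar> + (\<beta> / 2 * C2 + \<beta> / 2 * Q)"
    using 5 unfolding u_def abs_mult[symmetric] by linarith
  finally show ?thesis
    unfolding Q_def[symmetric] c_def[symmetric] distrib_right by simp
qed

text \<open>Built from \<beta>, t, R and K alone, like \<open>c2\<close> and
  \<open>berry_esseen_const\<close> below; neither N nor the couplings enter, which permits one
  constant for the whole sequence.\<close>

definition "c1 = 2 + L / 2 + \<beta> / 2 + (\<beta> / 2 + 2 * \<beta>\<^sup>2) * K"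

lemma c1_nonneg: "0 \<le> c1"
  using L \<beta>_pos K_nonneg by (simp add: c1_def)

lemma E_abs_rem: "E h (\<lambda>s. \<bar>rem s\<bar>) \<le> c1 * D"
proof -
  define G where "G s = (\<Sum>i<N. (degree i - 1) * (s i - local_mean h i s))" for s
  have "E h (\<lambda>s. \<bar>rem s\<bar>) \<le> E h (\<lambda>s. \<bar>t\<bar> * \<bar>\<Sum>i<N. (degree i - 1)\<bar> + \<bar>G s\<bar>
     + \<beta> / 2 * C2 + (\<beta> / 2 + 2 * \<beta>\<^sup>2) * (\<Sum>i<N. (local_field i s - t)\<^sup>2))"
    unfolding G_def by (intro E_mono abs_rem_le)
  also have "\<dots> = \<bar>t\<bar> * \<bar>\<Sum>i<N. (degree i - 1)\<bar> + E h (\<lambda>s. \<bar>G s\<bar>) + \<beta> / 2 * C2 + (\<beta> / 2 + 2 * \<beta>\<^sup>2) * M2"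
    unfolding E_add E_cmult E_const M2_def field_deviation_def ..
  also have "E h (\<lambda>s. \<bar>G s\<bar>) \<le> sqrt (L * C2)"
    using E_sum_spin_minus_local_mean_le[of R h "\<lambda>i. degree i - 1"] degree_le
    by (intro E_abs_le_sqrt) (simp add: G_def L_def C2_def)
  \<comment> \<open>Linearising the root costs 1/2, which \<open>one_le_D\<close> pays back.\<close>
  also have "sqrt (L * C2) \<le> 1 / 2 + L / 2 * C2"
    using arith_geo_mean_sqrt[of 1 "L * C2"] L C2_nonneg by simp
  also have "1 / 2 \<le> F2 + C2" using one_le_D by simp
  finally have "E h (\<lambda>s. \<bar>rem s\<bar>) \<le> D + L / 2 * C2 + \<beta> / 2 * C2 + (\<beta> / 2 + 2 * \<beta>\<^sup>2) * M2"
    by (simp add: D_def)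
  also have "\<dots> \<le> D + L / 2 * D + \<beta> / 2 * D + (\<beta> / 2 + 2 * \<beta>\<^sup>2) * (K * D)"
    using D_ge M2 \<beta>_pos L by (intro add_mono mult_left_mono) auto
  also have "\<dots> \<le> c1 * D" using D_ge by (simp add: c1_def algebra_simps)
  finally show ?thesis .
qed

lemma sqrt_N: "1 \<le> sqrt N" "sqrt N * sqrt N = N"
  using N_pos by auto

text \<open>From (1 - \<theta>) S = Y - rem. The product of sqrt N and D is coarse, but S enters
  below with a factor of order 1/N.\<close>

lemma E_abs_S: "E h (\<lambda>s. \<bar>S s\<bar>) \<le> (2 * sqrt L + c1) / (1 - \<theta>) * (sqrt N * D)"
proof -
  have 1: "(1 - \<theta>) * \<bar>S s\<bar> \<le> \<bar>Y s\<bar> + \<bar>rem s\<bar>" for s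
  proof -
    have "(1 - \<theta>) * \<bar>S s\<bar> = \<bar>(1 - \<theta>) * S s\<bar>" using \<theta> by (simp add: abs_mult)
    also have "\<dots> = \<bar>Y s - rem s\<bar>" by (simp add: rem_def)
    finally show ?thesis by linarith
  qed
  have "(1 - \<theta>) * E h (\<lambda>s. \<bar>S s\<bar>) \<le> E h (\<lambda>s. \<bar>Y s\<bar> + \<bar>rem s\<bar>)"
    unfolding E_cmult[symmetric] by (intro E_mono 1)
  also have "\<dots> \<le> sqrt L * sqrt N + c1 * D"
    unfolding E_add using E_abs_Y E_abs_rem by simp
  also have "\<dots> \<le> sqrt L * sqrt N * (2 * D) + c1 * (sqrt N * D)"
  proof (rule add_mono)
    have "sqrt L * sqrt N * 1 \<le> sqrt L * sqrt N * (2 * D)"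
      by (intro mult_left_mono D_ge) (use L in auto)
    then show "sqrt L * sqrt N \<le> sqrt L * sqrt N * (2 * D)" by (simp only: mult_1_right)
    have "c1 * (1 * D) \<le> c1 * (sqrt N * D)"
      by (intro mult_left_mono mult_right_mono sqrt_N c1_nonneg) (use D_ge in auto)
    then show "c1 * D \<le> c1 * (sqrt N * D)" by simp
  qed
  also have "\<dots> = (2 * sqrt L + c1) * (sqrt N * D)" by (simp add: algebra_simps)
  finally show ?thesis using \<theta> by (simp add: field_simps)
qed

definition "c2 = (\<beta> * (1 + K / 2) + (2 * sqrt L + c1) / (1 - \<theta>)) / (1 - t\<^sup>2)"

text \<open>Up to normalisation, the distance of the conditional second moment of a jump from its
  limit 1 - t^2. It reduces to the sum of s_i times (local mean - t), plus t S.\<close>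

lemma E_variance_term:
  "E h (\<lambda>s. \<bar>1 - (\<Sum>i<N. 1 - s i * local_mean h i s) / (real N * (1 - t\<^sup>2))\<bar>) \<le> c2 * (D / sqrt N)"
proof -
  have 1: "\<bar>1 - (\<Sum>i<N. 1 - s i * local_mean h i s) / (real N * (1 - t\<^sup>2))\<bar>
      \<le> (1 / (real N * (1 - t\<^sup>2))) * (\<beta> / 2 * sqrt N * (\<Sum>i<N. (local_field i s - t)\<^sup>2) + \<beta> / 2 * sqrt N + \<bar>S s\<bar>)"
    if s: "s \<in> spin_configs N" for s
  proof -
    have "1 - (\<Sum>i<N. 1 - s i * local_mean h i s) / (real N * (1 - t\<^sup>2))
        = (1 / (real N * (1 - t\<^sup>2))) * (\<Sum>i<N. s i * local_mean h i s - t\<^sup>2)"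
      using t2 N_pos by (simp add: sum_subtractf field_simps)
    also have "(\<Sum>i<N. s i * local_mean h i s - t\<^sup>2) = (\<Sum>i<N. s i * (local_mean h i s - t)) + t * S s"
      by (simp add: S_def sum_subtractf algebra_simps sum_distrib_left power2_eq_square)
    finally have e: "\<bar>1 - (\<Sum>i<N. 1 - s i * local_mean h i s) / (real N * (1 - t\<^sup>2))\<bar>
        = (1 / (real N * (1 - t\<^sup>2))) * \<bar>(\<Sum>i<N. s i * (local_mean h i s - t)) + t * S s\<bar>"
      using t2 N_pos by (simp add: abs_mult)
    have "\<bar>\<Sum>i<N. s i * (local_mean h i s - t)\<bar> \<le> (\<Sum>i<N. \<beta> / 2 * sqrt N * (local_field i s - t)\<^sup>2 + \<beta> / 2 / sqrt N)"
    proof (intro order.trans[OF sum_abs] sum_mono)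
      fix i assume i: "i \<in> {..<N}"
      have "\<bar>s i * (local_mean h i s - t)\<bar> = \<bar>local_mean h i s - t\<bar>"
        using spin_cases[OF s, of i] i by (auto simp: abs_mult)
      also have "\<dots> \<le> \<beta> * \<bar>local_field i s - t\<bar>"
        using local_mean_diff_le[of h i s t] by (simp flip: t_fp)
      also have "\<bar>local_field i s - t\<bar> \<le> sqrt N / 2 * (local_field i s - t)\<^sup>2 + 1 / 2 / sqrt N"
      proof -
        \<comment> \<open>The weight w = sqrt N balances the two sides: N remainders of order 1/sqrt
          N add up to sqrt N, in step with sqrt N times the field deviation.\<close>
        have p: "x \<le> w / 2 * x\<^sup>2 + 1 / 2 / w" if "w > 0" for x w :: real
        proof -
          have "0 \<le> (w * x - 1)\<^sup>2 / (2 * w)" using that by simp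
          also have "\<dots> = w / 2 * x\<^sup>2 + 1 / 2 / w - x" using that by (simp add: field_simps power2_eq_square)
          finally show ?thesis by simp
        qed
        show ?thesis using p[of "sqrt N" "\<bar>local_field i s - t\<bar>"] N_pos by simp
      qed
      finally show "\<bar>s i * (local_mean h i s - t)\<bar> \<le> \<beta> / 2 * sqrt N * (local_field i s - t)\<^sup>2 + \<beta> / 2 / sqrt N"
        using \<beta>_pos by (simp add: distrib_left mult_ac)
    qed
    also have "\<dots> = \<beta> / 2 * sqrt N * (\<Sum>i<N. (local_field i s - t)\<^sup>2) + \<beta> / 2 * sqrt N"
    proof -
      have "real N * (\<beta> / 2 / sqrt N) = \<beta> / 2 * (real N / sqrt N)" by simp
      also have "real N / sqrt N = sqrt N" by (rule real_div_sqrt) simp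
      finally show ?thesis by (simp only: sum.distrib sum_distrib_left sum_constant card_lessThan)
    qed
    finally have "\<bar>(\<Sum>i<N. s i * (local_mean h i s - t)) + t * S s\<bar>
        \<le> \<beta> / 2 * sqrt N * (\<Sum>i<N. (local_field i s - t)\<^sup>2) + \<beta> / 2 * sqrt N + \<bar>S s\<bar>"
      using mult_right_mono[of "\<bar>t\<bar>" 1 "\<bar>S s\<bar>"] t_abs abs_triangle_ineq[of "\<Sum>i<N. s i * (local_mean h i s - t)" "t * S s"]
      by (simp add: abs_mult)
    then show ?thesis unfolding e using t2 N_pos by (intro mult_left_mono) auto
  qed
  have "E h (\<lambda>s. \<bar>1 - (\<Sum>i<N. 1 - s i * local_mean h i s) / (real N * (1 - t\<^sup>2))\<bar>)
      \<le> (1 / (real N * (1 - t\<^sup>2))) * (\<beta> / 2 * sqrt N * M2 + \<beta> / 2 * sqrt N + E h (\<lambda>s. \<bar>S s\<bar>))"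
    using E_mono[OF 1, of "\<lambda>s. s" h] unfolding E_cmult E_add E_const M2_def field_deviation_def by simp
  also have "\<dots> \<le> (1 / (real N * (1 - t\<^sup>2))) * ((c2 * (1 - t\<^sup>2)) * (sqrt N * D))"
  proof (rule mult_left_mono)
    define P where "P = sqrt N * D"
    have "\<beta> / 2 * sqrt N * M2 \<le> \<beta> / 2 * sqrt N * (K * D)"
      using M2 \<beta>_pos by (intro mult_left_mono) auto
    also have "\<dots> = \<beta> * (K / 2) * P" by (simp add: P_def)
    finally have 1: "\<beta> / 2 * sqrt N * M2 \<le> \<beta> * (K / 2) * P" .
    have "\<beta> / 2 * sqrt N * 1 \<le> \<beta> / 2 * sqrt N * (2 * D)"
      using D_ge \<beta>_pos by (intro mult_left_mono) auto
    then have 2: "\<beta> / 2 * sqrt N \<le> \<beta> * 1 * P" by (simp add: P_def)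
    have "c2 * (1 - t\<^sup>2) = \<beta> * (1 + K / 2) + (2 * sqrt L + c1) / (1 - \<theta>)"
      using t2 by (simp add: c2_def)
    then have "c2 * (1 - t\<^sup>2) * P = \<beta> * 1 * P + \<beta> * (K / 2) * P + (2 * sqrt L + c1) / (1 - \<theta>) * P"
      by (simp only: distrib_right distrib_left)
    with 1 2 show "\<beta> / 2 * sqrt N * M2 + \<beta> / 2 * sqrt N + E h (\<lambda>s. \<bar>S s\<bar>) \<le> c2 * (1 - t\<^sup>2) * (sqrt N * D)"
      using E_abs_S unfolding P_def[symmetric] by linarith
  qed (use t2 in simp)
  also have "\<dots> = c2 * (D / sqrt N)"
    using t2 N_pos by (intro rescale) auto
  finally show ?thesis .
qed

definition "berry_esseen_const = 2 * c2 + 4 * sqrt L / (1 - t\<^sup>2) + 5 * (c1 / ((1 - \<theta>) * sqrt \<tau>))"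

text \<open>Dividing the flip rates by 1 - \<theta> normalises the drift of W = S / sqrt(N \<tau>)
  to W + r, and \<tau> is the value for which the squared jumps add up to 2 in leading order. Every
  jump has size 2 / sqrt(N \<tau>), so the sum of signed squares is a multiple of Y.\<close>

theorem kolmogorov_distance_le:
  "\<bar>E h (\<lambda>s. if S s / sqrt (real N * \<tau>) \<le> z then 1 else 0) - \<Phi> z\<bar> \<le> berry_esseen_const * (D / sqrt N)"
proof -
  define p where "p s = weight h s / Z h" for s
  have E: "E h F = (\<Sum>s\<in>spin_configs N. p s * F s)" for F
    by (simp add: E_def p_def sum_divide_distrib)
  define q where "q = sqrt (real N * \<tau>)"
  have q: "q > 0" "q\<^sup>2 = real N * \<tau>" using N_pos \<tau>_pos by (auto simp: q_def)
  define W where "W s = S s / q" for s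
  define \<kappa> where "\<kappa> i s = p s * flip_rate h i s / (1 - \<theta>)" for i s
  define r where "r s = rem s / ((1 - \<theta>) * q)" for s
  have W: "W s - W (flip i s) = 2 * s i / q" if "i < N" for i s
  proof -
    have "S s - S (flip i s) = 2 * s i" by (simp add: S_def sum_flip[OF that])
    then show ?thesis by (simp add: W_def diff_divide_distrib[symmetric])
  qed
  have p_nonneg: "0 \<le> p s" for s
    using weight_pos[of h s] Z_pos[of h] by (simp add: p_def)
  have al: "P * (x / 2) / y * (4 / w) = 2 * P / (y * w) * x" "P - 2 * P / m * x / 2 = P * (1 - x / m)"
    for P x y w m :: real
    by (simp_all add: algebra_simps)
  have main: "\<bar>(\<Sum>s\<in>spin_configs N. p s * (if W s \<le> z then 1 else 0)) - \<Phi> z\<bar> \<le>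
     2 * (\<Sum>s\<in>spin_configs N. \<bar>p s - (\<Sum>i<N. \<kappa> i s * (W s - W (flip i s))\<^sup>2) / 2\<bar>)
     + (\<Sum>s\<in>spin_configs N. \<bar>\<Sum>i<N. \<kappa> i s * ((W s - W (flip i s)) * \<bar>W s - W (flip i s)\<bar>)\<bar>)
     + 5 * (\<Sum>s\<in>spin_configs N. p s * \<bar>r s\<bar>)"
  proof (rule exchangeable_pair_normal_approximation)
    fix i s assume mem: "i \<in> {..<N}" "s \<in> spin_configs N"
    show "flip i s \<in> spin_configs N" using mem by (simp add: flip_in)
    show "\<kappa> i (flip i s) = \<kappa> i s"
      using detailed_balance[of s i h] mem by (simp add: \<kappa>_def p_def)
    show "0 \<le> \<kappa> i s" using flip_rate_bounds[of s i h] mem p_nonneg[of s] \<theta> by (simp add: \<kappa>_def)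
  next
    show "(\<Sum>s\<in>spin_configs N. p s) = 1" using E[of "\<lambda>_. 1"] by simp
  next
    fix s assume s: "s \<in> spin_configs N"
    have "(\<Sum>i<N. \<kappa> i s * (W s - W (flip i s))) = (\<Sum>i<N. p s / ((1 - \<theta>) * q) * (s i - local_mean h i s))"
    proof (rule sum.cong)
      fix i assume "i \<in> {..<N}"
      then show "\<kappa> i s * (W s - W (flip i s)) = p s / ((1 - \<theta>) * q) * (s i - local_mean h i s)"
        using spin_minus_local_mean[OF s, of i h] by (simp add: W \<kappa>_def)
    qed simp
    also have "\<dots> = p s / ((1 - \<theta>) * q) * Y s" by (simp add: Y_def sum_distrib_left)
    also have "\<dots> = p s * (W s + r s)"
      using \<theta> q by (simp add: W_def r_def rem_def field_simps)
    finally show "(\<Sum>i<N. \<kappa> i s * (W s - W (flip i s))) = p s * (W s + r s)" .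
  qed (auto simp: p_nonneg)
  have e1: "(\<Sum>s\<in>spin_configs N. \<bar>p s - (\<Sum>i<N. \<kappa> i s * (W s - W (flip i s))\<^sup>2) / 2\<bar>)
      = E h (\<lambda>s. \<bar>1 - (\<Sum>i<N. 1 - s i * local_mean h i s) / (real N * (1 - t\<^sup>2))\<bar>)"
    unfolding E
  proof (rule sum.cong[OF refl])
    fix s assume s: "s \<in> spin_configs N"
    have k: "(1 - \<theta>) * q\<^sup>2 = real N * (1 - t\<^sup>2)" using \<theta> by (simp add: q \<tau>_def)
    have "(\<Sum>i<N. \<kappa> i s * (W s - W (flip i s))\<^sup>2) = (\<Sum>i<N. 2 * p s / (real N * (1 - t\<^sup>2)) * (1 - s i * local_mean h i s))"
    proof (rule sum.cong)
      fix i assume i: "i \<in> {..<N}"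
      have "(s i)\<^sup>2 = 1" using spin_cases[OF s, of i] i by auto
      then show "\<kappa> i s * (W s - W (flip i s))\<^sup>2 = 2 * p s / (real N * (1 - t\<^sup>2)) * (1 - s i * local_mean h i s)"
        using i al(1)[of "p s" "1 - s i * local_mean h i s" "1 - \<theta>" "q\<^sup>2"]
        unfolding k[symmetric] by (simp add: W \<kappa>_def flip_rate_def power_divide power_mult_distrib)
    qed simp
    then have "p s - (\<Sum>i<N. \<kappa> i s * (W s - W (flip i s))\<^sup>2) / 2
        = p s * (1 - (\<Sum>i<N. 1 - s i * local_mean h i s) / (real N * (1 - t\<^sup>2)))"
      by (simp only: sum_distrib_left[symmetric] al(2))
    then show "\<bar>p s - (\<Sum>i<N. \<kappa> i s * (W s - W (flip i s))\<^sup>2) / 2\<bar>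
        = p s * \<bar>1 - (\<Sum>i<N. 1 - s i * local_mean h i s) / (real N * (1 - t\<^sup>2))\<bar>"
      using p_nonneg[of s] by (simp add: abs_mult)
  qed
  have e2: "(\<Sum>s\<in>spin_configs N. \<bar>\<Sum>i<N. \<kappa> i s * ((W s - W (flip i s)) * \<bar>W s - W (flip i s)\<bar>)\<bar>)
      = 2 / (real N * (1 - t\<^sup>2)) * E h (\<lambda>s. \<bar>Y s\<bar>)"
    unfolding E sum_distrib_left
  proof (rule sum.cong[OF refl])
    fix s assume s: "s \<in> spin_configs N"
    have k: "(1 - \<theta>) * (q * q) = real N * (1 - t\<^sup>2)" using \<theta> q(2) by (simp add: \<tau>_def power2_eq_square)
    have "(\<Sum>i<N. \<kappa> i s * ((W s - W (flip i s)) * \<bar>W s - W (flip i s)\<bar>))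
        = (\<Sum>i<N. 2 * p s / (real N * (1 - t\<^sup>2)) * (s i - local_mean h i s))"
    proof (rule sum.cong)
      fix i assume i: "i \<in> {..<N}"
      then have i': "i < N" by simp
      have "\<bar>s i\<bar> = 1" using spin_cases[OF s i'] by auto
      then have "\<bar>W s - W (flip i s)\<bar> = 2 / q" using q by (simp add: W[OF i'] abs_mult)
      then show "\<kappa> i s * ((W s - W (flip i s)) * \<bar>W s - W (flip i s)\<bar>) = 2 * p s / (real N * (1 - t\<^sup>2)) * (s i - local_mean h i s)"
        unfolding spin_minus_local_mean[OF s i'] by (simp add: W[OF i'] \<kappa>_def mult_ac flip: k)
    qed simp
    also have "\<dots> = 2 * p s / (real N * (1 - t\<^sup>2)) * Y s" by (simp add: Y_def sum_distrib_left)
    finally show "\<bar>\<Sum>i<N. \<kappa> i s * ((W s - W (flip i s)) * \<bar>W s - W (flip i s)\<bar>)\<bar>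
        = 2 / (real N * (1 - t\<^sup>2)) * (p s * \<bar>Y s\<bar>)"
      using p_nonneg[of s] t2 by (simp add: abs_mult)
  qed
  have e3: "(\<Sum>s\<in>spin_configs N. p s * \<bar>r s\<bar>) = 1 / ((1 - \<theta>) * q) * E h (\<lambda>s. \<bar>rem s\<bar>)"
    unfolding E sum_distrib_left using \<theta> q by (intro sum.cong) (auto simp: r_def abs_mult)
  have b2: "2 / (real N * (1 - t\<^sup>2)) * E h (\<lambda>s. \<bar>Y s\<bar>) \<le> 4 * sqrt L / (1 - t\<^sup>2) * (D / sqrt N)"
  proof -
    have "2 / (real N * (1 - t\<^sup>2)) * E h (\<lambda>s. \<bar>Y s\<bar>) \<le> 2 / (real N * (1 - t\<^sup>2)) * (sqrt L * sqrt N)"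
      using E_abs_Y t2 by (intro mult_left_mono) auto
    also have "\<dots> = 2 * sqrt L / (1 - t\<^sup>2) * (1 / sqrt N)"
      using rescale[of "1 - t\<^sup>2" "real N" "2 * sqrt L / (1 - t\<^sup>2)" 1] t2 N_pos by simp
    also have "\<dots> \<le> 2 * sqrt L / (1 - t\<^sup>2) * (2 * D / sqrt N)"
      using D_ge(4) L t2 by (intro mult_left_mono divide_right_mono) auto
    finally show ?thesis by simp
  qed
  have b3: "1 / ((1 - \<theta>) * q) * E h (\<lambda>s. \<bar>rem s\<bar>) \<le> c1 / ((1 - \<theta>) * sqrt \<tau>) * (D / sqrt N)"
  proof -
    have "1 / ((1 - \<theta>) * q) * E h (\<lambda>s. \<bar>rem s\<bar>) \<le> 1 / ((1 - \<theta>) * q) * (c1 * D)"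
      using E_abs_rem \<theta> q by (intro mult_left_mono) auto
    then show ?thesis by (simp add: q_def real_sqrt_mult mult_ac)
  qed
  define e where "e = D / sqrt N"
  have "berry_esseen_const * e = 2 * (c2 * e) + 4 * sqrt L / (1 - t\<^sup>2) * e + 5 * (c1 / ((1 - \<theta>) * sqrt \<tau>) * e)"
    unfolding berry_esseen_const_def by (simp only: distrib_right mult.assoc)
  then show ?thesis
    using main[unfolded e1 e2 e3 E[of "\<lambda>s. if W s \<le> z then 1 else 0", symmetric]] E_variance_term b2 b3
    unfolding e_def[symmetric] W_def q_def by linarith
qed

end

section \<open>Largest eigenvalue and distribution functions\<close>

context ising_model
begin

text \<open>The unit sphere is realised in the product space of real sequences: coordinates beyond N
  are pinned to 0 and the others lie in [-1, 1], so Tychonoff gives compactness. Homogeneity extends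
  maximality to all x.\<close>

lemma quadratic_form_maximiser:
  assumes N: "N > 0"
  obtains v \<mu> where "(\<Sum>i<N. (v i)\<^sup>2) = 1" "spectral_bound \<mu>"
    "(\<Sum>i<N. \<Sum>j<N. v i * (a i j * v j)) = \<mu>"
proof -
  define q where "q x = (\<Sum>i<N. \<Sum>j<N. x i * (a i j * x j))" for x :: "nat \<Rightarrow> real"
  define C where "C = PiE UNIV (\<lambda>i. if i < N then {-1..1} else {0::real}) \<inter> {x. (\<Sum>i<N. (x i)\<^sup>2) = 1}"
  have cont: "continuous_on A (\<lambda>x :: nat \<Rightarrow> real. x i)" for A i
    by (rule continuous_on_subset[OF continuous_on_product_coordinates]) auto
  have "compact (PiE UNIV (\<lambda>i. if i < N then {-1..1} else {0::real}))"
    unfolding compactin_euclidean_iff[symmetric] euclidean_product_topology[symmetric] compactin_PiE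
    by auto
  moreover have "closed {x :: nat \<Rightarrow> real. (\<Sum>i<N. (x i)\<^sup>2) = 1}"
    by (intro closed_Collect_eq continuous_intros cont)
  ultimately have "compact C" unfolding C_def by (rule compact_Int_closed)
  moreover have "(\<lambda>i. if i = 0 then 1 else 0) \<in> C"
  proof -
    have "(\<Sum>i<N. (if i = 0 then 1 else 0 :: real)\<^sup>2) = (\<Sum>i<N. if i = 0 then 1 else 0)"
      by (rule sum.cong) auto
    then show ?thesis using N by (auto simp: C_def sum.delta)
  qed
  moreover have "continuous_on C q"
    unfolding q_def by (intro continuous_intros cont)
  ultimately obtain v where v: "v \<in> C" "\<And>x. x \<in> C \<Longrightarrow> q x \<le> q v"
    using continuous_attains_sup[of C q] by blast
  have "q x \<le> q v * (\<Sum>i<N. (x i)\<^sup>2)" for x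
  proof (cases "(\<Sum>i<N. (x i)\<^sup>2) = 0")
    case True
    then have "x i = 0" if "i < N" for i
      using that by (simp add: sum_nonneg_eq_0_iff)
    then have "q x = 0" unfolding q_def by (intro sum.neutral) auto
    then show ?thesis using True by simp
  next
    case False
    define n where "n = sqrt (\<Sum>i<N. (x i)\<^sup>2)"
    have "0 \<le> (\<Sum>i<N. (x i)\<^sup>2)" by (intro sum_nonneg) auto
    with False have n: "n > 0" "n\<^sup>2 = (\<Sum>i<N. (x i)\<^sup>2)" by (auto simp: n_def)
    define y where "y i = (if i < N then x i / n else 0)" for i
    have y1: "(\<Sum>i<N. (y i)\<^sup>2) = 1"
    proof -
      have "(\<Sum>i<N. (y i)\<^sup>2) = (\<Sum>i<N. (x i)\<^sup>2) / n\<^sup>2"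
        unfolding sum_divide_distrib by (rule sum.cong) (auto simp: y_def power_divide)
      also have "\<dots> = 1" unfolding n(2)[symmetric] using n(1) by simp
      finally show ?thesis .
    qed
    have "\<bar>y i\<bar> \<le> 1" if "i < N" for i
    proof -
      have "(y i)\<^sup>2 \<le> (\<Sum>i<N. (y i)\<^sup>2)" using that by (intro member_le_sum) auto
      then show ?thesis using y1 by (simp add: abs_square_le_1)
    qed
    then have "y \<in> C" using y1 by (auto simp: C_def abs_le_iff) (auto simp: y_def)
    then have "q y \<le> q v" by (rule v(2))
    moreover have "q y = q x / n\<^sup>2"
      unfolding q_def y_def sum_divide_distrib by (intro sum.cong) (auto simp: power2_eq_square)
    ultimately have "q x / n\<^sup>2 \<le> q v" by simp
    then show ?thesis unfolding n(2)[symmetric] using n(1) by (simp add: field_simps)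
  qed
  then have "spectral_bound (q v)" unfolding spectral_bound_def q_def by blast
  with v show ?thesis by (intro that[of v "q v"]) (auto simp: C_def q_def)
qed

text \<open>First-order condition: moving \<open>v\<close> in the direction of its residual \<open>y\<close> changes the
  Rayleigh defect \<open>q - \<mu> |.|\<^sup>2\<close> to first order by \<open>2 |y|\<^sup>2\<close>.\<close>

lemma maximiser_is_eigenvector:
  assumes sb: "spectral_bound \<mu>"
    and v: "(\<Sum>i<N. \<Sum>j<N. v i * (a i j * v j)) = \<mu> * (\<Sum>i<N. (v i)\<^sup>2)"
    and i: "i < N"
  shows "(\<Sum>j<N. a i j * v j) = \<mu> * v i"
proof -
  define y where "y i = (\<Sum>j<N. a i j * v j) - \<mu> * v i" for i
  define q where "q x z = (\<Sum>i<N. \<Sum>j<N. x i * (a i j * z j))" for x z :: "nat \<Rightarrow> real"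
  define n where "n x z = (\<Sum>i<N. x i * z i)" for x z :: "nat \<Rightarrow> real"
  define d where "d = q y y - \<mu> * n y y"
  have qs: "q v y = q y v" unfolding q_def
    by (subst sum.swap) (auto intro!: sum.cong simp: a_sym mult_ac)
  have e: "2 * s * n y y + s\<^sup>2 * d \<le> 0" for s
  proof -
    have "q (\<lambda>i. v i + s * y i) (\<lambda>i. v i + s * y i) \<le> \<mu> * n (\<lambda>i. v i + s * y i) (\<lambda>i. v i + s * y i)"
      using sb by (simp add: spectral_bound_def q_def n_def power2_eq_square)
    moreover have "q (\<lambda>i. v i + s * y i) (\<lambda>i. v i + s * y i) = q v v + s * q v y + s * q y v + s\<^sup>2 * q y y"
      by (simp add: q_def algebra_simps sum.distrib sum_distrib_left power2_eq_square)
    moreover have "n (\<lambda>i. v i + s * y i) (\<lambda>i. v i + s * y i) = n v v + 2 * s * n y v + s\<^sup>2 * n y y"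
      by (simp add: n_def algebra_simps sum.distrib sum_distrib_left power2_eq_square)
    moreover have "q v v = \<mu> * n v v" using v by (simp add: q_def n_def power2_eq_square)
    moreover have "q y v - \<mu> * n y v = n y y"
    proof -
      have "q y v = (\<Sum>i<N. y i * (y i + \<mu> * v i))"
        unfolding q_def sum_distrib_left[symmetric] by (simp add: y_def)
      then show ?thesis
        by (simp add: n_def algebra_simps sum.distrib sum_distrib_left)
    qed
    then have "q y v = \<mu> * n y v + n y y" by simp
    ultimately show ?thesis unfolding qs d_def by (simp add: algebra_simps)
  qed
  have n0: "0 \<le> n y y" unfolding n_def by (intro sum_nonneg) auto
  have "n y y = 0"
  proof (rule ccontr)
    assume "n y y \<noteq> 0"
    with n0 have p: "n y y > 0" by simp
    \<comment> \<open>Small enough that s |d| \<le> n y y, so the second-order term cannot undo the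
      first-order gain \<open>2 * s * n y y\<close>.\<close>
    define s where "s = n y y / (\<bar>d\<bar> + 1)"
    have s: "s > 0" using p by (simp add: s_def)
    have "s * \<bar>d\<bar> \<le> s * (\<bar>d\<bar> + 1)" using s by simp
    also have "\<dots> = n y y" by (simp add: s_def add_nonneg_eq_0_iff)
    finally have "s * (s * \<bar>d\<bar>) \<le> s * n y y" using s by (intro mult_left_mono) auto
    moreover have "- (s * (s * \<bar>d\<bar>)) \<le> s\<^sup>2 * d"
      using s abs_ge_minus_self[of d] mult_left_mono[of "- d" "\<bar>d\<bar>" "s * s"] by (simp add: power2_eq_square)
    moreover have "s * n y y > 0" using s p by simp
    ultimately show False using e[of s] by simp
  qed
  then have "y i * y i = 0"
    using i unfolding n_def by (subst (asm) sum_nonneg_eq_0_iff) auto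
  then show ?thesis by (simp add: y_def)
qed

end

lemma coupling_matrix_ising_model:
  fixes \<beta> :: real
  assumes "coupling_matrix N A" "\<beta> > 0"
  shows "ising_model N (\<lambda>i j. A $$ (i, j)) \<beta>"
proof
  fix i j assume ij: "i < N" "j < N"
  have A: "A \<in> carrier_mat N N" "transpose_mat A = A" using assms by (auto simp: coupling_matrix_def)
  have "A $$ (i, j) = transpose_mat A $$ (i, j)" by (simp add: A(2))
  also have "\<dots> = A $$ (j, i)" using A(1) ij by simp
  finally show "A $$ (i, j) = A $$ (j, i)" .
  show "0 \<le> A $$ (i, j)" using assms ij by (auto simp: coupling_matrix_def)
qed (use assms in \<open>auto simp: coupling_matrix_def\<close>)

text \<open>The maximal value of the quadratic form on the sphere is an eigenvalue, hence at most
  the maximum of the spectrum.\<close>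

lemma spectral_bound_lambda_1:
  fixes \<beta> :: real
  assumes A: "coupling_matrix N A" and N: "N > 0" and \<beta>: "\<beta> > 0"
  shows "ising_model.spectral_bound N (\<lambda>i j. A $$ (i, j)) (lambda_1 A)"
proof -
  interpret ising_model N "\<lambda>i j. A $$ (i, j)" \<beta>
    by (rule coupling_matrix_ising_model[OF A \<beta>])
  have carr: "A \<in> carrier_mat N N" using A by (simp add: coupling_matrix_def)
  obtain v \<mu> where v: "(\<Sum>i<N. (v i)\<^sup>2) = 1" "spectral_bound \<mu>"
    "(\<Sum>i<N. \<Sum>j<N. v i * (A $$ (i, j) * v j)) = \<mu>"
    by (rule quadratic_form_maximiser[OF N])
  define w where "w = vec N v"
  have ev: "A *\<^sub>v w = \<mu> \<cdot>\<^sub>v w"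
  proof (rule eq_vecI)
    fix i assume "i < dim_vec (\<mu> \<cdot>\<^sub>v w)"
    then have i: "i < N" by (simp add: w_def)
    have "(A *\<^sub>v w) $ i = (\<Sum>j<N. A $$ (i, j) * v j)"
      using carr i by (simp add: scalar_prod_def w_def atLeast0LessThan)
    also have "\<dots> = \<mu> * v i"
      by (rule maximiser_is_eigenvector[OF v(2) _ i]) (simp add: v)
    finally show "(A *\<^sub>v w) $ i = (\<mu> \<cdot>\<^sub>v w) $ i" using i by (simp add: w_def)
  qed (use carr in \<open>simp add: w_def\<close>)
  have "w \<noteq> 0\<^sub>v N"
  proof
    assume w0: "w = 0\<^sub>v N"
    have "v i = 0" if "i < N" for i
      using arg_cong[OF w0, of "\<lambda>x. x $ i"] that by (simp add: w_def)
    then show False using v(1) by simp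
  qed
  with ev carr have "\<mu> \<in> spectrum A"
    unfolding spectrum_def eigenvalue_def eigenvector_def by (auto simp: w_def intro!: exI[of _ w])
  then have "\<mu> \<le> lambda_1 A"
    unfolding lambda_1_def using card_finite_spectrum(1)[OF carr] by simp
  with v(2) show ?thesis by (rule spectral_bound_mono)
qed

section \<open>From vectors and mass functions to finite sums\<close>

lemma sum_spins:
  "(\<Sum>\<sigma>\<in>spins N. G \<sigma>) = (\<Sum>s\<in>spin_configs N. G (vec N s))"
proof (rule sum.reindex_bij_witness[of _ "\<lambda>s. vec N s" "\<lambda>\<sigma>. restrict (vec_index \<sigma>) {..<N}"])
  fix \<sigma> assume "\<sigma> \<in> spins N"
  then show "vec N (restrict (($) \<sigma>) {..<N}) = \<sigma>" "restrict (($) \<sigma>) {..<N} \<in> spin_configs N"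
    by (auto simp: spins_def spin_configs_def)
  then show "G (vec N (restrict (($) \<sigma>) {..<N})) = G \<sigma>" by simp
next
  fix s assume s: "s \<in> spin_configs N"
  show "restrict (($) (vec N s)) {..<N} = s"
    using s by (auto simp: spin_configs_def PiE_iff extensional_def fun_eq_iff)
  show "vec N s \<in> spins N"
    using spin_cases[OF s] by (auto simp: spins_def)
qed

lemma cdf_ising:
  assumes A: "coupling_matrix N A" and \<beta>: "\<beta> > 0"
  shows "cdf (distr (measure_pmf (ising A \<beta> B)) borel F) x =
    ising_model.E N (\<lambda>i j. A $$ (i, j)) \<beta> B (\<lambda>s. if F (vec N s) \<le> x then 1 else 0)"
proof -
  interpret ising_model N "\<lambda>i j. A $$ (i, j)" \<beta>
    by (rule coupling_matrix_ising_model[OF A \<beta>])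
  have carr: "A \<in> carrier_mat N N" using A by (simp add: coupling_matrix_def)
  have w: "ising_weight A \<beta> B (vec N s) = weight B s" for s
    unfolding ising_weight_def weight_def energy_def
    using carr by (simp add: scalar_prod_def atLeast0LessThan sum_distrib_left)
  have Z: "partition_function A \<beta> B = Z B"
    using carr by (simp add: partition_function_def Z_def sum_spins w)
  have "cdf (distr (measure_pmf (ising A \<beta> B)) borel F) x = measure (measure_pmf (ising A \<beta> B)) {\<sigma>. F \<sigma> \<le> x}"
    unfolding cdf_def by (subst measure_distr) (auto simp: vimage_def)
  also have "\<dots> = measure (measure_pmf (ising A \<beta> B)) ({\<sigma>. F \<sigma> \<le> x} \<inter> spins N)"
  proof (rule measure_prob_cong_0)
    fix \<sigma> assume "\<sigma> \<in> {\<sigma>. F \<sigma> \<le> x} - {\<sigma>. F \<sigma> \<le> x} \<inter> spins N"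
    then show "pmf (ising A \<beta> B) \<sigma> = 0" using carr by (simp add: pmf_ising)
  qed auto
  also have "\<dots> = (\<Sum>\<sigma>\<in>{\<sigma>. F \<sigma> \<le> x} \<inter> spins N. pmf (ising A \<beta> B) \<sigma>)"
    by (rule measure_measure_pmf_finite) (simp add: finite_spins)
  also have "\<dots> = (\<Sum>\<sigma>\<in>spins N. if F \<sigma> \<le> x then pmf (ising A \<beta> B) \<sigma> else 0)"
    by (simp add: sum.inter_filter[symmetric] finite_spins Collect_conj_eq Int_commute)
  also have "\<dots> = (\<Sum>\<sigma>\<in>spins N. ising_weight A \<beta> B \<sigma> / Z B * (if F \<sigma> \<le> x then 1 else 0))"
    using carr by (intro sum.cong) (auto simp: pmf_ising Z)
  also have "\<dots> = E B (\<lambda>s. if F (vec N s) \<le> x then 1 else 0)"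
    unfolding sum_spins w E_def sum_divide_distrib by (rule sum.cong) auto
  finally show ?thesis .
qed

text \<open>The law with variance v is the image of the standard one under multiplication by sqrt
  v.\<close>

lemma cdf_centered_normal:
  assumes "v > 0"
  shows "cdf (centered_normal v) x = \<Phi> (x / sqrt v)"
proof -
  have s: "sqrt v > 0" using assms by simp
  have "distributed std_normal_distribution lborel (\<lambda>x. x) std_normal_density"
    by (auto simp: distributed_def intro!: distr_id2)
  then have "distributed std_normal_distribution lborel (\<lambda>x. 0 + sqrt v * x) (normal_density 0 (sqrt v))"
    using prob_space.normal_density_affine[OF prob_space_normal_density, of 1 0 "\<lambda>x. x" 0 1 "sqrt v" 0] s
    by simp
  then have "centered_normal v = distr std_normal_distribution lborel (\<lambda>x. sqrt v * x)"
    by (simp add: distributed_def centered_normal_def)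
  then have "cdf (centered_normal v) x = measure std_normal_distribution {y. sqrt v * y \<le> x}"
    unfolding cdf_def by (simp add: measure_distr vimage_def)
  also have "{y. sqrt v * y \<le> x} = {..x / sqrt v}"
    using s by (auto simp: field_simps)
  finally show ?thesis by (simp add: cdf_def)
qed

section \<open>The mean-field regimes\<close>

lemma magnetization_Theta11: "(\<beta>, B) \<in> Theta11 \<Longrightarrow> magnetization \<beta> B = 0"
  by (simp add: magnetization_def)

lemma magnetization_Theta12:
  assumes "(\<beta>, B) \<in> Theta12"
  shows "magnetization \<beta> B = tanh (\<beta> * magnetization \<beta> B + B)" "sgn (magnetization \<beta> B) = sgn B"
proof -
  have b: "\<beta> > 0" "B \<noteq> 0" "(\<beta>, B) \<notin> Theta11"
    using assms by (auto simp: Theta12_def Theta11_def)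
  have "magnetization \<beta> B = tanh (\<beta> * magnetization \<beta> B + B) \<and> sgn (magnetization \<beta> B) = sgn B"
    unfolding magnetization_def if_not_P[OF b(3)]
    by (rule theI'[OF ex1_mean_field[OF b(1,2)]])
  then show "magnetization \<beta> B = tanh (\<beta> * magnetization \<beta> B + B)" "sgn (magnetization \<beta> B) = sgn B"
    by auto
qed

text \<open>tanh is odd and t has the sign of B, so absolute values reduce both signs to a positive
  field.\<close>

lemma positive_mean_field_abs:
  assumes "(\<beta>, B) \<in> Theta12" "t = magnetization \<beta> B"
  shows "positive_mean_field \<beta> \<bar>B\<bar> \<bar>t\<bar>"
proof
  have fp: "t = tanh (\<beta> * t + B)" and sg: "sgn t = sgn B" and b: "\<beta> > 0" "B \<noteq> 0"
    using magnetization_Theta12[OF assms(1)] assms by (auto simp: Theta12_def)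
  show "\<beta> > 0" "\<bar>B\<bar> > 0" using b by auto
  show "\<bar>t\<bar> > 0" using sg b(2) by (auto simp: sgn_if split: if_splits)
  have "\<bar>t\<bar> = \<bar>tanh (\<beta> * t + B)\<bar>" using fp by simp
  also have "\<dots> = tanh \<bar>\<beta> * t + B\<bar>" by simp
  also have "\<bar>\<beta> * t + B\<bar> = \<beta> * \<bar>t\<bar> + \<bar>B\<bar>"
  proof (cases "B > 0")
    case True
    then have "t > 0" using sg by (simp add: sgn_if split: if_splits)
    then show ?thesis using True b by simp
  next
    case False
    then have B: "B < 0" using b by simp
    then have t: "t < 0" using sg by (simp add: sgn_if split: if_splits)
    then have "\<beta> * t < 0" using b by (simp add: mult_pos_neg)
    then show ?thesis using B t by simp
  qed
  finally show "\<bar>t\<bar> = tanh (\<beta> * \<bar>t\<bar> + \<bar>B\<bar>)" .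
qed

lemma mean_field_regime:
  assumes "(\<beta>, B) \<in> Theta1" "t = magnetization \<beta> B"
  shows "\<beta> > 0" "t = tanh (\<beta> * t + B)" "\<bar>t\<bar> < 1" "\<beta> * (1 - t\<^sup>2) < 1"
proof -
  show fp: "t = tanh (\<beta> * t + B)"
    using assms magnetization_Theta11 magnetization_Theta12(1)[of \<beta> B]
    by (auto simp: Theta1_def Theta11_def)
  show "\<bar>t\<bar> < 1" using tanh_real_bounds[of "\<beta> * t + B"] by (auto simp flip: fp)
  show "\<beta> > 0" using assms by (auto simp: Theta1_def Theta11_def Theta12_def)
  show "\<beta> * (1 - t\<^sup>2) < 1"
  proof (cases "(\<beta>, B) \<in> Theta11")
    case True
    then show ?thesis using assms by (simp add: magnetization_Theta11) (simp add: Theta11_def)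
  next
    case False
    then interpret positive_mean_field \<beta> "\<bar>B\<bar>" "\<bar>t\<bar>"
      using assms by (intro positive_mean_field_abs) (auto simp: Theta1_def)
    show ?thesis using slope_at_fixed_point by simp
  qed
qed

text \<open>The order of quantifiers is the point: K and \<Lambda> depend on \<beta>, B and R, but
  not on the model. \<Lambda> > 1 leaves room for \<open>lambda_1\<close> to be above its
  limit.\<close>

lemma field_deviation_uniform_bound:
  fixes \<beta> B t R :: real
  assumes reg: "(\<beta>, B) \<in> Theta1" and t: "t = magnetization \<beta> B" and R0: "0 \<le> R"
  shows "\<exists>K \<Lambda>. 0 \<le> K \<and> 1 < \<Lambda> \<and>
    (\<forall>N a. ising_model N a \<beta> \<longrightarrow> (\<forall>i<N. ising_model.degree N a i \<le> R) \<longrightarrow>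
       ising_model.spectral_bound N a \<Lambda> \<longrightarrow>
       ising_model.field_deviation N a \<beta> B t \<le>
         K * (ising_model.F2 N a + (\<Sum>i<N. (ising_model.degree N a i - 1)\<^sup>2)))"
proof -
  have \<beta>: "\<beta> > 0" using mean_field_regime[OF reg t] by simp
  \<comment> \<open>With contraction rate \<rho> < 1, the choice \<Lambda> = 2/(1 + \<rho>) exceeds
    1 and still leaves the gap 1 - \<rho> \<Lambda> = (1 - \<rho>)/(1 + \<rho>), used as
    \<kappa>.\<close>
  have \<Lambda>: "1 < 2 / (1 + \<rho>)" "0 < (1 - \<rho>) / (1 + \<rho>)" "(1 - \<rho>) / (1 + \<rho>) \<le> 1 - \<rho> * (2 / (1 + \<rho>))"
    if "0 \<le> \<rho>" "\<rho> < 1" for \<rho> :: real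
    using that by (auto simp: field_simps)
  show ?thesis
  proof (cases "(\<beta>, B) \<in> Theta11")
    case True
    then have b: "\<beta> < 1" "B = 0" "t = 0" using t by (auto simp: Theta11_def magnetization_Theta11)
    define \<kappa> where "\<kappa> = (1 - \<beta>) / (1 + \<beta>)"
    note l = \<Lambda>[OF less_imp_le[OF \<beta>] b(1), folded \<kappa>_def]
    show ?thesis
    proof (rule exI[of _ "(2 + 2 * \<beta> * R) / \<kappa>\<^sup>2"], rule exI[of _ "2 / (1 + \<beta>)"], intro conjI allI impI)
      show "0 \<le> (2 + 2 * \<beta> * R) / \<kappa>\<^sup>2" using \<beta> R0 by simp
      show "1 < 2 / (1 + \<beta>)" by (rule l)
    next
      fix N a
      assume im: "ising_model N a \<beta>" and d: "\<forall>i<N. ising_model.degree N a i \<le> R"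
        and sb: "ising_model.spectral_bound N a (2 / (1 + \<beta>))"
      interpret ising_model N a \<beta> by (rule im)
      have "\<kappa>\<^sup>2 * field_deviation B t \<le> (2 + 2 * \<beta> * R) * F2"
        unfolding b using d sb l(2,3) by (intro field_deviation_high_temperature) auto
      also have "\<dots> \<le> (2 + 2 * \<beta> * R) * (F2 + (\<Sum>i<N. (degree i - 1)\<^sup>2))"
        using \<beta> R0 by (intro mult_left_mono) (auto intro: sum_nonneg)
      finally show "field_deviation B t \<le> (2 + 2 * \<beta> * R) / \<kappa>\<^sup>2 * (F2 + (\<Sum>i<N. (degree i - 1)\<^sup>2))"
        using l(2) by (simp add: field_simps)
    qed
  next
    case False
    then have b: "(\<beta>, B) \<in> Theta12" using reg by (simp add: Theta1_def)
    interpret mf: positive_mean_field \<beta> "\<bar>B\<bar>" "\<bar>t\<bar>" by (rule positive_mean_field_abs[OF b t])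
    define \<rho> where "\<rho> = 1 - tanh \<bar>B\<bar> / \<bar>t\<bar>"
    have \<rho>: "0 \<le> \<rho>" "\<rho> < 1" using mf.tanh_h mf.t unfolding \<rho>_def by (auto simp: field_simps)
    define \<kappa> where "\<kappa> = (1 - \<rho>) / (1 + \<rho>)"
    note l = \<Lambda>[OF \<rho>, folded \<kappa>_def]
    define K where "K = ((\<kappa>\<^sup>2 + 2 * R\<^sup>2 * \<beta>\<^sup>2) * (2 / \<bar>B\<bar>) + 2 * t\<^sup>2) / \<kappa>\<^sup>2"
    show ?thesis
    proof (rule exI[of _ K], rule exI[of _ "2 / (1 + \<rho>)"], intro conjI allI impI)
      show "0 \<le> K" unfolding K_def by simp
      show "1 < 2 / (1 + \<rho>)" by (rule l)
    next
      fix N a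
      assume im: "ising_model N a \<beta>" and d: "\<forall>i<N. ising_model.degree N a i \<le> R"
        and sb: "ising_model.spectral_bound N a (2 / (1 + \<rho>))"
      interpret ising_model N a \<beta> by (rule im)
      define C where "C = (\<Sum>i<N. (degree i - 1)\<^sup>2)"
      have C: "0 \<le> C" unfolding C_def by (intro sum_nonneg) auto
      have sgn: "B > 0 \<and> \<bar>B\<bar> = B \<and> \<bar>t\<bar> = t \<or> \<bar>B\<bar> = - B \<and> \<bar>t\<bar> = - t"
        using magnetization_Theta12(2)[OF b] t by (auto simp: sgn_if split: if_splits)
      \<comment> \<open>Spin reversal, in case B is negative.\<close>
      have "field_deviation B t = field_deviation \<bar>B\<bar> \<bar>t\<bar>"
        using sgn field_deviation_minus[of B t] by auto
      also have "\<kappa>\<^sup>2 * \<dots> \<le> (\<kappa>\<^sup>2 + 2 * R\<^sup>2 * \<beta>\<^sup>2) * (2 / \<bar>B\<bar> * F2) + 2 * \<bar>t\<bar>\<^sup>2 * C"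
        unfolding C_def
        by (rule field_deviation_positive_field[OF d[rule_format] sb \<rho>(1) _ l(2,3) mf.h])
          (simp_all only: \<rho>_def mf.contraction)
      also have "\<dots> \<le> ((\<kappa>\<^sup>2 + 2 * R\<^sup>2 * \<beta>\<^sup>2) * (2 / \<bar>B\<bar>)) * (F2 + C) + 2 * t\<^sup>2 * (F2 + C)"
      proof (rule add_mono)
        have "((\<kappa>\<^sup>2 + 2 * R\<^sup>2 * \<beta>\<^sup>2) * (2 / \<bar>B\<bar>)) * F2 \<le> ((\<kappa>\<^sup>2 + 2 * R\<^sup>2 * \<beta>\<^sup>2) * (2 / \<bar>B\<bar>)) * (F2 + C)"
          using C by (intro mult_left_mono) auto
        then show "(\<kappa>\<^sup>2 + 2 * R\<^sup>2 * \<beta>\<^sup>2) * (2 / \<bar>B\<bar> * F2) \<le> ((\<kappa>\<^sup>2 + 2 * R\<^sup>2 * \<beta>\<^sup>2) * (2 / \<bar>B\<bar>)) * (F2 + C)"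
          by (simp only: mult.assoc)
        show "2 * \<bar>t\<bar>\<^sup>2 * C \<le> 2 * t\<^sup>2 * (F2 + C)"
          using F2_nonneg by (simp add: mult_left_mono)
      qed
      also have "\<dots> = \<kappa>\<^sup>2 * (K * (F2 + C))"
        using l(2) by (simp add: K_def distrib_right)
      finally show "field_deviation B t \<le> K * (F2 + (\<Sum>i<N. (degree i - 1)\<^sup>2))"
        using l(2) by (simp add: C_def)
    qed
  qed
qed

lemma dKS_le: "(\<And>x. \<bar>cdf \<mu> x - cdf \<nu> x\<bar> \<le> c) \<Longrightarrow> dKS \<mu> \<nu> \<le> c"
  unfolding dKS_def by (rule cSUP_least) auto
theorem theorem1p1:
  fixes \<beta> B t \<tau> :: real and A :: "nat \<Rightarrow> real mat"
  assumes "(\<beta>, B) \<in> Theta1"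
    and "\<And>N. N \<ge> 1 \<Longrightarrow> coupling_matrix N (A N)"
    and "lesssim (\<lambda>N. MAX i\<in>{..<N}. row_sum (A N) i) (\<lambda>N. 1)"
    and "(\<lambda>N. lambda_1 (A N)) \<longlonglongrightarrow> 1"
    and "t = magnetization \<beta> B"
    and "\<tau> = (1 - t\<^sup>2) / (1 - \<beta> * (1 - t\<^sup>2))"
  shows "lesssim
    (\<lambda>N. dKS (distr (measure_pmf (ising (A N) \<beta> B)) borel (\<lambda>\<sigma>. sqrt (real N) * (spin_mean \<sigma> - t)))
             (centered_normal \<tau>))
    (\<lambda>N. 1 / sqrt (real N) *
       ((frobenius_norm (A N))\<^sup>2 + (\<Sum>i<N. (row_sum (A N) i - 1)\<^sup>2)
        + \<bar>t\<bar> * \<bar>\<Sum>i<N. (row_sum (A N) i - 1)\<bar>))"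
proof -
  note reg = mean_field_regime[OF assms(1,5)]
  obtain C0 where C0: "\<forall>N\<ge>1. (MAX i\<in>{..<N}. row_sum (A N) i) \<le> C0 * 1"
    using assms(3) unfolding lesssim_def by blast
  \<comment> \<open>The maximum with 0 keeps the constants built from R nonnegative.\<close>
  define R where "R = max C0 0"
  have R: "row_sum (A N) i \<le> R" if "i < N" for i N
  proof -
    have "row_sum (A N) i \<le> (MAX i\<in>{..<N}. row_sum (A N) i)" using that by (intro Max_ge) auto
    also have "\<dots> \<le> R" using C0[rule_format, of N] that by (auto simp: R_def)
    finally show ?thesis .
  qed
  have R0: "0 \<le> R" by (simp add: R_def)
  obtain K \<Lambda> where K: "0 \<le> K" "1 < \<Lambda>"
    "\<forall>N a. ising_model N a \<beta> \<longrightarrow> (\<forall>i<N. ising_model.degree N a i \<le> R) \<longrightarrow>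
       ising_model.spectral_bound N a \<Lambda> \<longrightarrow>
       ising_model.field_deviation N a \<beta> B t \<le>
         K * (ising_model.F2 N a + (\<Sum>i<N. (ising_model.degree N a i - 1)\<^sup>2))"
    using field_deviation_uniform_bound[OF assms(1,5) R0]
    by (elim exE conjE) (rule that, assumption+)
  have "\<forall>\<^sub>F N in sequentially. lambda_1 (A N) < \<Lambda>"
    using order_tendstoD(2)[OF assms(4) K(2)] .
  then obtain N0 where N0: "\<And>N. N \<ge> N0 \<Longrightarrow> lambda_1 (A N) < \<Lambda>"
    by (auto simp: eventually_sequentially)
  \<comment> \<open>The first entry serves N \<ge> N0, where \<open>lambda_1\<close> is below
    \<Lambda>. The second serves smaller N, where the distance is at most 1 \<le> 2 D, and 2 D is 2
    sqrt N times D / sqrt N.\<close>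
  define C where "C = max (berry_esseen_setting.berry_esseen_const \<beta> t R K) (2 * sqrt N0)"
  have \<tau>: "\<tau> > 0" using reg(3,4) assms(6) by (simp add: abs_square_less_1)
  show ?thesis
    unfolding lesssim_def
  proof (intro exI[of _ C] allI impI dKS_le)
    fix N :: nat and x :: real
    assume N: "1 \<le> N"
    define a where "a = (\<lambda>i j. A N $$ (i, j))"
    interpret ising_model N a \<beta>
      unfolding a_def using assms(2)[OF N] reg(1) by (rule coupling_matrix_ising_model)
    have dim: "dim_row (A N) = N" "dim_col (A N) = N"
      using assms(2)[OF N] by (auto simp: coupling_matrix_def)
    have a: "A N $$ (i, j) = a i j" for i j
      by (simp add: a_def)
    have deg: "row_sum (A N) i = degree i" for i
      unfolding row_sum_def degree_def dim a ..
    have frob: "(frobenius_norm (A N))\<^sup>2 = F2"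
      unfolding frobenius_norm_def F2_def dim a by (intro real_sqrt_pow2 sum_nonneg) auto
    define D where "D = F2 + (\<Sum>i<N. (degree i - 1)\<^sup>2) + \<bar>t\<bar> * \<bar>\<Sum>i<N. (degree i - 1)\<bar>"
    define S where "S s = (\<Sum>i<N. s i) - real N * t" for s :: "nat \<Rightarrow> real"
    define \<mu> where "\<mu> = distr (measure_pmf (ising (A N) \<beta> B)) borel (\<lambda>\<sigma>. sqrt (real N) * (spin_mean \<sigma> - t))"
    have D1: "1 \<le> 2 * D"
    proof -
      have "1 \<le> 2 * (F2 + (\<Sum>i<N. (degree i - 1)\<^sup>2))"
        using N by (intro one_le_F2_plus_degree_deviation) simp
      also have "\<dots> \<le> 2 * D" by (simp add: D_def)
      finally show ?thesis .
    qed
    \<comment> \<open>Dividing by sqrt \<tau> turns the event into the one for the standardised sum;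
      the normal law is rescaled alike.\<close>
    have ev: "sqrt N * (spin_mean (vec N s) - t) \<le> x \<longleftrightarrow> S s / sqrt (real N * \<tau>) \<le> x / sqrt \<tau>" for s
    proof -
      define w v where "w = sqrt N" and "v = sqrt \<tau>"
      have wv: "w > 0" "real N = w * w" "v > 0" "sqrt (real N * \<tau>) = w * v"
        using N \<tau> by (simp_all add: w_def v_def real_sqrt_mult)
      have "spin_mean (vec N s) - t = S s / real N"
        using N by (simp add: spin_mean_def S_def diff_divide_distrib)
      then have "w * (spin_mean (vec N s) - t) = S s / w"
        unfolding wv(2) using wv(1) by simp
      moreover have "S s / w \<le> x \<longleftrightarrow> S s / (w * v) \<le> x / v"
        using wv(1,3) by (simp add: field_simps)
      ultimately show ?thesis unfolding wv(4) w_def[symmetric] v_def[symmetric] by simp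
    qed
    have cdf\<mu>: "cdf \<mu> x = E B (\<lambda>s. if S s / sqrt (real N * \<tau>) \<le> x / sqrt \<tau> then 1 else 0)"
      unfolding \<mu>_def cdf_ising[OF assms(2)[OF N] reg(1)] ev a_def ..
    note cdf\<nu> = cdf_centered_normal[OF \<tau>]
    have "\<bar>cdf \<mu> x - cdf (centered_normal \<tau>) x\<bar> \<le> C * (D / sqrt N)"
    proof (cases "N \<ge> N0")
      case True
      have sb: "spectral_bound \<Lambda>"
      proof (rule spectral_bound_mono)
        show "spectral_bound (lambda_1 (A N))"
          unfolding a_def by (rule spectral_bound_lambda_1[OF assms(2)[OF N] _ reg(1)]) (use N in simp)
        show "lambda_1 (A N) \<le> \<Lambda>" using N0[OF True] by simp
      qed
      have degR: "degree i \<le> R" if "i < N" for i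
        using R[OF that] by (simp only: deg)
      interpret be: berry_esseen_setting N a \<beta> B t R K
      proof
        show "field_deviation B t \<le> K * (F2 + (\<Sum>i<N. (degree i - 1)\<^sup>2))"
          by (rule K(3)[rule_format, OF ising_model_axioms degR sb])
        show "t = tanh (\<beta> * t + B)" by (rule reg(2))
      qed (use N reg(3,4) R0 K(1) degR in simp_all)
      have be: "be.S = S" "be.D = D" "be.\<tau> = \<tau>"
        unfolding be.S_def[abs_def] S_def[abs_def] be.D_def be.C2_def D_def be.\<tau>_def be.\<theta>_def
        by (rule refl, rule refl, rule assms(6)[symmetric])
      have "\<bar>cdf \<mu> x - cdf (centered_normal \<tau>) x\<bar> \<le> be.berry_esseen_const * (D / sqrt N)"
        using be.kolmogorov_distance_le[of "x / sqrt \<tau>"] unfolding cdf\<mu> cdf\<nu> be .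
      also have "\<dots> \<le> C * (D / sqrt N)"
        using D1 by (intro mult_right_mono) (simp_all add: C_def)
      finally show ?thesis .
    next
      case False
      have "0 \<le> cdf \<mu> x" unfolding cdf\<mu> by (rule E_nonneg) simp
      moreover have "cdf \<mu> x \<le> E B (\<lambda>_. 1)" unfolding cdf\<mu> by (rule E_mono) simp
      ultimately have "\<bar>cdf \<mu> x - cdf (centered_normal \<tau>) x\<bar> \<le> 1"
        unfolding cdf\<nu> E_const
        using std_normal_cdf_nonneg[of "x / sqrt \<tau>"] std_normal_cdf_le_1[of "x / sqrt \<tau>"] by linarith
      also have "1 \<le> 2 * D" by (rule D1)
      also have "2 * D = 2 * sqrt N * (D / sqrt N)" using N by simp
      also have "\<dots> \<le> C * (D / sqrt N)"
      proof (rule mult_right_mono)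
        have "sqrt N \<le> sqrt N0" using False by simp
        then show "2 * sqrt N \<le> C" unfolding C_def by linarith
      qed (use D1 in simp)
      finally show ?thesis .
    qed
    then show "\<bar>cdf (distr (measure_pmf (ising (A N) \<beta> B)) borel (\<lambda>\<sigma>. sqrt (real N) * (spin_mean \<sigma> - t))) x
        - cdf (centered_normal \<tau>) x\<bar> \<le> C * (1 / sqrt (real N) *
       ((frobenius_norm (A N))\<^sup>2 + (\<Sum>i<N. (row_sum (A N) i - 1)\<^sup>2)
        + \<bar>t\<bar> * \<bar>\<Sum>i<N. (row_sum (A N) i - 1)\<bar>))"
      unfolding frob deg D_def[symmetric] \<mu>_def by (simp only: times_divide_eq_left mult_1_left)
  qed
qed

end
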